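(* Let $\kappa$ be an irreducible kernel on a ground space $(\mathcal S,\mu)$ such that $$\sup_{x}\int_{\mathcal S}\kappa(x,y)^2\,d\mu(y)<\infty ,$$ and let $c_0:=\|T_\kappa\|^{-1}>0$. Write $\rho(c)=\rho(c\kappa)$ for $c>0$, and let $\rho'_+$ denote the right derivative of $\rho$. Then $c_0\rho'_+(c_0)\le 2$, with equality in the classical Erdős–Rényi case; more precisely, equality holds if and only if $\int_{\mathcal S}\kappa(x,y)\,d\mu(y)=1$ for a.e. $x$.
   Context: A ground space is a pair $(\mathcal S,\mu)$, where $\mathcal S$ is a separable metric space and $\mu$ is a Borel probability measure on $\mathcal S$; "a.e." means $\mu$-a.e. (or $\mu\times\mu$-a.e. on $\mathcal S\times\mathcal S$). A kernel on $(\mathcal S,\mu)$ is a symmetric non-negative Borel measurable function on $\mathcal S\times\mathcal S$. It is irreducible if $A\subseteq\mathcal S$ measurable and $\kappa=0$ a.e. on $A\times(\mathcal S\setminus A)$ imply $\mu(A)=0$ or $\mu(\mathcal S\setminus A)=0$. $(T_\kappa f)(x)=\int_{\mathcal S}\kappa(x,y)f(y)\,d\mu(y)$, and $\|T_\kappa\|=\sup\{\|T_\kappa f\|_{L^2(\mu)}: f\ge0,\ \|f\|_{L^2(\mu)}\le1\}$. Branching process. $\mathfrak X_\kappa(x)$ is the multi-type Galton–Watson process with type space $\mathcal S$ started with one particle of type $x$, in which the children of a particle of type $y$ form a Poisson process on $\mathcal S$ with intensity $\kappa(y,z)\,d\mu(z)$. $\rho(\kappa;x)$ is the probability that $\mathfrak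 X_\kappa(x)$ survives for ever (every generation non-empty), and $\rho(\kappa)=\int_{\mathcal S}\rho(\kappa;x)\,d\mu(x)$. The classical Erdős–Rényi case is $\kappa=1$ identically, so that the kernel $c\kappa$ corresponds to the random graph $G(n,c/n)$ on $n$ vertices with independent edges, each present with probability $c/n$.
   Formalization: The equality criterion fails unless ‖T_κ‖=1 (κ≡2 gives equality with ∫κ=2); it is corrected to: equality iff ∫c_0κ(x,y)dμ(y)=1 for a.e. x; also, ∫κ(x,y)dμ(y)=1 a.e. iff c_0=1 and equality holds. ‖T_κ‖≠0 is assumed so that c_0 is a real number. *)

theory Defs
  imports "HOL-Probability.Probability"
begin

section \<open>Ground spaces, kernels and the operator \<open>T\<^sub>\<kappa>\<close>\<close>

text \<open>For metric spaces, second countability is the same as separability.\<close>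

definition ground_space :: "'s::{metric_space, second_countable_topology} measure \<Rightarrow> bool" where
  "ground_space \<mu> \<longleftrightarrow> sets \<mu> = sets borel \<and> prob_space \<mu>"

definition kernel_fun :: "('s::{metric_space, second_countable_topology} \<Rightarrow> 's \<Rightarrow> real) \<Rightarrow> bool" where
  "kernel_fun \<kappa> \<longleftrightarrow>
     (\<lambda>(x, y). \<kappa> x y) \<in> borel_measurable (borel :: ('s \<times> 's) measure) \<and>
     (\<forall>x y. \<kappa> x y = \<kappa> y x) \<and> (\<forall>x y. 0 \<le> \<kappa> x y)"

definition irreducible_kernel :: "'s measure \<Rightarrow> ('s \<Rightarrow> 's \<Rightarrow> real) \<Rightarrow> bool" where
  "irreducible_kernel \<mu> \<kappa> \<longleftrightarrow>
     (\<forall>A\<in>sets \<mu>.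
        (AE (x, y) in \<mu> \<Otimes>\<^sub>M \<mu>. x \<in> A \<and> y \<in> space \<mu> - A \<longrightarrow> \<kappa> x y = 0) \<longrightarrow>
        emeasure \<mu> A = 0 \<or> emeasure \<mu> (space \<mu> - A) = 0)"

text \<open>Non-negative functions are taken with values in \<open>[0, \<infinity>]\<close>, so that \<open>T\<^sub>\<kappa> f\<close> and its norm
  always make sense.\<close>

definition kernel_op :: "'s measure \<Rightarrow> ('s \<Rightarrow> 's \<Rightarrow> real) \<Rightarrow> ('s \<Rightarrow> ennreal) \<Rightarrow> 's \<Rightarrow> ennreal" where
  "kernel_op \<mu> \<kappa> f x = (\<integral>\<^sup>+ y. ennreal (\<kappa> x y) * f y \<partial>\<mu>)"

definition L2norm :: "'s measure \<Rightarrow> ('s \<Rightarrow> ennreal) \<Rightarrow> ennreal" where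
  "L2norm \<mu> f =
     (let I = \<integral>\<^sup>+ x. (f x)\<^sup>2 \<partial>\<mu> in if I = \<infinity> then \<infinity> else ennreal (sqrt (enn2real I)))"

definition kernel_op_norm :: "'s measure \<Rightarrow> ('s \<Rightarrow> 's \<Rightarrow> real) \<Rightarrow> ennreal" where
  "kernel_op_norm \<mu> \<kappa> =
     (SUP f\<in>{f \<in> borel_measurable \<mu>. L2norm \<mu> f \<le> 1}. L2norm \<mu> (kernel_op \<mu> \<kappa> f))"


section \<open>Poisson processes as random finite lists of points\<close>

text \<open>A finite configuration of points, counted with multiplicity, is represented by a list; the
  order of the entries carries no information. The generators of the \<open>\<sigma>\<close>-algebra are the
  products \<open>A\<^sub>1 \<times> \<dots> \<times> A\<^sub>n\<close> of measurable sets.\<close>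

definition list_space :: "'a measure \<Rightarrow> 'a list measure" where
  "list_space M = sigma (lists (space M)) (listset ` lists (sets M))"

primrec iid_list :: "nat \<Rightarrow> 'a measure \<Rightarrow> 'a list measure" where
  "iid_list 0 P = return (list_space P) []"
| "iid_list (Suc n) P = P \<bind> (\<lambda>x. iid_list n P \<bind> (\<lambda>xs. return (list_space P) (x # xs)))"

text \<open>The Poisson process with finite intensity measure \<open>\<nu>\<close>: a Poisson number of points with mean
  \<open>\<nu>(S)\<close>, placed independently according to \<open>\<nu> / \<nu>(S)\<close>. The constant \<open>poisson_pmf\<close> is specified
  only for positive rates, hence the case distinction.\<close>

definition poisson_process :: "'a measure \<Rightarrow> 'a list measure" where
  "poisson_process \<nu> =
     measure_pmf (if measure \<nu> (space \<nu>) = 0 then return_pmf 0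
                  else poisson_pmf (measure \<nu> (space \<nu>)))
       \<bind> (\<lambda>n. iid_list n (scale_measure (1 / emeasure \<nu> (space \<nu>)) \<nu>))"


section \<open>The branching process\<close>

text \<open>The construction is meaningful for kernels with \<open>\<integral> \<kappa>(x,y) d\<mu>(y) < \<infinity>\<close> for every \<open>x\<close>, so that every
  generation is finite. Since \<open>\<mu>\<close> is a probability measure, this follows from
  \<open>\<integral> \<kappa>(x,y)\<^sup>2 d\<mu>(y) < \<infinity>\<close> for every \<open>x\<close>.\<close>

definition offspring :: "'s measure \<Rightarrow> ('s \<Rightarrow> 's \<Rightarrow> real) \<Rightarrow> 's \<Rightarrow> 's list measure" where
  "offspring \<mu> \<kappa> y = poisson_process (density \<mu> (\<lambda>z. ennreal (\<kappa> y z)))"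

primrec next_generation ::
    "'s measure \<Rightarrow> ('s \<Rightarrow> 's \<Rightarrow> real) \<Rightarrow> 's list \<Rightarrow> 's list measure" where
  "next_generation \<mu> \<kappa> [] = return (list_space \<mu>) []"
| "next_generation \<mu> \<kappa> (y # ys) =
     offspring \<mu> \<kappa> y \<bind> (\<lambda>zs. next_generation \<mu> \<kappa> ys \<bind> (\<lambda>ws. return (list_space \<mu>) (zs @ ws)))"

text \<open>Conditional law of generation \<open>n\<close> given the generations \<open>\<omega> 0, \<dots>, \<omega> (n - 1)\<close>.\<close>

definition generation_step ::
    "'s measure \<Rightarrow> ('s \<Rightarrow> 's \<Rightarrow> real) \<Rightarrow> 's \<Rightarrow> nat \<Rightarrow> (nat \<Rightarrow> 's list) \<Rightarrow> 's list measure" where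
  "generation_step \<mu> \<kappa> x n \<omega> =
     (case n of 0 \<Rightarrow> return (list_space \<mu>) [x] | Suc m \<Rightarrow> next_generation \<mu> \<kappa> (\<omega> m))"

text \<open>The law of the whole sequence of generations, by the Ionescu--Tulcea theorem.\<close>

definition branching_process ::
    "'s measure \<Rightarrow> ('s \<Rightarrow> 's \<Rightarrow> real) \<Rightarrow> 's \<Rightarrow> (nat \<Rightarrow> 's list) measure" where
  "branching_process \<mu> \<kappa> x =
     projective_family.lim UNIV
       (Ionescu_Tulcea.CI (generation_step \<mu> \<kappa> x) (\<lambda>_. list_space \<mu>)) (\<lambda>_. list_space \<mu>)"

definition survival_prob_at :: "'s measure \<Rightarrow> ('s \<Rightarrow> 's \<Rightarrow> real) \<Rightarrow> 's \<Rightarrow> real" where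
  "survival_prob_at \<mu> \<kappa> x =
     measure (branching_process \<mu> \<kappa> x)
       {\<omega> \<in> space (branching_process \<mu> \<kappa> x). \<forall>n. \<omega> n \<noteq> []}"

definition survival_prob :: "'s measure \<Rightarrow> ('s \<Rightarrow> 's \<Rightarrow> real) \<Rightarrow> real" where
  "survival_prob \<mu> \<kappa> = (\<integral>x. survival_prob_at \<mu> \<kappa> x \<partial>\<mu>)"

end

(*
  Let f_c(x) be the survival probability of the process with kernel c kappa started at x. Generating
  functions show that f_c is the limit of the iterates, started from 1, of f -> 1 - exp (- c T f).
  Normalise T to have norm 1, so that c = 1 is critical.

  A positive bounded eigenfunction psi of T is obtained without weak compactness. The numbers
  |T^k g|^2 decrease in k, so the sequence (T^(2n+1) g)(y) converges at every y, and its limit h gives the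
  eigenfunction h + T h. Taking for g the rows K2(x, .) of the kernel of T^2, the integral over x of
  |T^k K2(x, .)|^2 is the squared Hilbert-Schmidt norm of T^(k+2) and hence at least 1, so the limit is
  non-zero for some x. The same convergence, with simplicity of the eigenvalue 1, shows that
  (T^(2n+1) + T^(2n+2)) / 2 tends to the projection onto psi in Hilbert-Schmidt norm. This replaces a
  spectral gap for 1, and since T f_c - f_c = o(|f_c|) as c decreases to 1, f_c is asymptotically
  proportional to psi.

  Pairing the fixed point equation with psi then gives the slope
  2 (int psi) (int psi^2) / (int psi^3), which is compared with 2 through
  int psi^3 - m int psi^2 = int (psi - m)^2 (psi + m), where m = int psi.
*)
theory Submission
  imports Defs
begin

section \<open>Lists of points and Poisson processes\<close>

text \<open>The analysis uses genuine bounded measurable functions rather than classes.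
  Cauchy-Schwarz on the rows of the kernel gives \<open>\<bar>T f x\<bar> \<le> B * nrm f\<close> at
  every point, so one application of \<open>T\<close> turns convergence in L2 into pointwise
  convergence, and \<open>T\<close> maps functions that agree almost everywhere to functions that
  agree everywhere. The kernel itself may be unbounded, but the kernel of \<open>T\<close> composed
  with itself is bounded by \<open>B\<^sup>2\<close>; its rows therefore have uniformly bounded
  iterates, and dominated convergence applies. Odd and even powers are averaged because -1 may be an
  eigenvalue, as for a bipartite kernel, and then the powers of \<open>T\<close> alone need not
  converge. The survival functions must be shown to vanish at criticality: pairing the fixed point
  equation with \<psi> bounds the integral of f^2 \<psi> by a multiple of c - 1, and \<psi> > 0
  almost everywhere removes the weight. Conversely 0 solves the fixed point equation for every c, so
  positivity above criticality comes from a small multiple of \<psi> that stays below all iterates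
  started at 1.\<close>

lemma mem_listset_iff: "xs \<in> listset As \<longleftrightarrow> list_all2 (\<in>) xs As"
  by (induction As arbitrary: xs) (auto simp: set_Cons_def list_all2_Cons2)

lemma space_list_space [simp]: "space (list_space M) = lists (space M)"
  by (simp add: list_space_def space_measure_of_conv)

lemma sets_list_space:
  "sets (list_space M) = sigma_sets (lists (space M)) (listset ` lists (sets M))"
  unfolding list_space_def
proof (rule sets_measure_of)
  have *: "y \<in> space M" if "xs \<in> listset As" "set As \<subseteq> sets M" "y \<in> set xs" for As xs y
  proof -
    from that(3) obtain i where i: "i < length xs" "xs ! i = y"
      by (auto simp: in_set_conv_nth)
    with that(1) have "y \<in> As ! i" "As ! i \<in> set As"
      by (auto simp: mem_listset_iff list_all2_conv_all_nth)
    with that(2) show ?thesis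
      using sets.sets_into_space by blast
  qed
  show "listset ` lists (sets M) \<subseteq> Pow (lists (space M))"
  proof (intro image_subsetI PowI subsetI)
    fix As xs assume "As \<in> lists (sets M)" "xs \<in> listset As"
    then show "xs \<in> lists (space M)"
      unfolding lists_eq_set mem_Collect_eq using *[of xs As] by blast
  qed
qed

lemma list_space_cong: "sets M = sets N \<Longrightarrow> list_space M = list_space N"
  using sets_eq_imp_space_eq[of M N] by (simp add: list_space_def)

lemma listset_in_sets_list_space: "set As \<subseteq> sets M \<Longrightarrow> listset As \<in> sets (list_space M)"
  unfolding sets_list_space by (intro sigma_sets.Basic imageI) auto

lemma Nil_in_sets_list_space [measurable]: "{[]} \<in> sets (list_space M)"
  using listset_in_sets_list_space[of "[]" M] by simp

text \<open>The boxes \<open>listset As\<close> generate the \<sigma>-algebra of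
  \<open>list_space\<close>, and lying in a box is the entrywise relation \<open>list_all2\<close>;
  so preimages of boxes suffice.\<close>

lemma measurable_list_spaceI:
  assumes "\<And>x. x \<in> space N \<Longrightarrow> set (f x) \<subseteq> space M"
    and "\<And>As. set As \<subseteq> sets M \<Longrightarrow> {x \<in> space N. list_all2 (\<in>) (f x) As} \<in> sets N"
  shows "f \<in> measurable N (list_space M)"
proof (rule measurable_sigma_sets[OF sets_list_space])
  show "listset ` lists (sets M) \<subseteq> Pow (lists (space M))"
    using sets.sets_into_space[OF listset_in_sets_list_space[of _ M]] by (auto simp: lists_eq_set)
  show "f \<in> space N \<rightarrow> lists (space M)"
    using assms(1) by (auto simp: lists_eq_set)
  fix B assume "B \<in> listset ` lists (sets M)"
  then obtain As where As: "B = listset As" "set As \<subseteq> sets M"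
    by (auto simp: lists_eq_set)
  have "f -` B \<inter> space N = {x \<in> space N. list_all2 (\<in>) (f x) As}"
    by (auto simp: As mem_listset_iff)
  with assms(2)[OF As(2)] show "f -` B \<inter> space N \<in> sets N" by simp
qed

lemma measurable_Cons_list_space [measurable]:
  "(\<lambda>(x, xs). x # xs) \<in> measurable (M \<Otimes>\<^sub>M list_space M) (list_space M)"
proof (rule measurable_list_spaceI)
  fix As assume As: "set As \<subseteq> sets M"
  show "{p \<in> space (M \<Otimes>\<^sub>M list_space M). list_all2 (\<in>) (case p of (x, xs) \<Rightarrow> x # xs) As}
      \<in> sets (M \<Otimes>\<^sub>M list_space M)"
  proof (cases As)
    case (Cons B Bs)
    have "{p \<in> space (M \<Otimes>\<^sub>M list_space M). list_all2 (\<in>) (case p of (x, xs) \<Rightarrow> x # xs) As}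
        = B \<times> listset Bs"
      using As sets.sets_into_space[of B M] sets.sets_into_space[OF listset_in_sets_list_space[of Bs M]]
      by (auto simp: Cons space_pair_measure mem_listset_iff)
    then show ?thesis
      using As Cons by (auto intro!: pair_measureI listset_in_sets_list_space)
  qed (simp add: case_prod_beta)
qed (auto simp: space_pair_measure)

text \<open>The cut point \<open>k\<close> is bounded by the length, so that the preimage of a box
  under concatenation is a finite union of products of boxes.\<close>

lemma list_all2_append1_iff:
  "list_all2 P (xs @ ys) zs \<longleftrightarrow>
     (\<exists>k\<le>length zs. list_all2 P xs (take k zs) \<and> list_all2 P ys (drop k zs))"
proof
  assume H: "list_all2 P (xs @ ys) zs"
  then show "\<exists>k\<le>length zs. list_all2 P xs (take k zs) \<and> list_all2 P ys (drop k zs)"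
    unfolding list_all2_append1
    by (metis append_eq_conv_conj le_add1 length_append list_all2_lengthD)
next
  assume "\<exists>k\<le>length zs. list_all2 P xs (take k zs) \<and> list_all2 P ys (drop k zs)"
  then show "list_all2 P (xs @ ys) zs"
    by (metis append_take_drop_id list_all2_appendI)
qed

lemma measurable_append_list_space [measurable]:
  "(\<lambda>(xs, ys). xs @ ys) \<in> measurable (list_space M \<Otimes>\<^sub>M list_space M) (list_space M)"
proof (rule measurable_list_spaceI)
  fix As assume As: "set As \<subseteq> sets M"
  have sub: "set (take k As) \<subseteq> sets M" "set (drop k As) \<subseteq> sets M" for k
    using As set_take_subset[of k As] set_drop_subset[of k As] by auto
  have "{p \<in> space (list_space M \<Otimes>\<^sub>M list_space M). list_all2 (\<in>) (case p of (xs, ys) \<Rightarrow> xs @ ys) As}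
      = (\<Union>k\<in>{..length As}. listset (take k As) \<times> listset (drop k As))"
    (is "_ = ?U")
  proof
    have "listset (take k As) \<times> listset (drop k As) \<subseteq> lists (space M) \<times> lists (space M)" for k
      using sets.sets_into_space[OF listset_in_sets_list_space[OF sub(1)]]
        sets.sets_into_space[OF listset_in_sets_list_space[OF sub(2)]]
      unfolding space_list_space by (rule Sigma_mono)
    then have "?U \<subseteq> space (list_space M \<Otimes>\<^sub>M list_space M)"
      unfolding space_pair_measure space_list_space by (intro UN_least)
    then show "?U \<subseteq> {p \<in> space (list_space M \<Otimes>\<^sub>M list_space M).
        list_all2 (\<in>) (case p of (xs, ys) \<Rightarrow> xs @ ys) As}"
      by (auto simp: mem_listset_iff list_all2_append1_iff)
  qed (auto simp: list_all2_append1_iff mem_listset_iff)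
  also have "\<dots> \<in> sets (list_space M \<Otimes>\<^sub>M list_space M)"
    using sub by (intro sets.finite_UN pair_measureI listset_in_sets_list_space) auto
  finally show "{p \<in> space (list_space M \<Otimes>\<^sub>M list_space M).
      list_all2 (\<in>) (case p of (xs, ys) \<Rightarrow> xs @ ys) As} \<in> sets (list_space M \<Otimes>\<^sub>M list_space M)" .
qed (auto simp: space_pair_measure)

lemma list_all2_replicate2: "list_all2 P xs (replicate n y) \<longleftrightarrow> length xs = n \<and> (\<forall>x\<in>set xs. P x y)"
  by (auto simp: list_all2_conv_all_nth all_set_conv_all_nth)

lemma sets_list_space_length:
  "{xs \<in> space (list_space M). length xs = n} \<in> sets (list_space M)"
proof -
  have "{xs \<in> space (list_space M). length xs = n} = listset (replicate n (space M))"
    by (auto simp: mem_listset_iff list_all2_replicate2)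
  then show ?thesis
    by (simp add: listset_in_sets_list_space set_replicate_conv_if)
qed

lemma measurable_tl_list_space: "tl \<in> measurable (list_space M) (list_space M)"
proof (rule measurable_list_spaceI)
  fix As assume As: "set As \<subseteq> sets M"
  \<comment> \<open>Since \<open>tl [] = []\<close>, the empty list is an extra member of the
    preimage exactly when \<open>As\<close> is empty.\<close>
  have "{xs \<in> space (list_space M). list_all2 (\<in>) (tl xs) As}
     = listset (space M # As) \<union> (if As = [] then {[]} else {})"
  proof (intro set_eqI)
    fix xs
    show "xs \<in> {xs \<in> space (list_space M). list_all2 (\<in>) (tl xs) As} \<longleftrightarrow>
      xs \<in> listset (space M # As) \<union> (if As = [] then {[]} else {})"
      using sets.sets_into_space[OF listset_in_sets_list_space[OF As]]
      by (cases xs) (auto simp: mem_listset_iff set_Cons_def)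
  qed
  also have "\<dots> \<in> sets (list_space M)"
    using As by (intro sets.Un listset_in_sets_list_space) auto
  finally show "{xs \<in> space (list_space M). list_all2 (\<in>) (tl xs) As} \<in> sets (list_space M)" .
next
  fix xs assume "xs \<in> space (list_space M)"
  then show "set (tl xs) \<subseteq> space M" by (cases xs) auto
qed

text \<open>\<open>hd []\<close> is unspecified, hence the restriction to non-empty lists; with the
  length fixed, each preimage is a single box.\<close>

lemma measurable_hd_list_space:
  "hd \<in> measurable (restrict_space (list_space M) {xs. length xs = Suc n}) M"
proof (rule measurableI)
  fix xs assume "xs \<in> space (restrict_space (list_space M) {xs. length xs = Suc n})"
  then show "hd xs \<in> space M"
    by (cases xs) (auto simp: space_restrict_space)
next
  fix A assume A: "A \<in> sets M"
  have *: "hd -` A \<inter> space (restrict_space (list_space M) {xs. length xs = Suc n})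
      = listset (A # replicate n (space M))"
  proof (intro set_eqI)
    fix xs
    show "xs \<in> hd -` A \<inter> space (restrict_space (list_space M) {xs. length xs = Suc n}) \<longleftrightarrow>
      xs \<in> listset (A # replicate n (space M))"
      using sets.sets_into_space[OF A]
      by (cases xs) (auto simp: mem_listset_iff set_Cons_def list_all2_replicate2 space_restrict_space)
  qed
  have "listset (A # replicate n (space M)) \<in> sets (list_space M)"
    using A by (intro listset_in_sets_list_space) (auto simp: set_replicate_conv_if)
  moreover have "listset (A # replicate n (space M)) \<subseteq> {xs. length xs = Suc n}"
    by (auto simp: mem_listset_iff dest!: list_all2_lengthD simp del: listset.simps)
  ultimately show "hd -` A \<inter> space (restrict_space (list_space M) {xs. length xs = Suc n})
      \<in> sets (restrict_space (list_space M) {xs. length xs = Suc n})"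
    unfolding * sets_restrict_space by blast
qed

text \<open>Structural recursion is handled on the lists of one length at a time, by induction on
  the length through \<open>hd\<close> and \<open>tl\<close>; these sets are measurable and
  countably many. Both products over lists and the kernel \<open>next_generation\<close> are of this
  form.\<close>

lemma measurable_list_rec:
  fixes f :: "'a list \<Rightarrow> 'b"
  assumes f0: "f [] \<in> space N"
    and g: "(\<lambda>(x, y). g x y) \<in> measurable (M \<Otimes>\<^sub>M N) N"
    and f: "\<And>x xs. f (x # xs) = g x (f xs)"
  shows "f \<in> measurable (list_space M) N"
proof -
  let ?L = "\<lambda>n. {xs :: 'a list. length xs = n}"
  have len: "f \<in> measurable (restrict_space (list_space M) (?L n)) N" for n
  proof (induction n)
    case 0
    have "f \<in> measurable (restrict_space (list_space M) (?L 0)) N \<longleftrightarrow>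
        (\<lambda>_. f []) \<in> measurable (restrict_space (list_space M) (?L 0)) N"
      by (intro measurable_cong) (auto simp: space_restrict_space)
    with f0 show ?case by simp
  next
    case (Suc n)
    have hd: "hd \<in> measurable (restrict_space (list_space M) (?L (Suc n))) M"
      by (rule measurable_hd_list_space)
    have tl: "tl \<in> measurable (restrict_space (list_space M) (?L (Suc n)))
        (restrict_space (list_space M) (?L n))"
      by (intro measurable_restrict_space2 measurable_restrict_space1 measurable_tl_list_space)
         (auto simp: space_restrict_space)
    have "(\<lambda>xs. (\<lambda>(x, y). g x y) (hd xs, f (tl xs)))
        \<in> measurable (restrict_space (list_space M) (?L (Suc n))) N"
      by (rule measurable_compose[OF _ g])
         (intro measurable_Pair hd measurable_compose[OF tl Suc])
    moreover have "f \<in> measurable (restrict_space (list_space M) (?L (Suc n))) N \<longleftrightarrow>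
        (\<lambda>xs. (\<lambda>(x, y). g x y) (hd xs, f (tl xs)))
          \<in> measurable (restrict_space (list_space M) (?L (Suc n))) N"
    proof (intro measurable_cong)
      fix xs assume "xs \<in> space (restrict_space (list_space M) (?L (Suc n)))"
      then show "f xs = (\<lambda>(x, y). g x y) (hd xs, f (tl xs))"
        by (cases xs) (auto simp: space_restrict_space f)
    qed
    ultimately show ?case by simp
  qed
  show ?thesis
  proof (rule measurable_piecewise_restrict[where C = "range ?L"])
    show "\<And>\<Omega>. \<Omega> \<in> range ?L \<Longrightarrow> \<Omega> \<inter> space (list_space M) \<in> sets (list_space M)"
      using sets_list_space_length[of M] by (auto simp: Int_def conj_commute)
  qed (use len in auto)
qed

lemma measurable_prod_list_map [measurable]:
  fixes g :: "'a \<Rightarrow> ennreal"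
  assumes [measurable]: "g \<in> borel_measurable M"
  shows "(\<lambda>xs. prod_list (map g xs)) \<in> borel_measurable (list_space M)"
  by (rule measurable_list_rec[where g = "\<lambda>x y. g x * y"]) (auto intro!: borel_measurable_times_ennreal)

section \<open>Independent samples and the generating functional of a Poisson process\<close>

lemma measurable_iid_list:
  "iid_list n \<in> measurable (subprob_algebra M) (subprob_algebra (list_space M))"
proof (induction n)
  case 0
  have "iid_list 0 \<in> measurable (subprob_algebra M) (subprob_algebra (list_space M)) \<longleftrightarrow>
     (\<lambda>_. return (list_space M) []) \<in> measurable (subprob_algebra M) (subprob_algebra (list_space M))"
    by (intro measurable_cong) (auto simp: space_subprob_algebra intro!: arg_cong2[where f = return] list_space_cong)
  moreover have "return (list_space M) [] \<in> space (subprob_algebra (list_space M))"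
    by (auto simp: space_subprob_algebra intro!: subprob_space_return)
  ultimately show ?case by (simp del: iid_list.simps)
next
  case (Suc n)
  note [measurable] = Suc
  have "iid_list (Suc n) \<in> measurable (subprob_algebra M) (subprob_algebra (list_space M)) \<longleftrightarrow>
     (\<lambda>P. P \<bind> (\<lambda>x. iid_list n P \<bind> (\<lambda>xs. return (list_space M) (x # xs))))
       \<in> measurable (subprob_algebra M) (subprob_algebra (list_space M))"
    by (intro measurable_cong) (auto simp: space_subprob_algebra dest!: list_space_cong)
  also have "\<dots>"
    by measurable
  finally show ?case .
qed

lemma iid_list_in_subprob_algebra:
  "P \<in> space (subprob_algebra M) \<Longrightarrow> iid_list n P \<in> space (subprob_algebra (list_space M))"
  by (rule measurable_space[OF measurable_iid_list])

text \<open>Independence of the entries turns the expected product into a power. Sub-probabilities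
  are allowed because the normalisation of a zero intensity is the zero measure.\<close>

lemma nn_integral_iid_list:
  fixes g :: "'a \<Rightarrow> ennreal"
  assumes P: "P \<in> space (subprob_algebra M)" and g [measurable]: "g \<in> borel_measurable M"
  shows "(\<integral>\<^sup>+ xs. prod_list (map g xs) \<partial>iid_list n P) = (\<integral>\<^sup>+ x. g x \<partial>P) ^ n"
proof (induction n)
  have sets_P [measurable_cong, simp]: "sets P = sets M"
    using P by (simp add: space_subprob_algebra)
  have L: "list_space P = list_space M"
    using sets_P by (rule list_space_cong)
  {
    case 0
    show ?case by (simp add: L nn_integral_return)
  next
    case (Suc n)
    have iid: "iid_list n P \<in> space (subprob_algebra (list_space M))"
      by (rule iid_list_in_subprob_algebra[OF P])
    have sets_iid [measurable_cong, simp]: "sets (iid_list n P) = sets (list_space M)"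
      using iid by (simp add: space_subprob_algebra)
    have space_iid: "space (iid_list n P) = lists (space M)"
      using sets_eq_imp_space_eq[OF sets_iid] by simp
    have space_P: "space P = space M"
      using sets_eq_imp_space_eq[OF sets_P] by simp
    have iid_const: "(\<lambda>_. iid_list n P) \<in> measurable P (subprob_algebra (list_space M))"
      using iid by simp
    have inner: "(\<integral>\<^sup>+ xs. prod_list (map g xs) \<partial>(iid_list n P \<bind> (\<lambda>xs. return (list_space M) (x # xs))))
        = g x * (\<integral>\<^sup>+ x. g x \<partial>P) ^ n" if x: "x \<in> space M" for x
    proof -
      have [measurable]: "(\<lambda>xs. x # xs) \<in> measurable (list_space M) (list_space M)"
        using measurable_compose[OF measurable_Pair1'[OF x] measurable_Cons_list_space] by simp
      have "(\<integral>\<^sup>+ xs. prod_list (map g xs) \<partial>(iid_list n P \<bind> (\<lambda>xs. return (list_space M) (x # xs))))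
         = (\<integral>\<^sup>+ xs. g x * prod_list (map g xs) \<partial>iid_list n P)"
        using x by (subst nn_integral_bind[where B = "list_space M"])
          (auto simp: space_iid nn_integral_return intro!: nn_integral_cong)
      also have "\<dots> = g x * (\<integral>\<^sup>+ x. g x \<partial>P) ^ n"
        by (subst nn_integral_cmult) (simp_all add: Suc)
      finally show ?thesis .
    qed
    have "(\<lambda>x. iid_list n P \<bind> (\<lambda>xs. return (list_space M) (x # xs)))
        \<in> measurable P (subprob_algebra (list_space M))"
      by (rule measurable_bind[OF iid_const]) measurable
    then have "(\<integral>\<^sup>+ xs. prod_list (map g xs) \<partial>iid_list (Suc n) P)
       = (\<integral>\<^sup>+ x. g x * (\<integral>\<^sup>+ x. g x \<partial>P) ^ n \<partial>P)"
      unfolding iid_list.simps L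
      by (subst nn_integral_bind[where B = "list_space M"])
        (auto simp: space_P intro!: nn_integral_cong inner)
    also have "\<dots> = (\<integral>\<^sup>+ x. g x \<partial>P) * (\<integral>\<^sup>+ x. g x \<partial>P) ^ n"
      by (subst nn_integral_multc) auto
    finally show ?case by simp
  }
qed

lemma normalized_in_subprob_algebra:
  assumes "finite_measure \<nu>" "sets \<nu> = sets M" "space M \<noteq> {}"
  shows "scale_measure (1 / emeasure \<nu> (space \<nu>)) \<nu> \<in> space (subprob_algebra M)"
proof -
  interpret finite_measure \<nu> by fact
  have "space \<nu> = space M"
    using assms(2) by (rule sets_eq_imp_space_eq)
  moreover have "(1 / emeasure \<nu> (space \<nu>)) * emeasure \<nu> (space \<nu>) \<le> 1"
    by (cases "emeasure \<nu> (space \<nu>) = 0")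
      (simp_all add: ennreal_divide_times less_top[symmetric])
  ultimately show ?thesis
    using assms by (auto simp: space_subprob_algebra space_scale_measure intro!: subprob_spaceI)
qed

text \<open>Names the case distinction in \<open>poisson_process\<close>; with
  \<open>0 ^ 0 = 1\<close> the usual mass function then covers rate 0 as well.\<close>

definition poisson_count :: "real \<Rightarrow> nat pmf" where
  "poisson_count \<Lambda> = (if \<Lambda> = 0 then return_pmf 0 else poisson_pmf \<Lambda>)"

lemma pmf_poisson_count: "0 \<le> \<Lambda> \<Longrightarrow> pmf (poisson_count \<Lambda>) n = \<Lambda> ^ n / fact n * exp (- \<Lambda>)"
  by (auto simp: poisson_count_def pmf_return power_0_left)

text \<open>Given n points, the expected product is the n-th power of the integral of
  \<open>q\<close> against the normalised intensity; averaging over a Poisson number of points sums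
  the exponential series. This is the classical formula in which the exponent is minus the
  \<nu>-integral of 1 - q.\<close>

lemma nn_integral_poisson_process:
  fixes q :: "'a \<Rightarrow> ennreal"
  assumes fin: "finite_measure \<nu>" and sets_\<nu>: "sets \<nu> = sets M" and ne: "space M \<noteq> {}"
    and q [measurable]: "q \<in> borel_measurable M" and r: "(\<integral>\<^sup>+ x. q x \<partial>\<nu>) = ennreal r" "0 \<le> r"
  shows "(\<integral>\<^sup>+ xs. prod_list (map q xs) \<partial>poisson_process \<nu>)
    = ennreal (exp (r - measure \<nu> (space \<nu>)))"
proof -
  interpret finite_measure \<nu> by fact
  define \<Lambda> where "\<Lambda> = measure \<nu> (space \<nu>)"
  define P where "P = scale_measure (1 / emeasure \<nu> (space \<nu>)) \<nu>"
  have \<Lambda>: "0 \<le> \<Lambda>" "emeasure \<nu> (space \<nu>) = ennreal \<Lambda>"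
    by (simp_all add: \<Lambda>_def emeasure_eq_measure)
  have P: "P \<in> space (subprob_algebra M)"
    unfolding P_def by (rule normalized_in_subprob_algebra[OF fin sets_\<nu> ne])
  have q\<nu> [measurable]: "q \<in> borel_measurable \<nu>"
    using q by (simp add: measurable_cong_sets[OF sets_\<nu> refl])
  have "(\<integral>\<^sup>+ x. q x \<partial>P) = (1 / ennreal \<Lambda>) * ennreal r"
    unfolding P_def by (simp add: nn_integral_scale_measure r \<Lambda>)
  then have q_P: "(\<integral>\<^sup>+ x. q x \<partial>P) = ennreal (r / \<Lambda>)" if "\<Lambda> \<noteq> 0"
    using that r \<Lambda> by (simp add: divide_ennreal flip: ennreal_1 ennreal_mult)
  have summand: "ennreal (pmf (poisson_count \<Lambda>) n) * (\<integral>\<^sup>+ x. q x \<partial>P) ^ n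
      = ennreal (exp (- \<Lambda>) * (r ^ n / fact n))" for n
  \<comment> \<open>For \<open>\<Lambda> = 0\<close> the intensity vanishes, so \<open>r = 0\<close>
    and only the term \<open>n = 0\<close> survives.\<close>
  proof (cases "\<Lambda> = 0")
    case True
    then have "(\<integral>\<^sup>+ x. q x \<partial>\<nu>) = 0"
      using \<Lambda> by (subst nn_integral_0_iff) (auto intro!: emeasure_eq_0[of "space \<nu>" \<nu>])
    then have "r = 0" using r by simp
    with True show ?thesis
      by (cases n) (auto simp: pmf_poisson_count)
  next
    case False
    then show ?thesis
      using \<Lambda>(1) r(2)
      by (simp add: q_P pmf_poisson_count power_divide ennreal_power flip: ennreal_mult)
  qed
  have meas: "(\<lambda>n. iid_list n P) \<in> measurable (measure_pmf (poisson_count \<Lambda>)) (subprob_algebra (list_space M))"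
    using iid_list_in_subprob_algebra[OF P] by auto
  have "(\<integral>\<^sup>+ xs. prod_list (map q xs) \<partial>poisson_process \<nu>)
     = (\<integral>\<^sup>+ xs. prod_list (map q xs) \<partial>(measure_pmf (poisson_count \<Lambda>) \<bind> (\<lambda>n. iid_list n P)))"
    by (simp add: poisson_process_def poisson_count_def P_def \<Lambda>_def)
  also have "\<dots> = (\<integral>\<^sup>+ n. (\<integral>\<^sup>+ x. q x \<partial>P) ^ n \<partial>measure_pmf (poisson_count \<Lambda>))"
    by (subst nn_integral_bind[OF _ meas]) (simp_all add: nn_integral_iid_list[OF P])
  also have "\<dots> = (\<Sum>n. ennreal (exp (- \<Lambda>) * (r ^ n / fact n)))"
    by (simp add: nn_integral_measure_pmf nn_integral_count_space_nat summand)
  also have "\<dots> = ennreal (exp (- \<Lambda>) * exp r)"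
  proof (rule suminf_ennreal_eq)
    show "(\<lambda>n. exp (- \<Lambda>) * (r ^ n / fact n)) sums (exp (- \<Lambda>) * exp r)"
      using exp_converges[of r] by (intro sums_mult) (simp add: divide_inverse mult.commute)
  qed (use r in auto)
  finally show ?thesis
    by (simp add: \<Lambda>_def exp_diff exp_minus divide_inverse mult.commute)
qed

section \<open>The branching process\<close>

locale poisson_branching = prob_space \<mu> for \<mu> :: "'a measure" +
  fixes \<kappa> :: "'a \<Rightarrow> 'a \<Rightarrow> real"
  assumes measurable_kernel: "(\<lambda>(x, y). \<kappa> x y) \<in> borel_measurable (\<mu> \<Otimes>\<^sub>M \<mu>)"
    and kernel_nonneg: "0 \<le> \<kappa> x y"
    and finite_intensity: "x \<in> space \<mu> \<Longrightarrow> (\<integral>\<^sup>+ y. ennreal (\<kappa> x y) \<partial>\<mu>) < \<infinity>"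
begin

lemma measurable_kernel2 [measurable (raw)]:
  assumes "f \<in> measurable N \<mu>" "g \<in> measurable N \<mu>"
  shows "(\<lambda>x. \<kappa> (f x) (g x)) \<in> borel_measurable N"
  using measurable_compose[OF measurable_Pair[OF assms] measurable_kernel] by simp

lemma measurable_kernel_section:
  assumes x: "x \<in> space \<mu>" shows "\<kappa> x \<in> borel_measurable \<mu>"
  using measurable_compose[OF measurable_Pair1'[OF x] measurable_kernel] by simp

lemma integrable_kernel: "x \<in> space \<mu> \<Longrightarrow> integrable \<mu> (\<kappa> x)"
  using finite_intensity[of x]
  by (intro integrableI_bounded measurable_kernel_section) (simp_all add: kernel_nonneg)

lemma integrable_kernel_mult:
  assumes x: "x \<in> space \<mu>" and [measurable]: "f \<in> borel_measurable \<mu>" and f: "\<And>y. \<bar>f y\<bar> \<le> 1"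
  shows "integrable \<mu> (\<lambda>y. \<kappa> x y * f y)"
proof (rule Bochner_Integration.integrable_bound[OF integrable_kernel[OF x]])
  have [measurable]: "\<kappa> x \<in> borel_measurable \<mu>"
    by (rule measurable_kernel_section[OF x])
  show "(\<lambda>y. \<kappa> x y * f y) \<in> borel_measurable \<mu>" by simp
  show "AE y in \<mu>. norm (\<kappa> x y * f y) \<le> norm (\<kappa> x y)"
    using f by (auto simp: abs_mult kernel_nonneg mult_left_le)
qed

definition intensity :: "'a \<Rightarrow> 'a measure" where
  "intensity x = density \<mu> (\<lambda>z. ennreal (\<kappa> x z))"

lemma space_intensity [simp]: "space (intensity x) = space \<mu>"
  and sets_intensity [simp]: "sets (intensity x) = sets \<mu>"
  by (simp_all add: intensity_def)

lemma emeasure_intensity: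
  assumes x: "x \<in> space \<mu>" and A: "A \<in> sets \<mu>"
  shows "emeasure (intensity x) A = (\<integral>\<^sup>+ z\<in>A. ennreal (\<kappa> x z) \<partial>\<mu>)"
  unfolding intensity_def using measurable_kernel_section[OF x] A
  by (subst emeasure_density) auto

lemma finite_measure_intensity:
  assumes x: "x \<in> space \<mu>" shows "finite_measure (intensity x)"
proof (rule finite_measureI)
  have "(\<integral>\<^sup>+ z\<in>space \<mu>. ennreal (\<kappa> x z) \<partial>\<mu>) = (\<integral>\<^sup>+ z. ennreal (\<kappa> x z) \<partial>\<mu>)"
    by (intro nn_integral_cong) simp
  then show "emeasure (intensity x) (space (intensity x)) \<noteq> \<infinity>"
    using finite_intensity[OF x] by (simp add: emeasure_intensity[OF x])
qed

lemma measure_intensity_space: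
  assumes x: "x \<in> space \<mu>"
  shows "measure (intensity x) (space \<mu>) = (\<integral>z. \<kappa> x z \<partial>\<mu>)"
proof -
  have "emeasure (intensity x) (space \<mu>) = (\<integral>\<^sup>+ z. ennreal (\<kappa> x z) \<partial>\<mu>)"
    by (auto simp: emeasure_intensity[OF x] intro!: nn_integral_cong)
  also have "\<dots> = ennreal (\<integral>z. \<kappa> x z \<partial>\<mu>)"
    using integrable_kernel[OF x] kernel_nonneg by (intro nn_integral_eq_integral) auto
  finally show ?thesis
    by (intro measure_eq_emeasure_eq_ennreal) (auto simp: kernel_nonneg)
qed

lemma offspring_eq: "offspring \<mu> \<kappa> x = poisson_process (intensity x)"
  by (simp add: offspring_def intensity_def)

abbreviation (input) pgf :: "('a \<Rightarrow> real) \<Rightarrow> 'a list \<Rightarrow> ennreal" where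
  "pgf q zs \<equiv> prod_list (map (\<lambda>z. ennreal (q z)) zs)"

text \<open>The generating functional of the Poisson offspring of \<open>x\<close>. If
  \<open>q z\<close> is the probability that the line of a child of type \<open>z\<close> is extinct
  after n generations, this is the probability that the line of \<open>x\<close> is extinct after n
  + 1.\<close>

definition gen_op :: "('a \<Rightarrow> real) \<Rightarrow> 'a \<Rightarrow> real" where
  "gen_op q x = exp (- (\<integral>z. \<kappa> x z * (1 - q z) \<partial>\<mu>))"

lemma nn_integral_offspring:
  assumes x: "x \<in> space \<mu>" and q [measurable]: "q \<in> borel_measurable \<mu>"
    and q01: "\<And>z. 0 \<le> q z" "\<And>z. q z \<le> 1"
  shows "(\<integral>\<^sup>+ zs. pgf q zs \<partial>offspring \<mu> \<kappa> x) = ennreal (gen_op q x)"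
proof -
  note [measurable] = measurable_kernel_section[OF x]
  have int: "integrable \<mu> (\<lambda>z. \<kappa> x z * q z)"
    using q01 by (intro integrable_kernel_mult x) auto
  have "(\<integral>\<^sup>+ z. ennreal (q z) \<partial>intensity x) = (\<integral>\<^sup>+ z. ennreal (\<kappa> x z * q z) \<partial>\<mu>)"
    unfolding intensity_def by (subst nn_integral_density) (auto simp: ennreal_mult kernel_nonneg q01)
  also have "\<dots> = ennreal (\<integral>z. \<kappa> x z * q z \<partial>\<mu>)"
    using int by (intro nn_integral_eq_integral) (auto simp: kernel_nonneg q01)
  finally have "(\<integral>\<^sup>+ zs. pgf q zs \<partial>offspring \<mu> \<kappa> x)
      = ennreal (exp ((\<integral>z. \<kappa> x z * q z \<partial>\<mu>) - (\<integral>z. \<kappa> x z \<partial>\<mu>)))"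
    unfolding offspring_eq
    by (subst nn_integral_poisson_process[where M = \<mu>])
      (auto simp: finite_measure_intensity[OF x] not_empty kernel_nonneg q01 measure_intensity_space[OF x]
        intro!: Bochner_Integration.integral_nonneg)
  also have "(\<integral>z. \<kappa> x z * q z \<partial>\<mu>) - (\<integral>z. \<kappa> x z \<partial>\<mu>) = - (\<integral>z. \<kappa> x z * (1 - q z) \<partial>\<mu>)"
    using int integrable_kernel[OF x] by (simp add: right_diff_distrib)
  finally show ?thesis by (simp add: gen_op_def)
qed

lemma measurable_normalized_intensity:
  "(\<lambda>x. scale_measure (1 / emeasure (intensity x) (space (intensity x))) (intensity x))
    \<in> measurable \<mu> (subprob_algebra \<mu>)"
    (is "?P \<in> _")
proof (rule measurable_subprob_algebra)
  fix x assume "x \<in> space \<mu>"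
  then have "?P x
      \<in> space (subprob_algebra \<mu>)"
    by (intro normalized_in_subprob_algebra finite_measure_intensity) (auto simp: not_empty)
  then show "subprob_space (?P x)"
    "sets (?P x) = sets \<mu>"
    by (auto simp: space_subprob_algebra)
next
  fix A assume A [measurable]: "A \<in> sets \<mu>"
  have "(\<lambda>x. (1 / (\<integral>\<^sup>+ z\<in>space \<mu>. ennreal (\<kappa> x z) \<partial>\<mu>)) * (\<integral>\<^sup>+ z\<in>A. ennreal (\<kappa> x z) \<partial>\<mu>))
      \<in> borel_measurable \<mu>"
    by measurable
  then show "(\<lambda>x. emeasure (?P x) A)
      \<in> borel_measurable \<mu>"
    by (subst measurable_cong[where g = "\<lambda>x. (1 / (\<integral>\<^sup>+ z\<in>space \<mu>. ennreal (\<kappa> x z) \<partial>\<mu>)) * (\<integral>\<^sup>+ z\<in>A. ennreal (\<kappa> x z) \<partial>\<mu>)"])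
      (auto simp: emeasure_scale_measure emeasure_intensity)
qed

lemma measurable_poisson_count:
  "(\<lambda>x. measure_pmf (poisson_count (\<integral>z. \<kappa> x z \<partial>\<mu>))) \<in> measurable \<mu> (subprob_algebra (count_space UNIV))"
proof (rule measurable_subprob_algebra)
  fix A :: "nat set"
  have [measurable]: "(\<lambda>x. ennreal (pmf (poisson_count (\<integral>z. \<kappa> x z \<partial>\<mu>)) n)) \<in> borel_measurable \<mu>" for n
    by (simp add: pmf_poisson_count kernel_nonneg integral_nonneg_AE)
  have "emeasure (measure_pmf (poisson_count (\<integral>z. \<kappa> x z \<partial>\<mu>))) A
      = (\<Sum>n. ennreal (pmf (poisson_count (\<integral>z. \<kappa> x z \<partial>\<mu>)) n) * indicator A n)" for x
  proof -
    have "emeasure (measure_pmf (poisson_count (\<integral>z. \<kappa> x z \<partial>\<mu>))) A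
        = (\<integral>\<^sup>+ n. indicator A n \<partial>measure_pmf (poisson_count (\<integral>z. \<kappa> x z \<partial>\<mu>)))"
      by simp
    also have "\<dots> = (\<Sum>n. ennreal (pmf (poisson_count (\<integral>z. \<kappa> x z \<partial>\<mu>)) n) * indicator A n)"
      unfolding nn_integral_measure_pmf nn_integral_count_space_nat ..
    finally show ?thesis .
  qed
  then show "(\<lambda>x. emeasure (measure_pmf (poisson_count (\<integral>z. \<kappa> x z \<partial>\<mu>))) A) \<in> borel_measurable \<mu>"
    by simp
qed (auto intro!: prob_space_imp_subprob_space prob_space_measure_pmf)

text \<open>The law is a mixture, over a Poisson number n, of the laws of n independent points. Rate
  and normalised intensity depend measurably on the type, as Ionescu-Tulcea requires of a transition
  kernel.\<close>

lemma measurable_offspring [measurable]: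
  "offspring \<mu> \<kappa> \<in> measurable \<mu> (subprob_algebra (list_space \<mu>))"
proof -
  let ?P = "\<lambda>x. scale_measure (1 / emeasure (intensity x) (space (intensity x))) (intensity x)"
  note [measurable] = measurable_poisson_count
  have [measurable]: "(\<lambda>(x, n). iid_list n (?P x))
      \<in> measurable (\<mu> \<Otimes>\<^sub>M count_space UNIV) (subprob_algebra (list_space \<mu>))"
    by (subst measurable_pair_swap_iff, rule measurable_pair_measure_countable1)
      (auto intro: measurable_compose[OF measurable_normalized_intensity measurable_iid_list]
        simp del: space_intensity)
  have "(\<lambda>x. measure_pmf (poisson_count (\<integral>z. \<kappa> x z \<partial>\<mu>)) \<bind> (\<lambda>n. iid_list n (?P x)))
      \<in> measurable \<mu> (subprob_algebra (list_space \<mu>))"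
    by (rule measurable_bind[OF measurable_poisson_count]) measurable
  then show ?thesis
    by (subst measurable_cong[where g = "\<lambda>x. measure_pmf (poisson_count (\<integral>z. \<kappa> x z \<partial>\<mu>)) \<bind> (\<lambda>n. iid_list n (?P x))"])
      (auto simp: offspring_eq poisson_process_def poisson_count_def measure_intensity_space)
qed

lemma measurable_next_generation [measurable]:
  "next_generation \<mu> \<kappa> \<in> measurable (list_space \<mu>) (subprob_algebra (list_space \<mu>))"
proof (rule measurable_list_rec)
  show "next_generation \<mu> \<kappa> [] \<in> space (subprob_algebra (list_space \<mu>))"
    by (auto simp: space_subprob_algebra intro!: subprob_space_return)
  show "(\<lambda>(y, L). offspring \<mu> \<kappa> y \<bind> (\<lambda>zs. L \<bind> (\<lambda>ws. return (list_space \<mu>) (zs @ ws))))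
      \<in> measurable (\<mu> \<Otimes>\<^sub>M subprob_algebra (list_space \<mu>)) (subprob_algebra (list_space \<mu>))"
    by measurable
qed simp

lemma sets_next_generation:
  "ys \<in> lists (space \<mu>) \<Longrightarrow> sets (next_generation \<mu> \<kappa> ys) = sets (list_space \<mu>)"
  using measurable_space[OF measurable_next_generation, of ys] by (simp add: space_subprob_algebra)

lemma sets_offspring: "y \<in> space \<mu> \<Longrightarrow> sets (offspring \<mu> \<kappa> y) = sets (list_space \<mu>)"
  using measurable_space[OF measurable_offspring, of y] by (simp add: space_subprob_algebra)

lemma nn_integral_next_generation_Cons:
  assumes y: "y \<in> space \<mu>" and ys: "ys \<in> lists (space \<mu>)"
    and g [measurable]: "g \<in> borel_measurable (list_space \<mu>)"
  shows "(\<integral>\<^sup>+ zs. g zs \<partial>next_generation \<mu> \<kappa> (y # ys))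
    = (\<integral>\<^sup>+ zs. (\<integral>\<^sup>+ ws. g (zs @ ws) \<partial>next_generation \<mu> \<kappa> ys) \<partial>offspring \<mu> \<kappa> y)"
proof -
  note [simp, measurable_cong] = sets_next_generation[OF ys] sets_offspring[OF y]
  have sp [simp]: "space (next_generation \<mu> \<kappa> ys) = lists (space \<mu>)" "space (offspring \<mu> \<kappa> y) = lists (space \<mu>)"
    using sets_eq_imp_space_eq[OF sets_next_generation[OF ys]] sets_eq_imp_space_eq[OF sets_offspring[OF y]]
    by simp_all
  have [simp]: "next_generation \<mu> \<kappa> ys \<in> space (subprob_algebra (list_space \<mu>))"
    by (rule measurable_space[OF measurable_next_generation]) (use ys in simp)
  have "(\<lambda>_. next_generation \<mu> \<kappa> ys) \<in> measurable (offspring \<mu> \<kappa> y) (subprob_algebra (list_space \<mu>))"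
    by simp
  then have m: "(\<lambda>zs. next_generation \<mu> \<kappa> ys \<bind> (\<lambda>ws. return (list_space \<mu>) (zs @ ws)))
      \<in> measurable (offspring \<mu> \<kappa> y) (subprob_algebra (list_space \<mu>))"
    by (rule measurable_bind) measurable
  have "(\<integral>\<^sup>+ zs. g zs \<partial>next_generation \<mu> \<kappa> (y # ys))
    = (\<integral>\<^sup>+ zs. (\<integral>\<^sup>+ ws. g ws \<partial>(next_generation \<mu> \<kappa> ys \<bind> (\<lambda>ws. return (list_space \<mu>) (zs @ ws)))) \<partial>offspring \<mu> \<kappa> y)"
    unfolding next_generation.simps by (rule nn_integral_bind[OF g m])
  also have "\<dots> = (\<integral>\<^sup>+ zs. (\<integral>\<^sup>+ ws. g (zs @ ws) \<partial>next_generation \<mu> \<kappa> ys) \<partial>offspring \<mu> \<kappa> y)"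
  proof (rule nn_integral_cong)
    fix zs assume "zs \<in> space (offspring \<mu> \<kappa> y)"
    then have zs: "zs \<in> space (list_space \<mu>)" by simp
    have app [measurable]: "(\<lambda>ws. zs @ ws) \<in> measurable (list_space \<mu>) (list_space \<mu>)"
      using measurable_compose[OF measurable_Pair1'[OF zs] measurable_append_list_space] by simp
    have "(\<lambda>ws. return (list_space \<mu>) (zs @ ws)) \<in> measurable (next_generation \<mu> \<kappa> ys) (subprob_algebra (list_space \<mu>))"
      by measurable
    then have "(\<integral>\<^sup>+ ws. g ws \<partial>(next_generation \<mu> \<kappa> ys \<bind> (\<lambda>ws. return (list_space \<mu>) (zs @ ws))))
      = (\<integral>\<^sup>+ ws. (\<integral>\<^sup>+ us. g us \<partial>return (list_space \<mu>) (zs @ ws)) \<partial>next_generation \<mu> \<kappa> ys)"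
      by (rule nn_integral_bind[OF g])
    also have "\<dots> = (\<integral>\<^sup>+ ws. g (zs @ ws) \<partial>next_generation \<mu> \<kappa> ys)"
      using zs by (intro nn_integral_cong) (auto simp: nn_integral_return)
    finally show "(\<integral>\<^sup>+ ws. g ws \<partial>(next_generation \<mu> \<kappa> ys \<bind> (\<lambda>ws. return (list_space \<mu>) (zs @ ws))))
      = (\<integral>\<^sup>+ ws. g (zs @ ws) \<partial>next_generation \<mu> \<kappa> ys)" .
  qed
  finally show ?thesis .
qed

text \<open>Branching property: different parents have independent families, so their offspring
  functionals multiply.\<close>

lemma nn_integral_next_generation:
  assumes ys: "ys \<in> lists (space \<mu>)" and q [measurable]: "q \<in> borel_measurable \<mu>"
    and q01: "\<And>z. 0 \<le> q z" "\<And>z. q z \<le> 1"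
  shows "(\<integral>\<^sup>+ zs. pgf q zs \<partial>next_generation \<mu> \<kappa> ys)
    = pgf (gen_op q) ys"
  using ys
proof (induction ys)
  case Nil
  then show ?case by (simp add: nn_integral_return)
next
  case (Cons y ys)
  then have y: "y \<in> space \<mu>" and ys: "ys \<in> lists (space \<mu>)" by auto
  note [simp, measurable_cong] = sets_next_generation[OF ys] sets_offspring[OF y]
  have "(\<integral>\<^sup>+ zs. pgf q zs \<partial>next_generation \<mu> \<kappa> (y # ys))
     = (\<integral>\<^sup>+ zs. pgf q zs * pgf (gen_op q) ys \<partial>offspring \<mu> \<kappa> y)"
    by (subst nn_integral_next_generation_Cons[OF y ys]) (simp_all add: nn_integral_cmult Cons.IH)
  also have "\<dots> = ennreal (gen_op q y) * pgf (gen_op q) ys"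
    by (subst nn_integral_multc) (simp_all add: nn_integral_offspring[OF y q q01])
  finally show ?case by simp
qed

text \<open>The total mass is the generating functional at the constant 1, which
  \<open>gen_op\<close> fixes.\<close>

lemma prob_space_next_generation:
  assumes ys: "ys \<in> lists (space \<mu>)" shows "prob_space (next_generation \<mu> \<kappa> ys)"
proof (rule prob_spaceI)
  have "prod_list (map (\<lambda>_. 1 :: ennreal) xs) = 1" for xs :: "'a list"
    by (induction xs) auto
  then show "emeasure (next_generation \<mu> \<kappa> ys) (space (next_generation \<mu> \<kappa> ys)) = 1"
    using nn_integral_next_generation[OF ys, of "\<lambda>_. 1"] by (simp add: gen_op_def)
qed

end

section \<open>Extinction by generation n and survival for ever\<close>

context poisson_branching
begin

text \<open>\<open>extinction n x\<close> will be the probability that generation n is empty. It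
  starts from 0 because generation 0 is the single particle \<open>[x]\<close>.\<close>

primrec extinction :: "nat \<Rightarrow> 'a \<Rightarrow> real" where
  "extinction 0 = (\<lambda>_. 0)"
| "extinction (Suc n) = gen_op (extinction n)"

lemma gen_op_bounds:
  assumes q01: "\<And>z. 0 \<le> q z" "\<And>z. q z \<le> 1"
  shows "0 \<le> gen_op q x" "gen_op q x \<le> 1"
  using q01 kernel_nonneg by (auto simp: gen_op_def intro!: integral_nonneg_AE)

lemma measurable_gen_op [measurable]:
  assumes [measurable]: "q \<in> borel_measurable \<mu>"
  shows "gen_op q \<in> borel_measurable \<mu>"
  unfolding gen_op_def[abs_def] by measurable

lemma extinction_bounds: "0 \<le> extinction n x" "extinction n x \<le> 1"
proof -
  have "\<forall>x. 0 \<le> extinction n x \<and> extinction n x \<le> 1"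
    by (induction n) (auto intro: gen_op_bounds)
  then show "0 \<le> extinction n x" "extinction n x \<le> 1" by auto
qed

lemma measurable_extinction [measurable]: "extinction n \<in> borel_measurable \<mu>"
  by (induction n) auto

context
  fixes x assumes x: "x \<in> space \<mu>"
begin

lemma Ionescu_Tulcea_generation_step:
  "Ionescu_Tulcea (generation_step \<mu> \<kappa> x) (\<lambda>_. list_space \<mu>)"
proof (rule Ionescu_Tulcea.intro)
  fix i :: nat
  show "generation_step \<mu> \<kappa> x i \<in> measurable (PiM {0..<i} (\<lambda>_. list_space \<mu>)) (subprob_algebra (list_space \<mu>))"
  proof (cases i)
    case 0
    then show ?thesis
      using x by (auto simp: generation_step_def[abs_def] space_subprob_algebra intro!: measurable_const subprob_space_return)
  next
    case (Suc m)
    have "(\<lambda>\<omega>. next_generation \<mu> \<kappa> (\<omega> m)) \<in> measurable (PiM {0..<i} (\<lambda>_. list_space \<mu>)) (subprob_algebra (list_space \<mu>))"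
      by (rule measurable_compose[OF measurable_component_singleton[of m _ "\<lambda>_. list_space \<mu>"] measurable_next_generation])
        (simp add: Suc)
    then show ?thesis by (simp add: generation_step_def[abs_def] Suc)
  qed
next
  fix i :: nat and \<omega> assume \<omega>: "\<omega> \<in> space (PiM {0..<i} (\<lambda>_. list_space \<mu>))"
  show "prob_space (generation_step \<mu> \<kappa> x i \<omega>)"
    using x \<omega> by (cases i)
      (auto simp: generation_step_def space_PiM PiE_iff intro!: prob_space_return prob_space_next_generation)
qed

interpretation IT: Ionescu_Tulcea "generation_step \<mu> \<kappa> x" "\<lambda>_. list_space \<mu>"
  by (rule Ionescu_Tulcea_generation_step)

text \<open>\<open>law k\<close> is the joint law of the generations 0, ..., k - 1; generation
  \<open>k\<close> is the one that the next step adds.\<close>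

abbreviation (input) law :: "nat \<Rightarrow> (nat \<Rightarrow> 'a list) measure" where
  "law k \<equiv> IT.C 0 k (\<lambda>_. undefined)"

lemma nn_integral_C_Suc:
  assumes [measurable]: "f \<in> borel_measurable (PiM {0..<Suc k} (\<lambda>_. list_space \<mu>))"
  shows "(\<integral>\<^sup>+ \<omega>. f \<omega> \<partial>law (Suc k))
    = (\<integral>\<^sup>+ \<omega>. (\<integral>\<^sup>+ ys. f (fun_upd \<omega> k ys) \<partial>generation_step \<mu> \<kappa> x k \<omega>) \<partial>law k)"
proof -
  have u: "(\<lambda>_. undefined) \<in> space (PiM {0..<0::nat} (\<lambda>_. list_space \<mu>))" by simp
  have m: "IT.eP (0 + k) \<in> measurable (law k) (subprob_algebra (PiM {0..<Suc k} (\<lambda>_. list_space \<mu>)))"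
    using IT.measurable_eP[of k] by (simp add: measurable_cong_sets[OF IT.sets_C[OF u] refl])
  have "(\<integral>\<^sup>+ \<omega>. f \<omega> \<partial>law (Suc k))
    = (\<integral>\<^sup>+ \<omega>. (\<integral>\<^sup>+ \<omega>'. f \<omega>' \<partial>IT.eP k \<omega>) \<partial>law k)"
    unfolding IT.C.simps by (subst nn_integral_bind[OF assms m]) simp
  also have "\<dots> = (\<integral>\<^sup>+ \<omega>. (\<integral>\<^sup>+ ys. f (fun_upd \<omega> k ys) \<partial>generation_step \<mu> \<kappa> x k \<omega>) \<partial>law k)"
    by (intro nn_integral_cong IT.nn_integral_eP) (simp_all add: IT.space_C[OF u])
  finally show ?thesis .
qed

lemma measurable_prod_list_component:
  assumes [measurable]: "g \<in> borel_measurable \<mu>" and "k \<in> J"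
  shows "(\<lambda>\<omega>. pgf g (\<omega> k)) \<in> borel_measurable (PiM J (\<lambda>_. list_space \<mu>))"
  by (rule measurable_compose[OF measurable_component_singleton[OF assms(2)]]) measurable

text \<open>Integrating out the last generation moves the functional back by one and turns
  \<open>extinction n\<close> into \<open>extinction (Suc n)\<close>; after \<open>k\<close> such
  steps only the root is left.\<close>

lemma nn_integral_C_prod_extinction:
  "(\<integral>\<^sup>+ \<omega>. pgf (extinction n) (\<omega> k) \<partial>law (Suc k))
    = ennreal (extinction (n + k) x)"
proof (induction k arbitrary: n)
  case 0
  have "(\<integral>\<^sup>+ \<omega>. pgf (extinction n) (\<omega> 0) \<partial>law (Suc 0))
    = (\<integral>\<^sup>+ \<omega>. (\<integral>\<^sup>+ ys. pgf (extinction n) ys \<partial>return (list_space \<mu>) [x])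
        \<partial>law 0)"
    by (subst nn_integral_C_Suc) (auto simp: generation_step_def intro!: measurable_prod_list_component)
  also have "\<dots> = ennreal (extinction n x)"
    using x prob_space.emeasure_space_1[OF IT.prob_space_C[of "\<lambda>_. undefined" 0 0]]
    by (subst nn_integral_return) auto
  finally show ?case by simp
next
  case (Suc k)
  have u: "(\<lambda>_. undefined) \<in> space (PiM {0..<0::nat} (\<lambda>_. list_space \<mu>))" by simp
  have "(\<integral>\<^sup>+ \<omega>. pgf (extinction n) (\<omega> (Suc k)) \<partial>law (Suc (Suc k)))
    = (\<integral>\<^sup>+ \<omega>. (\<integral>\<^sup>+ ys. pgf (extinction n) ys \<partial>next_generation \<mu> \<kappa> (\<omega> k))
        \<partial>law (Suc k))"
    by (subst nn_integral_C_Suc) (auto simp: generation_step_def simp del: IT.C.simps intro!: measurable_prod_list_component)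
  also have "\<dots> = (\<integral>\<^sup>+ \<omega>. pgf (extinction (Suc n)) (\<omega> k) \<partial>law (Suc k))"
    unfolding extinction.simps
    by (intro nn_integral_cong nn_integral_next_generation measurable_extinction extinction_bounds)
      (auto simp: IT.space_C[OF u] space_PiM PiE_iff simp del: IT.C.simps)
  also have "\<dots> = ennreal (extinction (Suc n + k) x)"
    by (rule Suc)
  finally show ?case by simp
qed

abbreviation (input) BP :: "(nat \<Rightarrow> 'a list) measure" where
  "BP \<equiv> branching_process \<mu> \<kappa> x"

lemma branching_process_eq: "BP = IT.PF.lim"
  by (simp add: branching_process_def)

lemma emeasure_branching_process:
  assumes X: "X \<in> sets (PiM {0..<n} (\<lambda>_. list_space \<mu>))"
  shows "emeasure (BP) {\<omega> \<in> space (BP). restrict \<omega> {0..<n} \<in> X}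
    = emeasure (law n) X"
proof -
  have "{\<omega> \<in> space (BP). restrict \<omega> {0..<n} \<in> X} = prod_emb UNIV (\<lambda>_. list_space \<mu>) {0..<n} X"
    by (auto simp: branching_process_eq prod_emb_def space_PiM)
  then show ?thesis
    using X IT.emeasure_CI[of "{0..<n}" n X] sets.sets_into_space[OF X]
    by (simp add: branching_process_eq IT.lim prod_emb_id space_PiM)
qed

lemma prob_space_branching_process: "prob_space (BP)"
proof (rule prob_spaceI)
  have *: "{\<omega> \<in> space (BP). restrict \<omega> {0..<0} \<in> space (PiM {0..<0} (\<lambda>_. list_space \<mu>))}
      = space (BP)"
    by (auto simp: space_PiM)
  have "prob_space (law 0)"
    by (rule IT.prob_space_C) simp
  from prob_space.emeasure_space_1[OF this]
  show "emeasure (BP) (space (BP)) = 1"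
    using emeasure_branching_process[OF sets.top, of 0] unfolding * by simp
qed

lemma sets_branching_process [measurable_cong, simp]:
  "sets (BP) = sets (PiM UNIV (\<lambda>_. list_space \<mu>))"
  by (simp add: branching_process_eq)

lemma sets_component_Nil:
  assumes "k \<in> J"
  shows "{\<omega> \<in> space (PiM J (\<lambda>_. list_space \<mu>)). \<omega> k = []} \<in> sets (PiM J (\<lambda>_. list_space \<mu>))"
proof -
  have "{\<omega> \<in> space (PiM J (\<lambda>_. list_space \<mu>)). \<omega> k \<in> {[]}} \<in> sets (PiM J (\<lambda>_. list_space \<mu>))"
    using measurable_sets[OF measurable_component_singleton[OF assms, of "\<lambda>_. list_space \<mu>"] Nil_in_sets_list_space]
    by (simp add: vimage_def Int_def conj_commute)
  then show ?thesis by simp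
qed

lemma sets_branching_process_Nil [measurable]:
  "{\<omega> \<in> space (BP). \<omega> k = []} \<in> sets (BP)"
  using sets_component_Nil[of k UNIV] by (simp add: branching_process_eq)

text \<open>\<open>extinction 0\<close> is the zero function, whose product over a list is the
  indicator of the empty list.\<close>

lemma emeasure_generation_extinct:
  "emeasure (BP) {\<omega> \<in> space (BP). \<omega> k = []} = ennreal (extinction k x)"
proof -
  let ?X = "{\<omega> \<in> space (PiM {0..<Suc k} (\<lambda>_. list_space \<mu>)). \<omega> k = []}"
  have u: "(\<lambda>_. undefined) \<in> space (PiM {0..<0::nat} (\<lambda>_. list_space \<mu>))" by simp
  have X: "?X \<in> sets (PiM {0..<Suc k} (\<lambda>_. list_space \<mu>))"
    by (rule sets_component_Nil) simp
  have "{\<omega> \<in> space (BP). restrict \<omega> {0..<Suc k} \<in> ?X} = {\<omega> \<in> space (BP). \<omega> k = []}"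
    by (auto simp: branching_process_eq space_PiM)
  then have "emeasure (BP) {\<omega> \<in> space (BP). \<omega> k = []}
      = emeasure (law (Suc k)) ?X"
    using emeasure_branching_process[OF X] by simp
  also have "\<dots> = (\<integral>\<^sup>+ \<omega>. indicator ?X \<omega> \<partial>law (Suc k))"
    using X by (intro nn_integral_indicator[symmetric]) (simp add: IT.sets_C[OF u] del: IT.C.simps)
  also have "\<dots> = (\<integral>\<^sup>+ \<omega>. pgf (extinction 0) (\<omega> k) \<partial>law (Suc k))"
  proof (rule nn_integral_cong)
    fix \<omega> assume "\<omega> \<in> space (law (Suc k))"
    then show "indicator ?X \<omega> = pgf (extinction 0) (\<omega> k)"
      by (cases "\<omega> k") (auto simp: IT.space_C[OF u] indicator_def simp del: IT.C.simps)
  qed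
  also have "\<dots> = ennreal (extinction k x)"
    using nn_integral_C_prod_extinction[of k 0] by (simp del: IT.C.simps)
  finally show ?thesis .
qed

text \<open>Only almost sure: the product space also contains sequences in which a non-empty
  generation follows an empty one. They form a null set because \<open>next_generation\<close> of
  \<open>[]\<close> is the point mass at \<open>[]\<close>.\<close>

lemma AE_extinct_stays_extinct:
  "AE \<omega> in BP. \<omega> k = [] \<longrightarrow> \<omega> (Suc k) = []"
proof -
  let ?M = "\<lambda>J. PiM J (\<lambda>_. list_space \<mu>)"
  let ?X = "{\<omega> \<in> space (?M {0..<Suc (Suc k)}). \<omega> k = []} - {\<omega> \<in> space (?M {0..<Suc (Suc k)}). \<omega> (Suc k) = []}"
  have u: "(\<lambda>_. undefined) \<in> space (?M {0..<0::nat})" by simp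
  have X: "?X \<in> sets (?M {0..<Suc (Suc k)})"
    by (intro sets.Diff sets_component_Nil) auto
  have eq: "{\<omega> \<in> space (BP). restrict \<omega> {0..<Suc (Suc k)} \<in> ?X}
    = {\<omega> \<in> space (BP). \<not> (\<omega> k = [] \<longrightarrow> \<omega> (Suc k) = [])}"
    by (auto simp: branching_process_eq space_PiM)
  have "emeasure (law (Suc (Suc k))) ?X
      = (\<integral>\<^sup>+ \<omega>. indicator ?X \<omega> \<partial>law (Suc (Suc k)))"
    using X by (intro nn_integral_indicator[symmetric]) (simp add: IT.sets_C[OF u] del: IT.C.simps)
  also have "\<dots> = (\<integral>\<^sup>+ \<omega>. (\<integral>\<^sup>+ ys. indicator ?X (fun_upd \<omega> (Suc k) ys) \<partial>next_generation \<mu> \<kappa> (\<omega> k)) \<partial>law (Suc k))"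
    using X by (subst nn_integral_C_Suc) (simp_all add: generation_step_def del: IT.C.simps)
  also have "\<dots> = (\<integral>\<^sup>+ \<omega>. 0 \<partial>law (Suc k))"
  proof (rule nn_integral_cong)
    fix \<omega> assume "\<omega> \<in> space (law (Suc k))"
    then have \<omega>: "\<omega> \<in> space (?M {0..<Suc k})" by (simp add: IT.space_C[OF u] del: IT.C.simps)
    show "(\<integral>\<^sup>+ ys. indicator ?X (fun_upd \<omega> (Suc k) ys) \<partial>next_generation \<mu> \<kappa> (\<omega> k)) = 0"
    proof (cases "\<omega> k = []")
      case True
      have "(\<integral>\<^sup>+ ys. indicator ?X (fun_upd \<omega> (Suc k) ys) \<partial>return (list_space \<mu>) [])
        = (\<integral>\<^sup>+ ys. indicator (- {[]}) ys \<partial>return (list_space \<mu>) [])"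
        using True \<omega>
        by (intro nn_integral_cong) (auto simp: indicator_def space_PiM PiE_iff extensional_def)
      also have "\<dots> = 0"
      proof (subst nn_integral_return)
        have "(\<lambda>ys. 1 - indicator {[]} ys :: ennreal) \<in> borel_measurable (list_space \<mu>)"
          by measurable
        moreover have "(\<lambda>ys. 1 - indicator {[]} ys :: ennreal) = indicator (- {[] :: 'a list})"
          by (auto simp: indicator_def fun_eq_iff)
        ultimately show "indicator (- {[] :: 'a list}) \<in> borel_measurable (list_space \<mu>)"
          by simp
      qed auto
      finally show ?thesis by (simp add: True)
    next
      case False
      then show ?thesis by simp
    qed
  qed
  finally have "emeasure (BP)
      {\<omega> \<in> space (BP). \<not> (\<omega> k = [] \<longrightarrow> \<omega> (Suc k) = [])} = 0"
    using emeasure_branching_process[OF X] unfolding eq by simp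
  moreover have "{\<omega> \<in> space (BP). \<not> (\<omega> k = [] \<longrightarrow> \<omega> (Suc k) = [])}
      \<in> sets (BP)"
  proof -
    have "{\<omega> \<in> space (BP). \<not> (\<omega> k = [] \<longrightarrow> \<omega> (Suc k) = [])}
      = {\<omega> \<in> space (BP). \<omega> k = []} - {\<omega> \<in> space (BP). \<omega> (Suc k) = []}"
      by auto
    then show ?thesis
      using sets.Diff[OF sets_branching_process_Nil[of k] sets_branching_process_Nil[of "Suc k"]] by simp
  qed
  ultimately show ?thesis by (rule AE_I[OF subset_refl])
qed

text \<open>Having no empty generation up to n differs from non-emptiness of generation n by a null
  set only. The events \<open>D n\<close> decrease to survival for ever, so continuity from above
  applies.\<close>

lemma survival_prob_at_LIMSEQ: "(\<lambda>n. 1 - extinction n x) \<longlonglongrightarrow> survival_prob_at \<mu> \<kappa> x"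
proof -
  interpret B: prob_space "branching_process \<mu> \<kappa> x"
    by (rule prob_space_branching_process)
  let ?B = "branching_process \<mu> \<kappa> x"
  have A [measurable]: "{\<omega> \<in> space ?B. \<omega> k \<noteq> []} \<in> sets ?B" for k
  proof -
    have "{\<omega> \<in> space ?B. \<omega> k \<noteq> []} = space ?B - {\<omega> \<in> space ?B. \<omega> k = []}" by auto
    then show ?thesis using sets.compl_sets[OF sets_branching_process_Nil[of k]] by simp
  qed
  define D where "D n = (\<Inter>k\<le>n. {\<omega> \<in> space ?B. \<omega> k \<noteq> []})" for n
  have D_sets [measurable]: "D n \<in> sets ?B" for n
    unfolding D_def by (intro sets.finite_INT A) auto
  have "AE \<omega> in ?B. \<forall>k. \<omega> k = [] \<longrightarrow> \<omega> (Suc k) = []"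
    unfolding AE_all_countable using AE_extinct_stays_extinct by blast
  then have AE_D: "AE \<omega> in ?B. \<omega> \<in> {\<omega> \<in> space ?B. \<omega> n \<noteq> []} \<longleftrightarrow> \<omega> \<in> D n" for n
  proof (eventually_elim)
    fix \<omega> :: "nat \<Rightarrow> 'a list" assume st: "\<forall>k. \<omega> k = [] \<longrightarrow> \<omega> (Suc k) = []"
    have "\<omega> m = []" if "k \<le> m" "\<omega> k = []" for k m
      using that by (induction m rule: dec_induct) (use st in auto)
    then show "\<omega> \<in> {\<omega> \<in> space ?B. \<omega> n \<noteq> []} \<longleftrightarrow> \<omega> \<in> D n"
      by (auto simp: D_def)
  qed
  have D_prob: "B.prob (D n) = 1 - extinction n x" for n
  proof -
    have "B.prob (D n) = B.prob {\<omega> \<in> space ?B. \<omega> n \<noteq> []}"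
      by (rule B.finite_measure_eq_AE[OF AE_D A D_sets, symmetric])
    also have "{\<omega> \<in> space ?B. \<omega> n \<noteq> []} = space ?B - {\<omega> \<in> space ?B. \<omega> n = []}"
      by auto
    also have "B.prob \<dots> = 1 - B.prob {\<omega> \<in> space ?B. \<omega> n = []}"
      by (rule B.prob_compl) measurable
    also have "B.prob {\<omega> \<in> space ?B. \<omega> n = []} = extinction n x"
      using emeasure_generation_extinct[of n] extinction_bounds(1)[of n x]
      by (intro measure_eq_emeasure_eq_ennreal) auto
    finally show ?thesis .
  qed
  have "(\<lambda>n. B.prob (D n)) \<longlonglongrightarrow> B.prob (\<Inter>n. D n)"
  proof (rule B.finite_Lim_measure_decseq)
    show "range D \<subseteq> sets ?B" using D_sets by blast
    show "decseq D" by (auto simp: decseq_def D_def)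
  qed
  moreover have "(\<Inter>n. D n) = {\<omega> \<in> space ?B. \<forall>n. \<omega> n \<noteq> []}"
    by (auto simp: D_def)
  ultimately show ?thesis
    by (simp add: D_prob survival_prob_at_def)
qed

end

end

section \<open>Bounded functions in \<open>L\<^sup>2\<close>\<close>

lemma Cauchy_Schwarz_integral:
  fixes f g :: "'a \<Rightarrow> real"
  assumes [measurable]: "f \<in> borel_measurable M" "g \<in> borel_measurable M"
    and f2: "integrable M (\<lambda>x. (f x)\<^sup>2)" and g2: "integrable M (\<lambda>x. (g x)\<^sup>2)"
  shows "integrable M (\<lambda>x. f x * g x)"
    and "(\<integral>x. f x * g x \<partial>M)\<^sup>2 \<le> (\<integral>x. (f x)\<^sup>2 \<partial>M) * (\<integral>x. (g x)\<^sup>2 \<partial>M)"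
proof -
  show fg: "integrable M (\<lambda>x. f x * g x)"
  proof (rule Bochner_Integration.integrable_bound[OF Bochner_Integration.integrable_add[OF f2 g2]])
    have "\<bar>a * b\<bar> \<le> \<bar>a\<^sup>2 + b\<^sup>2\<bar>" for a b :: real
    proof -
      have "0 \<le> (\<bar>a\<bar> - \<bar>b\<bar>)\<^sup>2" "0 \<le> \<bar>a\<bar> * \<bar>b\<bar>" by simp_all
      then have "\<bar>a\<bar> * \<bar>b\<bar> \<le> a\<^sup>2 + b\<^sup>2" unfolding power2_diff power2_abs by linarith
      then show ?thesis by (simp add: abs_mult)
    qed
    then show "AE x in M. norm (f x * g x) \<le> norm ((f x)\<^sup>2 + (g x)\<^sup>2)"
      by (simp only: real_norm_def AE_I2)
  qed simp
  define a b c where "a = (\<integral>x. (f x)\<^sup>2 \<partial>M)" and "b = (\<integral>x. f x * g x \<partial>M)" and "c = (\<integral>x. (g x)\<^sup>2 \<partial>M)"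
  \<comment> \<open>Everything follows from this quadratic form being non-negative: the pair
    \<open>(c, - b)\<close> gives \<open>0 \<le> c * (a * c - b\<^sup>2)\<close>, and if
    \<open>c = 0\<close> then a suitable \<open>t\<close> would make it negative unless
    \<open>b = 0\<close>.\<close>
  have quad: "0 \<le> a * s\<^sup>2 + 2 * b * s * t + c * t\<^sup>2" for s t
  proof -
    have "0 \<le> (\<integral>x. (s * f x + t * g x)\<^sup>2 \<partial>M)" by simp
    also have "\<dots> = (\<integral>x. s\<^sup>2 * (f x)\<^sup>2 + 2 * s * t * (f x * g x) + t\<^sup>2 * (g x)\<^sup>2 \<partial>M)"
      by (intro Bochner_Integration.integral_cong refl) (simp add: power2_eq_square algebra_simps)
    also have "\<dots> = a * s\<^sup>2 + 2 * b * s * t + c * t\<^sup>2"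
      using f2 g2 fg by (simp add: a_def b_def c_def)
    finally show ?thesis .
  qed
  have "b\<^sup>2 \<le> a * c"
  proof (cases "c = 0")
    case False
    have "0 \<le> c" by (simp add: c_def)
    with False have c: "0 < c" by simp
    have "0 \<le> c * (a * c - b\<^sup>2)"
      using quad[of c "- b"] by (simp add: power2_eq_square algebra_simps)
    with c show ?thesis by (simp add: zero_le_mult_iff)
  next
    case True
    have "0 \<le> a" by (simp add: a_def)
    have "b = 0"
    proof (rule ccontr)
      assume "b \<noteq> 0"
      then have "2 * b * 1 * (- (a + 1) / b) = - 2 * (a + 1)" by simp
      with quad[of 1 "- (a + 1) / b"] True \<open>0 \<le> a\<close> show False by simp
    qed
    then show ?thesis using True by simp
  qed
  then show "(\<integral>x. f x * g x \<partial>M)\<^sup>2 \<le> (\<integral>x. (f x)\<^sup>2 \<partial>M) * (\<integral>x. (g x)\<^sup>2 \<partial>M)"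
    by (simp add: a_def b_def c_def)
qed

text \<open>The bound holds at every point, not just almost everywhere. Such functions are closed
  under sums and products, and on a probability space they are integrable.\<close>

definition bounded_measurable :: "'a measure \<Rightarrow> ('a \<Rightarrow> real) \<Rightarrow> bool" where
  "bounded_measurable M f \<longleftrightarrow> f \<in> borel_measurable M \<and> (\<exists>C. \<forall>x. \<bar>f x\<bar> \<le> C)"

lemma bounded_measurableD: "bounded_measurable M f \<Longrightarrow> f \<in> borel_measurable M"
  by (simp add: bounded_measurable_def)

lemma bounded_measurableI: "f \<in> borel_measurable M \<Longrightarrow> (\<And>x. \<bar>f x\<bar> \<le> C) \<Longrightarrow> bounded_measurable M f"
  by (auto simp: bounded_measurable_def)

lemma bounded_measurable_bound:
  assumes "bounded_measurable M f" obtains C where "0 < C" "\<And>x. \<bar>f x\<bar> \<le> C"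
proof -
  obtain C where C: "\<And>x. \<bar>f x\<bar> \<le> C" using assms by (auto simp: bounded_measurable_def)
  show thesis
  proof (rule that[of "max 1 C"])
    show "\<bar>f x\<bar> \<le> max 1 C" for x using C[of x] by simp
  qed simp
qed

lemma bounded_measurable_const [intro, simp]: "bounded_measurable M (\<lambda>_. c)"
  by (rule bounded_measurableI[where C = "\<bar>c\<bar>"]) auto

lemma bounded_measurable_add [intro]:
  assumes "bounded_measurable M f" "bounded_measurable M g"
  shows "bounded_measurable M (\<lambda>x. f x + g x)"
proof -
  obtain C D where "\<And>x. \<bar>f x\<bar> \<le> C" "\<And>x. \<bar>g x\<bar> \<le> D"
    using assms by (metis bounded_measurable_bound)
  then have "\<bar>f x + g x\<bar> \<le> C + D" for x
    using abs_triangle_ineq[of "f x" "g x"] by (meson add_mono order_trans)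
  then show ?thesis
    by (rule bounded_measurableI[OF borel_measurable_add[OF assms[THEN bounded_measurableD]]])
qed

lemma bounded_measurable_mult [intro]:
  assumes "bounded_measurable M f" "bounded_measurable M g"
  shows "bounded_measurable M (\<lambda>x. f x * g x)"
proof -
  obtain C D where "\<And>x. \<bar>f x\<bar> \<le> C" "\<And>x. \<bar>g x\<bar> \<le> D" "0 < C"
    using assms by (metis bounded_measurable_bound)
  then have "\<bar>f x * g x\<bar> \<le> C * D" for x
    by (auto simp: abs_mult intro!: mult_mono)
  then show ?thesis
    by (rule bounded_measurableI[OF borel_measurable_times[OF assms[THEN bounded_measurableD]]])
qed

lemma bounded_measurable_diff [intro]:
  assumes "bounded_measurable M f" "bounded_measurable M g"
  shows "bounded_measurable M (\<lambda>x. f x - g x)"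
  using bounded_measurable_add[OF assms(1) bounded_measurable_mult[OF bounded_measurable_const[of M "-1"] assms(2)]]
  by simp

lemma bounded_measurable_divide [intro]:
  "bounded_measurable M f \<Longrightarrow> bounded_measurable M (\<lambda>x. f x / c)"
  using bounded_measurable_mult[OF bounded_measurable_const[of M "1 / c"], of f] by simp

lemma bounded_measurable_power [intro]:
  "bounded_measurable M f \<Longrightarrow> bounded_measurable M (\<lambda>x. f x ^ n)"
  by (induction n) auto

lemma bounded_measurable_abs [intro]:
  "bounded_measurable M f \<Longrightarrow> bounded_measurable M (\<lambda>x. \<bar>f x\<bar>)"
  by (auto simp: bounded_measurable_def)

lemmas bm_intros = bounded_measurable_const bounded_measurable_add bounded_measurable_mult
  bounded_measurable_diff bounded_measurable_divide bounded_measurable_power bounded_measurable_abs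

section \<open>Norm and inner product of L2 on bounded functions\<close>

context prob_space
begin

abbreviation (input) bm :: "('a \<Rightarrow> real) \<Rightarrow> bool" where
  "bm \<equiv> bounded_measurable M"

lemma integrable_bm [intro]:
  assumes "bm f" shows "integrable M f"
proof -
  obtain C where "\<And>x. \<bar>f x\<bar> \<le> C" using bounded_measurable_bound[OF assms] by blast
  then show ?thesis
    by (intro integrable_const_bound[where B = C] bounded_measurableD[OF assms]) auto
qed

definition nsq :: "('a \<Rightarrow> real) \<Rightarrow> real" where
  "nsq f = (\<integral>x. (f x)\<^sup>2 \<partial>M)"

definition ip :: "('a \<Rightarrow> real) \<Rightarrow> ('a \<Rightarrow> real) \<Rightarrow> real" where
  "ip f g = (\<integral>x. f x * g x \<partial>M)"

lemma nsq_nonneg [simp]: "0 \<le> nsq f"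
  by (simp add: nsq_def)

lemma nsq_eq_ip: "nsq f = ip f f"
  by (simp add: nsq_def ip_def power2_eq_square)

lemma ip_commute: "ip f g = ip g f"
  by (simp add: ip_def mult.commute)

lemma integrable_bm_mult [intro]: "bm f \<Longrightarrow> bm g \<Longrightarrow> integrable M (\<lambda>x. f x * g x)"
  by auto

lemma ip_add_left: "bm f \<Longrightarrow> bm g \<Longrightarrow> bm h \<Longrightarrow> ip (\<lambda>x. f x + g x) h = ip f h + ip g h"
  by (simp add: ip_def distrib_right integrable_bm_mult)

lemma ip_diff_left: "bm f \<Longrightarrow> bm g \<Longrightarrow> bm h \<Longrightarrow> ip (\<lambda>x. f x - g x) h = ip f h - ip g h"
  by (simp add: ip_def left_diff_distrib integrable_bm_mult)

lemma ip_scale_left: "ip (\<lambda>x. c * f x) h = c * ip f h"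
  by (simp add: ip_def mult.assoc)

lemma nsq_diff:
  assumes "bm f" "bm g" shows "nsq (\<lambda>x. f x - g x) = nsq f - 2 * ip f g + nsq g"
proof -
  have "nsq (\<lambda>x. f x - g x) = (\<integral>x. f x * f x - 2 * (f x * g x) + g x * g x \<partial>M)"
    unfolding nsq_def by (intro Bochner_Integration.integral_cong refl) (simp add: power2_eq_square algebra_simps)
  also have "\<dots> = nsq f - 2 * ip f g + nsq g"
    using assms by (simp add: nsq_eq_ip ip_def integrable_bm_mult)
  finally show ?thesis .
qed

lemma nsq_add:
  assumes "bm f" "bm g" shows "nsq (\<lambda>x. f x + g x) = nsq f + 2 * ip f g + nsq g"
proof -
  have "nsq (\<lambda>x. f x + g x) = (\<integral>x. f x * f x + 2 * (f x * g x) + g x * g x \<partial>M)"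
    unfolding nsq_def by (intro Bochner_Integration.integral_cong refl) (simp add: power2_eq_square algebra_simps)
  also have "\<dots> = nsq f + 2 * ip f g + nsq g"
    using assms by (simp add: nsq_eq_ip ip_def integrable_bm_mult)
  finally show ?thesis .
qed

lemma ip_square_le: "bm f \<Longrightarrow> bm g \<Longrightarrow> (ip f g)\<^sup>2 \<le> nsq f * nsq g"
  unfolding ip_def nsq_def
  by (rule Cauchy_Schwarz_integral(2)) (auto dest: bounded_measurableD)

definition nrm :: "('a \<Rightarrow> real) \<Rightarrow> real" where
  "nrm f = sqrt (nsq f)"

lemma nrm_nonneg [simp]: "0 \<le> nrm f"
  by (simp add: nrm_def)

lemma nrm_square [simp]: "(nrm f)\<^sup>2 = nsq f"
  by (simp add: nrm_def)

lemma abs_ip_le: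
  assumes "bm f" "bm g" shows "\<bar>ip f g\<bar> \<le> nrm f * nrm g"
proof -
  have "\<bar>ip f g\<bar> \<le> sqrt (nsq f * nsq g)"
    using ip_square_le[OF assms] by (intro real_le_rsqrt) simp
  then show ?thesis by (simp add: nrm_def real_sqrt_mult)
qed

lemma nrm_triangle:
  assumes "bm f" "bm g" shows "nrm (\<lambda>x. f x + g x) \<le> nrm f + nrm g"
proof (rule power2_le_imp_le)
  have "nsq (\<lambda>x. f x + g x) \<le> nsq f + 2 * (nrm f * nrm g) + nsq g"
    using abs_ip_le[OF assms] by (simp add: nsq_add[OF assms])
  then show "(nrm (\<lambda>x. f x + g x))\<^sup>2 \<le> (nrm f + nrm g)\<^sup>2"
    by (simp add: power2_sum algebra_simps)
qed simp

lemma nsq_scale: "nsq (\<lambda>x. c * f x) = c\<^sup>2 * nsq f"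
  by (simp add: nsq_def power_mult_distrib)

lemma nrm_scale: "nrm (\<lambda>x. c * f x) = \<bar>c\<bar> * nrm f"
  by (simp add: nrm_def nsq_def power_mult_distrib real_sqrt_mult)

lemma nrm_const: "nrm (\<lambda>_. c) = \<bar>c\<bar>"
  by (simp add: nrm_def nsq_def prob_space)

lemma nsq_mono:
  assumes "bm f" "bm g" "\<And>x. \<bar>f x\<bar> \<le> \<bar>g x\<bar>" shows "nsq f \<le> nsq g"
  unfolding nsq_def using assms(3)
  by (intro integral_mono integrable_bm bounded_measurable_power assms) (simp add: abs_le_square_iff)

lemma nrm_mono:
  assumes "bm f" "bm g" "\<And>x. \<bar>f x\<bar> \<le> \<bar>g x\<bar>" shows "nrm f \<le> nrm g"
  unfolding nrm_def using nsq_mono[OF assms] by simp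

lemma abs_integral_le_nrm:
  assumes "bm f" shows "\<bar>\<integral>x. f x \<partial>M\<bar> \<le> nrm f"
  using abs_ip_le[OF assms bounded_measurable_const[of M 1]]
  by (simp add: ip_def nrm_def nsq_def prob_space)

lemma nsq_eq_0_iff: "bm f \<Longrightarrow> nsq f = 0 \<longleftrightarrow> (AE x in M. f x = 0)"
  unfolding nsq_def by (subst integral_nonneg_eq_0_iff_AE) auto

lemma dominated_convergence_bm:
  assumes "\<And>n. f n \<in> borel_measurable M" "g \<in> borel_measurable M" "\<And>x. (\<lambda>n. f n x) \<longlonglongrightarrow> g x"
    and "\<And>n x. \<bar>f n x\<bar> \<le> (C :: real)"
  shows "(\<lambda>n. \<integral>x. f n x \<partial>M) \<longlonglongrightarrow> (\<integral>x. g x \<partial>M)"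
  by (rule integral_dominated_convergence[where w = "\<lambda>_. C"]) (use assms in auto)

end

section \<open>The eigenfunction of a critical kernel\<close>

text \<open>\<open>B\<close> bounds the L2 norms of all rows of \<open>K\<close>, while
  \<open>K\<close> itself may be unbounded. Later \<open>K\<close> is \<open>c0 * \<kappa>\<close>
  and \<open>B\<close> is \<open>c0 * sqrt L\<close>.\<close>

locale kernel_operator = prob_space \<mu> for \<mu> :: "'a measure" +
  fixes K :: "'a \<Rightarrow> 'a \<Rightarrow> real" and B :: real
  assumes space_UNIV [simp]: "space \<mu> = UNIV"
    and K_measurable: "(\<lambda>(x, y). K x y) \<in> borel_measurable (\<mu> \<Otimes>\<^sub>M \<mu>)"
    and K_nonneg [simp]: "0 \<le> K x y"
    and K_sym: "K x y = K y x"
    and B_pos: "0 < B"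
    and K_square_bound: "(\<integral>\<^sup>+ y. ennreal ((K x y)\<^sup>2) \<partial>\<mu>) \<le> ennreal (B\<^sup>2)"
begin

lemma prob_UNIV [simp]: "prob UNIV = 1"
  using prob_space by simp

lemma K_measurable2 [measurable (raw)]:
  assumes "f \<in> measurable N \<mu>" "g \<in> measurable N \<mu>"
  shows "(\<lambda>x. K (f x) (g x)) \<in> borel_measurable N"
  using measurable_compose[OF measurable_Pair[OF assms] K_measurable] by simp

lemma K_section_measurable [measurable]: "K x \<in> borel_measurable \<mu>"
  using measurable_compose[OF measurable_Pair1'[of x] K_measurable] by simp

lemma integrable_K_square: "integrable \<mu> (\<lambda>y. (K x y)\<^sup>2)"
proof (rule integrableI_bounded)
  have "(\<integral>\<^sup>+ y. ennreal (norm ((K x y)\<^sup>2)) \<partial>\<mu>) \<le> ennreal (B\<^sup>2)"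
    using K_square_bound[of x] by simp
  also have "\<dots> < \<infinity>" by simp
  finally show "(\<integral>\<^sup>+ y. ennreal (norm ((K x y)\<^sup>2)) \<partial>\<mu>) < \<infinity>" .
qed simp

lemma integral_K_square_le: "(\<integral>y. (K x y)\<^sup>2 \<partial>\<mu>) \<le> B\<^sup>2"
proof -
  have "ennreal (\<integral>y. (K x y)\<^sup>2 \<partial>\<mu>) = (\<integral>\<^sup>+ y. ennreal ((K x y)\<^sup>2) \<partial>\<mu>)"
    by (rule nn_integral_eq_integral[symmetric, OF integrable_K_square]) simp
  with K_square_bound[of x] have "ennreal (\<integral>y. (K x y)\<^sup>2 \<partial>\<mu>) \<le> ennreal (B\<^sup>2)" by simp
  then show ?thesis by (simp add: ennreal_le_iff)
qed

lemma integrable_K_mult: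
  assumes "bm f" shows "integrable \<mu> (\<lambda>y. K x y * f y)"
  by (rule Cauchy_Schwarz_integral(1))
    (use assms in \<open>auto intro: integrable_K_square dest: bounded_measurableD\<close>)

lemma integrable_K: "integrable \<mu> (K x)"
  using integrable_K_mult[of "\<lambda>_. 1" x] by simp

definition T :: "('a \<Rightarrow> real) \<Rightarrow> 'a \<Rightarrow> real" where
  "T f x = (\<integral>y. K x y * f y \<partial>\<mu>)"

text \<open>Cauchy-Schwarz against the row of \<open>x\<close>: an L2 bound on the argument becomes
  a uniform bound on the image.\<close>

lemma T_abs_le:
  assumes "bm f" shows "\<bar>T f x\<bar> \<le> B * nrm f"
proof -
  have "(T f x)\<^sup>2 \<le> (\<integral>y. (K x y)\<^sup>2 \<partial>\<mu>) * nsq f"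
    unfolding T_def nsq_def using assms
    by (intro Cauchy_Schwarz_integral(2)) (auto intro: integrable_K_square dest: bounded_measurableD)
  also have "\<dots> \<le> B\<^sup>2 * nsq f"
    by (intro mult_right_mono integral_K_square_le) simp
  also have "\<dots> = (B * nrm f)\<^sup>2"
    by (simp add: power_mult_distrib)
  finally show ?thesis
    using B_pos by (simp add: abs_le_square_iff[symmetric])
qed

lemma T_measurable [measurable]:
  assumes [measurable]: "f \<in> borel_measurable \<mu>" shows "T f \<in> borel_measurable \<mu>"
  unfolding T_def[abs_def] by measurable

lemma bm_T [intro]: "bm f \<Longrightarrow> bm (T f)"
  by (rule bounded_measurableI[OF T_measurable]) (auto intro: T_abs_le dest: bounded_measurableD)

lemma T_add: "bm f \<Longrightarrow> bm g \<Longrightarrow> T (\<lambda>x. f x + g x) = (\<lambda>x. T f x + T g x)"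
  by (simp add: T_def fun_eq_iff distrib_left integrable_K_mult)

lemma T_diff: "bm f \<Longrightarrow> bm g \<Longrightarrow> T (\<lambda>x. f x - g x) = (\<lambda>x. T f x - T g x)"
  by (simp add: T_def fun_eq_iff right_diff_distrib integrable_K_mult)

lemma T_scale: "T (\<lambda>x. c * f x) = (\<lambda>x. c * T f x)"
proof
  fix x
  have "(\<lambda>y. K x y * (c * f y)) = (\<lambda>y. c * (K x y * f y))" by (simp add: fun_eq_iff)
  then show "T (\<lambda>x. c * f x) x = c * T f x" by (simp add: T_def)
qed

lemma T_mono: "bm f \<Longrightarrow> bm g \<Longrightarrow> (\<And>x. f x \<le> g x) \<Longrightarrow> T f x \<le> T g x"
  unfolding T_def by (intro integral_mono integrable_K_mult mult_left_mono) auto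

lemma T_nonneg: "(\<And>x. 0 \<le> f x) \<Longrightarrow> 0 \<le> T f x"
  unfolding T_def by simp

lemma T_abs: "bm f \<Longrightarrow> \<bar>T f x\<bar> \<le> T (\<lambda>x. \<bar>f x\<bar>) x"
proof -
  have "\<bar>T f x\<bar> \<le> (\<integral>y. \<bar>K x y * f y\<bar> \<partial>\<mu>)" unfolding T_def by (rule integral_abs_bound)
  then show ?thesis by (simp add: T_def abs_mult)
qed

text \<open>\<open>T\<close> uses its argument only under an integral, so the images agree at every
  point. This upgrades almost everywhere identities.\<close>

lemma T_cong_AE:
  assumes "f \<in> borel_measurable \<mu>" "g \<in> borel_measurable \<mu>" "AE x in \<mu>. f x = g x"
  shows "T f = T g"
proof
  fix x
  note [measurable] = assms(1,2)
  show "T f x = T g x"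
    unfolding T_def using assms(3) by (intro integral_cong_AE) auto
qed

lemma T_LIMSEQ:
  assumes "\<And>n. f n \<in> borel_measurable \<mu>" "g \<in> borel_measurable \<mu>"
    and "\<And>x. (\<lambda>n. f n x) \<longlonglongrightarrow> g x" and "\<And>n x. \<bar>f n x\<bar> \<le> C"
  shows "(\<lambda>n. T (f n) x) \<longlonglongrightarrow> T g x"
  unfolding T_def
proof (rule integral_dominated_convergence[where w = "\<lambda>y. K x y * C"])
  note [measurable] = assms(1,2)
  show "(\<lambda>y. K x y * g y) \<in> borel_measurable \<mu>" "\<And>n. (\<lambda>y. K x y * f n y) \<in> borel_measurable \<mu>"
    by measurable
  show "integrable \<mu> (\<lambda>y. K x y * C)" by (intro integrable_K_mult) simp
  show "AE y in \<mu>. (\<lambda>n. K x y * f n y) \<longlonglongrightarrow> K x y * g y"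
    by (intro AE_I2 tendsto_mult_left assms)
  show "AE y in \<mu>. norm (K x y * f n y) \<le> K x y * C" for n
    by (intro AE_I2) (auto simp: abs_mult intro!: mult_left_mono assms)
qed

text \<open>\<open>K\<close> is integrable on the product because its row integrals
  \<open>T (\<lambda>_. 1)\<close> are bounded; it serves as the dominating function for
  Fubini.\<close>

lemma integrable_K_pair:
  assumes "f \<in> borel_measurable (\<mu> \<Otimes>\<^sub>M \<mu>)" "\<And>x y. \<bar>f (x, y)\<bar> \<le> C * K x y"
  shows "integrable (\<mu> \<Otimes>\<^sub>M \<mu>) f"
proof -
  interpret P: pair_prob_space \<mu> \<mu> ..
  have K: "integrable (\<mu> \<Otimes>\<^sub>M \<mu>) (\<lambda>(x, y). K x y)"
  proof (rule P.Fubini_integrable[OF K_measurable])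
    have "T (\<lambda>_. 1) = (\<lambda>x. \<integral>y. norm (case (x, y) of (x, y) \<Rightarrow> K x y) \<partial>\<mu>)"
      by (simp add: T_def fun_eq_iff)
    moreover have "integrable \<mu> (T (\<lambda>_. 1))" by auto
    ultimately show "integrable \<mu> (\<lambda>x. \<integral>y. norm (case (x, y) of (x, y) \<Rightarrow> K x y) \<partial>\<mu>)" by simp
    show "AE x in \<mu>. integrable \<mu> (\<lambda>y. case (x, y) of (x, y) \<Rightarrow> K x y)"
      using integrable_K by simp
  qed
  show ?thesis
  proof (rule Bochner_Integration.integrable_bound[OF _ assms(1)])
    show "integrable (\<mu> \<Otimes>\<^sub>M \<mu>) (\<lambda>p. C * (case p of (x, y) \<Rightarrow> K x y))"
      using K by (intro integrable_mult_right)
    show "AE p in \<mu> \<Otimes>\<^sub>M \<mu>. norm (f p) \<le> norm (C * (case p of (x, y) \<Rightarrow> K x y))"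
    proof (rule AE_I2)
      fix p :: "'a \<times> 'a"
      show "norm (f p) \<le> norm (C * (case p of (x, y) \<Rightarrow> K x y))"
        using assms(2)[of "fst p" "snd p"] by (cases p) auto
    qed
  qed
qed

lemma T_selfadjoint:
  assumes f: "bm f" and g: "bm g" shows "ip (T f) g = ip f (T g)"
proof -
  interpret P: pair_prob_space \<mu> \<mu> ..
  obtain C D where C: "\<And>x. \<bar>f x\<bar> \<le> C" "0 < C" and D: "\<And>x. \<bar>g x\<bar> \<le> D" "0 < D"
    using assms by (metis bounded_measurable_bound)
  note [measurable] = f[THEN bounded_measurableD] g[THEN bounded_measurableD]
  have int: "integrable (\<mu> \<Otimes>\<^sub>M \<mu>) (\<lambda>(x, y). K x y * f y * g x)"
  proof (rule integrable_K_pair)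
    fix x y
    have "\<bar>f y\<bar> * \<bar>g x\<bar> \<le> C * D"
      using C D by (intro mult_mono) auto
    then show "\<bar>case (x, y) of (x, y) \<Rightarrow> K x y * f y * g x\<bar> \<le> C * D * K x y"
      by (simp add: abs_mult mult.assoc mult.commute[of _ "K x y"] mult_left_mono)
  qed measurable
  have "ip (T f) g = (\<integral>x. (\<integral>y. K x y * f y * g x \<partial>\<mu>) \<partial>\<mu>)"
    unfolding ip_def T_def by simp
  also have "\<dots> = (\<integral>y. (\<integral>x. K x y * f y * g x \<partial>\<mu>) \<partial>\<mu>)"
    by (rule P.Fubini_integral[symmetric, OF int])
  also have "\<dots> = (\<integral>y. f y * (\<integral>x. K y x * g x \<partial>\<mu>) \<partial>\<mu>)"
  proof (intro Bochner_Integration.integral_cong refl)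
    fix y
    have "(\<integral>x. K x y * f y * g x \<partial>\<mu>) = (\<integral>x. f y * (K y x * g x) \<partial>\<mu>)"
      by (intro Bochner_Integration.integral_cong refl) (simp add: K_sym[of _ y])
    then show "(\<integral>x. K x y * f y * g x \<partial>\<mu>) = f y * (\<integral>x. K y x * g x \<partial>\<mu>)" by simp
  qed
  also have "\<dots> = ip f (T g)" by (simp add: ip_def T_def)
  finally show ?thesis .
qed

lemma bm_T_iter [intro]: "bm f \<Longrightarrow> bm ((T ^^ n) f)"
  by (induction n) auto

lemma T_iter_selfadjoint: "bm f \<Longrightarrow> bm g \<Longrightarrow> ip ((T ^^ n) f) g = ip f ((T ^^ n) g)"
proof (induction n arbitrary: f)
  case (Suc n)
  then have "ip ((T ^^ Suc n) f) g = ip (T f) ((T ^^ n) g)"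
    by (simp add: funpow_Suc_right bm_T del: funpow.simps)
  also have "\<dots> = ip f ((T ^^ Suc n) g)"
    using Suc.prems by (simp add: T_selfadjoint bm_T_iter)
  finally show ?case .
qed simp

lemma T_iter_T_T: "(T ^^ k) (T (T f)) = (T ^^ (k + 2)) f"
  by (induction k) (simp_all add: numeral_2_eq_2)

lemma T_iter_nonneg: "(\<And>x. 0 \<le> f x) \<Longrightarrow> 0 \<le> (T ^^ n) f x"
  by (induction n arbitrary: x) (auto intro: T_nonneg)

lemma T_iter_fixed: "T f = f \<Longrightarrow> (T ^^ n) f = f"
  by (induction n) auto

definition K2 :: "'a \<Rightarrow> 'a \<Rightarrow> real" where
  "K2 x z = (\<integral>y. K x y * K y z \<partial>\<mu>)"

lemma K2_measurable [measurable]: "(\<lambda>(x, z). K2 x z) \<in> borel_measurable (\<mu> \<Otimes>\<^sub>M \<mu>)"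
  unfolding K2_def by measurable

lemma K2_nonneg [simp]: "0 \<le> K2 x z"
  by (simp add: K2_def)

text \<open>Cauchy-Schwarz for two rows; the bound is uniform in both variables, which
  \<open>K\<close> need not satisfy.\<close>

lemma K2_le: "K2 x z \<le> B\<^sup>2"
proof (rule power2_le_imp_le)
  have "(K2 x z)\<^sup>2 \<le> (\<integral>y. (K x y)\<^sup>2 \<partial>\<mu>) * (\<integral>y. (K z y)\<^sup>2 \<partial>\<mu>)"
    unfolding K2_def K_sym[of _ z]
    by (intro Cauchy_Schwarz_integral(2) integrable_K_square) auto
  also have "\<dots> \<le> B\<^sup>2 * B\<^sup>2"
    by (intro mult_mono integral_K_square_le) auto
  finally show "(K2 x z)\<^sup>2 \<le> (B\<^sup>2)\<^sup>2" by (simp add: power2_eq_square)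
qed simp

lemma bm_K2 [intro, simp]: "bm (K2 x)"
proof (rule bounded_measurableI)
  show "K2 x \<in> borel_measurable \<mu>"
    using measurable_compose[OF measurable_Pair1'[of x] K2_measurable] by simp
  show "\<bar>K2 x z\<bar> \<le> B\<^sup>2" for z using K2_le by simp
qed

lemma T_T_eq_K2:
  assumes f: "bm f" shows "T (T f) x = ip (K2 x) f"
proof -
  interpret P: pair_prob_space \<mu> \<mu> ..
  obtain C where C: "\<And>x. \<bar>f x\<bar> \<le> C" "0 < C"
    using bounded_measurable_bound[OF f] by metis
  note [measurable] = f[THEN bounded_measurableD]
  have int: "integrable (\<mu> \<Otimes>\<^sub>M \<mu>) (\<lambda>(y, z). K x y * (K y z * f z))"
  proof (rule P.Fubini_integrable)
    have "(\<lambda>y. K x y * T (\<lambda>z. \<bar>f z\<bar>) y) = (\<lambda>y. \<integral>z. norm (case (y, z) of (y, z) \<Rightarrow> K x y * (K y z * f z)) \<partial>\<mu>)"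
      by (simp add: T_def fun_eq_iff abs_mult)
    moreover have "integrable \<mu> (\<lambda>y. K x y * T (\<lambda>z. \<bar>f z\<bar>) y)"
      using f by (intro integrable_K_mult) auto
    ultimately show "integrable \<mu> (\<lambda>y. \<integral>z. norm (case (y, z) of (y, z) \<Rightarrow> K x y * (K y z * f z)) \<partial>\<mu>)" by simp
    show "AE y in \<mu>. integrable \<mu> (\<lambda>z. case (y, z) of (y, z) \<Rightarrow> K x y * (K y z * f z))"
      using integrable_K_mult[OF f] by (intro AE_I2) auto
  qed measurable
  have "T (T f) x = (\<integral>y. (\<integral>z. K x y * (K y z * f z) \<partial>\<mu>) \<partial>\<mu>)"
    unfolding T_def by simp
  also have "\<dots> = (\<integral>z. (\<integral>y. K x y * (K y z * f z) \<partial>\<mu>) \<partial>\<mu>)"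
    by (rule P.Fubini_integral[symmetric, OF int])
  also have "\<dots> = (\<integral>z. K2 x z * f z \<partial>\<mu>)"
  proof (intro Bochner_Integration.integral_cong refl)
    fix z
    have "(\<integral>y. K x y * (K y z * f z) \<partial>\<mu>) = (\<integral>y. (K x y * K y z) * f z \<partial>\<mu>)"
      by (simp add: mult.assoc)
    then show "(\<integral>y. K x y * (K y z * f z) \<partial>\<mu>) = K2 x z * f z" by (simp add: K2_def)
  qed
  finally show ?thesis by (simp add: ip_def)
qed

text \<open>By self-adjointness, \<open>(T ^^ n) (K2 x)\<close> is the row at \<open>x\<close> of
  the kernel of the power \<open>n + 2\<close>.\<close>

lemma T_iter_eq_K2:
  assumes f: "bm f" shows "(T ^^ (n + 2)) f x = ip ((T ^^ n) (K2 x)) f"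
proof -
  have "(T ^^ (n + 2)) f x = T (T ((T ^^ n) f)) x"
    by (simp add: numeral_2_eq_2)
  also have "\<dots> = ip (K2 x) ((T ^^ n) f)"
    using f by (intro T_T_eq_K2) auto
  finally show ?thesis
    using f by (simp add: T_iter_selfadjoint)
qed

lemma T_iter_K2_measurable [measurable]:
  "(\<lambda>(x, y). (T ^^ n) (K2 x) y) \<in> borel_measurable (\<mu> \<Otimes>\<^sub>M \<mu>)"
proof (induction n)
  case (Suc n)
  note [measurable] = Suc
  have "(\<lambda>p. \<integral>z. K (snd p) z * (T ^^ n) (K2 (fst p)) z \<partial>\<mu>) \<in> borel_measurable (\<mu> \<Otimes>\<^sub>M \<mu>)"
    by measurable
  then show ?case by (simp add: case_prod_beta' T_def[of "(T ^^ n) _"])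
qed (simp add: K2_measurable)

end

text \<open>Operator norm 1, expressed through bounded functions: at most 1 on non-negative
  arguments, over which the norm is defined, and approached arbitrarily closely.\<close>

locale critical_kernel = kernel_operator +
  assumes irreducible: "\<And>A. A \<in> sets \<mu> \<Longrightarrow> (AE (x, y) in \<mu> \<Otimes>\<^sub>M \<mu>. x \<in> A \<and> y \<notin> A \<longrightarrow> K x y = 0) \<Longrightarrow>
      emeasure \<mu> A = 0 \<or> emeasure \<mu> (- A) = 0"
    and contraction_nonneg: "\<And>f. bounded_measurable \<mu> f \<Longrightarrow> (\<And>x. 0 \<le> f x) \<Longrightarrow> nsq (T f) \<le> nsq f"
    and norm_attained: "\<And>r. r < 1 \<Longrightarrow> \<exists>g. bounded_measurable \<mu> g \<and> nsq g \<le> 1 \<and> r \<le> nsq (T g)"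
begin

text \<open>Signed functions reduce to non-negative ones through
  \<open>\<bar>T f x\<bar> \<le> T (\<lambda>x. \<bar>f x\<bar>) x\<close>.\<close>

lemma contraction:
  assumes f: "bm f" shows "nsq (T f) \<le> nsq f"
proof -
  have "nsq (T f) \<le> nsq (T (\<lambda>x. \<bar>f x\<bar>))"
    using f by (intro nsq_mono order_trans[OF T_abs abs_ge_self]) auto
  also have "\<dots> \<le> nsq (\<lambda>x. \<bar>f x\<bar>)"
    using f by (intro contraction_nonneg) auto
  also have "\<dots> = nsq f" by (simp add: nsq_def)
  finally show ?thesis .
qed

lemma contraction_nrm: "bm f \<Longrightarrow> nrm (T f) \<le> nrm f"
  using contraction by (simp add: nrm_def)

section \<open>Monotone norms and convergence of the iterates\<close>

lemma decseq_nsq_T_iter: "bm f \<Longrightarrow> decseq (\<lambda>n. nsq ((T ^^ n) f))"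
  by (auto simp: decseq_Suc_iff intro: contraction)

lemma nsq_T_iter_le: "bm f \<Longrightarrow> nsq ((T ^^ n) f) \<le> nsq f"
  using decseqD[OF decseq_nsq_T_iter, of f 0 n] by simp

lemma contraction_iter_nrm: "bm f \<Longrightarrow> nrm ((T ^^ n) f) \<le> nrm f"
  using nsq_T_iter_le by (simp add: nrm_def)

text \<open>Self-adjointness lets powers move between the two arguments, so only the sum
  \<open>m + n\<close> matters.\<close>

lemma ip_T_iter:
  assumes f: "bm f" and mn: "m + n = 2 * k"
  shows "ip ((T ^^ m) f) ((T ^^ n) f) = nsq ((T ^^ k) f)"
proof -
  have "ip ((T ^^ m) f) ((T ^^ n) f) = ip f ((T ^^ (m + n)) f)"
    using f by (simp add: T_iter_selfadjoint bm_T_iter funpow_add)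
  also have "\<dots> = ip f ((T ^^ (k + k)) f)" by (simp add: mn mult_2)
  also have "\<dots> = nsq ((T ^^ k) f)"
    using f by (simp add: nsq_eq_ip T_iter_selfadjoint bm_T_iter funpow_add)
  finally show ?thesis .
qed

lemma nsq_T_iter_limit:
  assumes f: "bm f" obtains t where "(\<lambda>n. nsq ((T ^^ n) f)) \<longlonglongrightarrow> t" "0 \<le> t" "\<And>n. t \<le> nsq ((T ^^ n) f)"
  using decseq_convergent[OF decseq_nsq_T_iter[OF f], of 0] LIMSEQ_le_const
  by (metis nsq_nonneg)

lemma T_iter_abs_le: "bm f \<Longrightarrow> \<bar>(T ^^ Suc n) f y\<bar> \<le> B * nrm f"
proof -
  assume f: "bm f"
  have "\<bar>(T ^^ Suc n) f y\<bar> \<le> B * nrm ((T ^^ n) f)"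
    using T_abs_le[of "(T ^^ n) f"] f by auto
  also have "\<dots> \<le> B * nrm f"
    using B_pos contraction_iter_nrm[OF f] by (intro mult_left_mono) auto
  finally show ?thesis .
qed

text \<open>\<open>\<parallel>T\<^sup>2\<^sup>n f - T\<^sup>2\<^sup>m f\<parallel>\<^sup>2 = t\<^sub>2\<^sub>n - 2 t\<^sub>n\<^sub>+\<^sub>m + t\<^sub>2\<^sub>m\<close> with \<open>t\<^sub>k = \<parallel>T\<^sup>k f\<parallel>\<^sup>2\<close> decreasing, so
  the even iterates are Cauchy in \<open>L\<^sup>2\<close>, and one further application of \<open>T\<close> makes this pointwise.\<close>

lemma T_odd_iter_convergent:
  assumes f: "bm f" shows "convergent (\<lambda>n. (T ^^ (2 * n + 1)) f y)"
proof -
  obtain t where t: "(\<lambda>n. nsq ((T ^^ n) f)) \<longlonglongrightarrow> t" "\<And>n. t \<le> nsq ((T ^^ n) f)"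
    using nsq_T_iter_limit[OF f] by metis
  have diff: "\<bar>(T ^^ (2 * n + 1)) f y - (T ^^ (2 * m + 1)) f y\<bar> \<le> B * sqrt (2 * (nsq ((T ^^ N) f) - t))"
    if "N \<le> n" "N \<le> m" for n m N
  proof -
    have bmd: "bm (\<lambda>x. (T ^^ (2 * n)) f x - (T ^^ (2 * m)) f x)"
      using f by auto
    have "(T ^^ (2 * n + 1)) f y - (T ^^ (2 * m + 1)) f y = T (\<lambda>x. (T ^^ (2 * n)) f x - (T ^^ (2 * m)) f x) y"
      using f by (simp add: T_diff bm_T_iter)
    then have "\<bar>(T ^^ (2 * n + 1)) f y - (T ^^ (2 * m + 1)) f y\<bar>
        \<le> B * nrm (\<lambda>x. (T ^^ (2 * n)) f x - (T ^^ (2 * m)) f x)"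
      using T_abs_le[OF bmd] by simp
    also have "\<dots> \<le> B * sqrt (2 * (nsq ((T ^^ N) f) - t))"
    proof (intro mult_left_mono)
      have "nsq (\<lambda>x. (T ^^ (2 * n)) f x - (T ^^ (2 * m)) f x)
          = nsq ((T ^^ (2 * n)) f) - 2 * nsq ((T ^^ (n + m)) f) + nsq ((T ^^ (2 * m)) f)"
        using f by (simp add: nsq_diff bm_T_iter ip_T_iter[of f "2 * n" "2 * m" "n + m"])
      also have "\<dots> \<le> 2 * (nsq ((T ^^ N) f) - t)"
      proof -
        \<comment> \<open>By monotonicity the two outer squared norms are at most the one at
          \<open>N\<close>; the middle one is at least the limit \<open>t\<close>.\<close>
        have N: "N \<le> 2 * n" "N \<le> 2 * m" using that by auto
        have "a - 2 * b + c \<le> 2 * (d - t)" if "a \<le> d" "c \<le> d" "t \<le> b" for a b c d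
          using that by argo
        then show ?thesis
          using decseqD[OF decseq_nsq_T_iter[OF f] N(1)] decseqD[OF decseq_nsq_T_iter[OF f] N(2)] t(2)
          by metis
      qed
      finally show "nrm (\<lambda>x. (T ^^ (2 * n)) f x - (T ^^ (2 * m)) f x) \<le> sqrt (2 * (nsq ((T ^^ N) f) - t))"
        by (simp add: nrm_def)
    qed (use B_pos in auto)
    finally show ?thesis .
  qed
  have "(\<lambda>N. B * sqrt (2 * (nsq ((T ^^ N) f) - t))) \<longlonglongrightarrow> B * sqrt (2 * (t - t))"
    by (intro tendsto_intros t)
  then have lim0: "(\<lambda>N. B * sqrt (2 * (nsq ((T ^^ N) f) - t))) \<longlonglongrightarrow> 0" by simp
  have "Cauchy (\<lambda>n. (T ^^ (2 * n + 1)) f y)"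
  proof (rule metric_CauchyI)
    fix e :: real assume "0 < e"
    then obtain N where N: "B * sqrt (2 * (nsq ((T ^^ N) f) - t)) < e"
      using order_tendstoD(2)[OF lim0] by (auto simp: eventually_sequentially)
    show "\<exists>M. \<forall>m\<ge>M. \<forall>n\<ge>M. dist ((T ^^ (2 * m + 1)) f y) ((T ^^ (2 * n + 1)) f y) < e"
    proof (intro exI allI impI)
      fix m n assume "N \<le> m" "N \<le> n"
      from diff[OF this] N show "dist ((T ^^ (2 * m + 1)) f y) ((T ^^ (2 * n + 1)) f y) < e"
        unfolding dist_real_def by linarith
    qed
  qed
  then show ?thesis by (rule real_Cauchy_convergent)
qed

text \<open>On an eigenfunction for \<lambda> this multiplies by
  \<open>\<lambda> ^ (2 * n + 1) * (1 + \<lambda>) / 2\<close>. For \<lambda> in [-1, 1] the factor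
  tends to 1 if \<lambda> = 1 and to 0 otherwise, also at \<lambda> = -1.\<close>

definition M_iter :: "nat \<Rightarrow> ('a \<Rightarrow> real) \<Rightarrow> 'a \<Rightarrow> real" where
  "M_iter n f y = ((T ^^ (2 * n + 1)) f y + (T ^^ (2 * n + 2)) f y) / 2"

lemma bm_M_iter [intro]: "bm f \<Longrightarrow> bm (M_iter n f)"
  unfolding M_iter_def[abs_def] by (intro bm_intros bm_T_iter)

lemma M_iter_abs_le:
  assumes f: "bm f" shows "\<bar>M_iter n f y\<bar> \<le> B * nrm f"
  using T_iter_abs_le[OF f, of "2 * n" y] T_iter_abs_le[OF f, of "2 * n + 1" y]
  unfolding M_iter_def by simp

lemma M_iter_nonneg: "(\<And>x. 0 \<le> f x) \<Longrightarrow> 0 \<le> M_iter n f y"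
  unfolding M_iter_def by (simp add: T_iter_nonneg del: funpow.simps)

text \<open>The odd iterates converge to \<open>h\<close> and, by dominated convergence, the even
  ones to \<open>T h\<close>. One more step merely shifts the odd sequence, so
  \<open>T (T h) = h\<close>, and the average of \<open>h\<close> and \<open>T h\<close> is fixed by
  \<open>T\<close>.\<close>

lemma M_iter_LIMSEQ:
  assumes f: "bm f"
  obtains \<phi> where "bm \<phi>" "T \<phi> = \<phi>" "\<And>y. (\<lambda>n. M_iter n f y) \<longlonglongrightarrow> \<phi> y"
proof -
  define h where "h y = lim (\<lambda>n. (T ^^ (2 * n + 1)) f y)" for y
  have h: "(\<lambda>n. (T ^^ (2 * n + 1)) f y) \<longlonglongrightarrow> h y" for y
    using T_odd_iter_convergent[OF f, of y] unfolding h_def by (simp only: convergent_LIMSEQ_iff)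
  have meas: "(T ^^ n) f \<in> borel_measurable \<mu>" for n
    by (rule bounded_measurableD[OF bm_T_iter[OF f]])
  have h_meas: "h \<in> borel_measurable \<mu>"
    by (rule borel_measurable_LIMSEQ_real[OF h meas])
  have h_le: "\<bar>h y\<bar> \<le> B * nrm f" for y
  proof (rule LIMSEQ_le_const2[OF tendsto_rabs[OF h]], intro exI allI impI)
    show "\<bar>(T ^^ (2 * n + 1)) f y\<bar> \<le> B * nrm f" for n
      using T_iter_abs_le[OF f, of "2 * n" y] by simp
  qed
  have bm_h: "bm h" using h_meas h_le by (rule bounded_measurableI)
  have Th: "(\<lambda>n. (T ^^ (2 * n + 2)) f y) \<longlonglongrightarrow> T h y" for y
    using T_LIMSEQ[OF meas h_meas h, of "B * nrm f" y] T_iter_abs_le[OF f] by simp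
  have "(\<lambda>n. (T ^^ (2 * n + 3)) f y) \<longlonglongrightarrow> T (T h) y" for y
  proof -
    have "\<bar>(T ^^ (2 * n + 2)) f x\<bar> \<le> B * nrm f" for n x
      using T_iter_abs_le[OF f, of "2 * n + 1" x] by simp
    from T_LIMSEQ[OF meas T_measurable[OF h_meas] Th this, of y] show ?thesis
      by (simp add: numeral_3_eq_3)
  qed
  moreover have "(\<lambda>n. (T ^^ (2 * n + 3)) f y) \<longlonglongrightarrow> h y" for y
    using LIMSEQ_Suc[OF h[of y]] by (simp add: numeral_3_eq_3)
  ultimately have TTh: "T (T h) = h"
    using LIMSEQ_unique by blast
  show thesis
  proof (rule that)
    let ?\<phi> = "\<lambda>y. (1 / 2) * (h y + T h y)"
    show "bm ?\<phi>"
      using bm_h by (intro bm_intros bm_T)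
    show "T ?\<phi> = ?\<phi>"
      unfolding T_scale T_add[OF bm_h bm_T[OF bm_h]] TTh by (simp add: add.commute)
    show "(\<lambda>n. M_iter n f y) \<longlonglongrightarrow> ?\<phi> y" for y
      using tendsto_divide[OF tendsto_add[OF h[of y] Th[of y]] tendsto_const[of 2]]
      unfolding M_iter_def by simp
  qed
qed

text \<open>Log-convexity of \<open>k \<mapsto> \<parallel>T\<^sup>k g\<parallel>\<^sup>2\<close> gives \<open>\<parallel>T\<^sup>k\<parallel> \<ge> \<parallel>T\<parallel>\<^sup>k\<close>.\<close>

lemma nsq_T_iter_ge_power:
  assumes g: "bm g" "nsq g \<le> 1" and r: "0 < r" "r \<le> nsq (T g)"
  shows "r ^ Suc k \<le> nsq ((T ^^ Suc k) g)"
proof -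
  let ?t = "\<lambda>k. nsq ((T ^^ k) g)"
  \<comment> \<open>Cauchy-Schwarz for the powers \<open>k\<close> and \<open>k + 2\<close>, whose
    inner product is the squared norm at \<open>k + 1\<close>.\<close>
  have convex: "(?t (Suc k))\<^sup>2 \<le> ?t k * ?t (Suc (Suc k))" for k
    using ip_square_le[of "(T ^^ k) g" "(T ^^ Suc (Suc k)) g"] g(1)
      ip_T_iter[OF g(1), of k "Suc (Suc k)" "Suc k"] by (auto simp del: funpow.simps)
  \<comment> \<open>Log-convexity makes the ratios of consecutive values non-decreasing, so the
    lower bound \<open>r\<close> on the first ratio persists; that first bound is where
    \<open>nsq g \<le> 1\<close> enters.\<close>
  have ratio: "0 < ?t k \<and> r * ?t k \<le> ?t (Suc k)" for k
  proof (induction k)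
    case 0
    have "0 < ?t 1" using r by simp
    then have "0 < ?t 0" using nsq_T_iter_le[OF g(1), of 1] by simp
    moreover have "r * nsq g \<le> r * 1"
      using g(2) r(1) by (intro mult_left_mono) auto
    then have "r * ?t 0 \<le> ?t (Suc 0)" using r(2) by simp
    ultimately show ?case by simp
  next
    case (Suc k)
    then have pos: "0 < ?t k" "0 < ?t (Suc k)"
      using r by (auto intro: less_le_trans[OF mult_pos_pos])
    have "?t (Suc k) * (r * ?t k) \<le> ?t (Suc k) * ?t (Suc k)"
      using Suc pos by (intro mult_left_mono) auto
    also have "\<dots> \<le> ?t k * ?t (Suc (Suc k))"
      using convex[of k] by (simp only: power2_eq_square)
    finally have "?t k * (r * ?t (Suc k)) \<le> ?t k * ?t (Suc (Suc k))"
      by (simp only: mult_ac)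
    then have "r * ?t (Suc k) \<le> ?t (Suc (Suc k))"
      using pos(1) by (simp only: mult_le_cancel_left_pos)
    with pos show ?case by blast
  qed
  show ?thesis
  proof (induction k)
    case 0
    then show ?case using r by simp
  next
    case (Suc k)
    have "r ^ Suc (Suc k) \<le> r * ?t (Suc k)"
      using Suc r by simp
    then show ?case using ratio[of "Suc k"] by linarith
  qed
qed

text \<open>\<open>B\<^sup>2\<close> bounds the case \<open>n = 0\<close> and \<open>B ^ 3\<close>
  the later iterates; the sum serves both, uniformly in \<open>n\<close>, \<open>x\<close> and
  \<open>y\<close>.\<close>

lemma T_iter_K2_abs_le: "\<bar>(T ^^ n) (K2 x) y\<bar> \<le> B ^ 3 + B\<^sup>2"
proof (cases n)
  case 0
  then show ?thesis using K2_le[of x y] B_pos by (simp add: add_increasing)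
next
  case (Suc m)
  have "nrm (K2 x) \<le> nrm (\<lambda>_. B\<^sup>2)"
    by (rule nrm_mono) (auto simp: K2_le)
  also have "\<dots> = B\<^sup>2" by (simp add: nrm_const)
  finally have "B * nrm (K2 x) \<le> B * B\<^sup>2" using B_pos by simp
  moreover have "\<bar>(T ^^ Suc m) (K2 x) y\<bar> \<le> B * nrm (K2 x)"
    by (rule T_iter_abs_le) simp
  moreover have "B * B\<^sup>2 = B ^ 3" by (simp add: power3_eq_cube power2_eq_square)
  moreover have "0 \<le> B\<^sup>2" by simp
  ultimately show ?thesis unfolding Suc by linarith
qed

section \<open>Hilbert-Schmidt norms of the powers and a positive eigenfunction\<close>

lemma nsq_T_iter_K2_measurable [measurable]: "(\<lambda>x. nsq ((T ^^ n) (K2 x))) \<in> borel_measurable \<mu>"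
  unfolding nsq_def by measurable

lemma nsq_T_iter_K2_le: "nsq ((T ^^ n) (K2 x)) \<le> (B ^ 3 + B\<^sup>2)\<^sup>2"
proof -
  have "nsq ((T ^^ n) (K2 x)) \<le> nsq (\<lambda>_. B ^ 3 + B\<^sup>2)"
    using T_iter_K2_abs_le B_pos by (intro nsq_mono) auto
  then show ?thesis by (simp add: nsq_def prob_space)
qed

lemma integrable_nsq_T_iter_K2: "integrable \<mu> (\<lambda>x. nsq ((T ^^ n) (K2 x)))"
  by (rule integrable_const_bound[where B = "(B ^ 3 + B\<^sup>2)\<^sup>2"]) (auto simp: nsq_T_iter_K2_le)

text \<open>The integral is the squared Hilbert--Schmidt norm of \<open>T\<^sup>n\<^sup>+\<^sup>2\<close>.\<close>

lemma one_le_integral_nsq_T_iter_K2: "1 \<le> (\<integral>x. nsq ((T ^^ n) (K2 x)) \<partial>\<mu>)"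
proof -
  let ?I = "\<integral>x. nsq ((T ^^ n) (K2 x)) \<partial>\<mu>"
  \<comment> \<open>Nearly extremal functions give the bound for each \<open>r < 1\<close> only; the
    value 1 is reached by letting \<open>r\<close> increase to 1.\<close>
  have "r ^ (n + 2) \<le> ?I" if r: "0 < r" "r < 1" for r
  proof -
    obtain g where g: "bm g" "nsq g \<le> 1" "r \<le> nsq (T g)" using norm_attained[OF r(2)] by metis
    have I: "0 \<le> ?I" by (intro integral_nonneg_AE AE_I2) simp
    have "r ^ (n + 2) \<le> nsq ((T ^^ (n + 2)) g)"
      using nsq_T_iter_ge_power[OF g(1,2) r(1) g(3), of "n + 1"] by simp
    also have "\<dots> \<le> (\<integral>x. nsq ((T ^^ n) (K2 x)) * nsq g \<partial>\<mu>)"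
      unfolding nsq_def[of "(T ^^ (n + 2)) g"]
    proof (rule integral_mono)
      show "integrable \<mu> (\<lambda>x. ((T ^^ (n + 2)) g x)\<^sup>2)"
        by (intro integrable_bm bounded_measurable_power bm_T_iter g)
      show "integrable \<mu> (\<lambda>x. nsq ((T ^^ n) (K2 x)) * nsq g)"
        by (intro integrable_mult_left integrable_nsq_T_iter_K2)
      show "((T ^^ (n + 2)) g x)\<^sup>2 \<le> nsq ((T ^^ n) (K2 x)) * nsq g" for x
        unfolding T_iter_eq_K2[OF g(1)] by (intro ip_square_le bm_T_iter g) simp
    qed
    also have "\<dots> = ?I * nsq g" by simp
    also have "\<dots> \<le> ?I * 1" using I g(2) by (intro mult_left_mono)
    finally show ?thesis by simp
  qed
  then have "eventually (\<lambda>r. r ^ (n + 2) \<le> ?I) (at_left 1)"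
    by (auto simp: eventually_at_left_field intro!: exI[of _ 0])
  moreover have "((\<lambda>r :: real. r ^ (n + 2)) \<longlongrightarrow> 1 ^ (n + 2)) (at_left 1)"
    by (intro tendsto_power tendsto_ident_at)
  ultimately show ?thesis
    by (intro tendsto_le[of "at_left (1 :: real)" "\<lambda>_. ?I" ?I "\<lambda>r. r ^ (n + 2)" 1]) simp_all
qed

lemma exists_nonneg_eigenfunction:
  obtains \<phi> where "bm \<phi>" "T \<phi> = \<phi>" "\<And>x. 0 \<le> \<phi> x" "\<not> (AE x in \<mu>. \<phi> x = 0)"
proof -
  have "\<exists>x. \<not> (\<lambda>n. nsq ((T ^^ n) (K2 x))) \<longlonglongrightarrow> 0"
  proof (rule ccontr)
    assume "\<not> ?thesis"
    then have "(\<lambda>n. \<integral>x. nsq ((T ^^ n) (K2 x)) \<partial>\<mu>) \<longlonglongrightarrow> (\<integral>x. 0 \<partial>\<mu>)"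
      by (intro dominated_convergence_bm[where C = "(B ^ 3 + B\<^sup>2)\<^sup>2"]) (auto simp: nsq_T_iter_K2_le)
    then have "1 \<le> (0 :: real)"
      using one_le_integral_nsq_T_iter_K2 by (intro LIMSEQ_le_const) auto
    then show False by simp
  qed
  then obtain x where x: "\<not> (\<lambda>n. nsq ((T ^^ n) (K2 x))) \<longlonglongrightarrow> 0" by blast
  let ?g = "K2 x"
  obtain t where t: "(\<lambda>n. nsq ((T ^^ n) ?g)) \<longlonglongrightarrow> t" "0 \<le> t" "\<And>n. t \<le> nsq ((T ^^ n) ?g)"
    using nsq_T_iter_limit[OF bm_K2] by metis
  have "0 < t" using x t by (cases "t = 0") auto
  obtain \<phi> where \<phi>: "bm \<phi>" "T \<phi> = \<phi>" "\<And>y. (\<lambda>n. M_iter n ?g y) \<longlonglongrightarrow> \<phi> y"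
    using M_iter_LIMSEQ[OF bm_K2] by metis
  have nonneg: "0 \<le> \<phi> y" for y
    by (rule LIMSEQ_le_const[OF \<phi>(3)]) (auto intro!: exI[of _ 0] M_iter_nonneg)
  have "\<not> (AE x in \<mu>. \<phi> x = 0)"
  proof
    assume ae: "AE x in \<mu>. \<phi> x = 0"
    have "(\<lambda>n. \<integral>y. M_iter n ?g y * ?g y \<partial>\<mu>) \<longlonglongrightarrow> (\<integral>y. \<phi> y * ?g y \<partial>\<mu>)"
    proof (rule dominated_convergence_bm)
      show "(\<lambda>n. M_iter n ?g y * ?g y) \<longlonglongrightarrow> \<phi> y * ?g y" for y
        by (intro tendsto_mult_right \<phi>)
      show "\<bar>M_iter n ?g y * ?g y\<bar> \<le> B * nrm ?g * B\<^sup>2" for n y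
        using B_pos unfolding abs_mult by (intro mult_mono M_iter_abs_le) (auto simp: K2_le)
    qed (auto intro!: bounded_measurableD[of \<mu>] \<phi>)
    moreover have "(\<integral>y. \<phi> y * ?g y \<partial>\<mu>) = 0"
      using ae by (intro integral_eq_zero_AE) auto
    \<comment> \<open>One of the two averaged powers pairs with \<open>?g\<close> to the squared
      norm of \<open>(T ^^ (n + 1)) ?g\<close>, which is at least \<open>t\<close>; the other
      contributes a non-negative amount because \<open>?g\<close> is non-negative. Hence the limit
      cannot vanish.\<close>
    moreover have "t / 2 \<le> (\<integral>y. M_iter n ?g y * ?g y \<partial>\<mu>)" for n
    proof -
      have "t \<le> nsq ((T ^^ (n + 1)) ?g)" by (rule t(3))
      also have "\<dots> = ip ((T ^^ (2 * n + 2)) ?g) ((T ^^ 0) ?g)"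
        by (rule ip_T_iter[symmetric]) auto
      also have "\<dots> \<le> 2 * (\<integral>y. M_iter n ?g y * ?g y \<partial>\<mu>)"
      proof -
        have "ip ((T ^^ (2 * n + 2)) ?g) ((T ^^ 0) ?g) / 2 = (\<integral>y. (T ^^ (2 * n + 2)) ?g y * ?g y / 2 \<partial>\<mu>)"
          by (simp add: ip_def)
        also have "\<dots> \<le> (\<integral>y. M_iter n ?g y * ?g y \<partial>\<mu>)"
        proof (rule integral_mono)
          show "integrable \<mu> (\<lambda>y. (T ^^ (2 * n + 2)) ?g y * ?g y / 2)"
            by (intro integrable_bm bm_intros bm_T_iter bm_K2)
          show "integrable \<mu> (\<lambda>y. M_iter n ?g y * ?g y)" by auto
          have "0 \<le> (T ^^ (2 * n + 1)) ?g y" for y by (rule T_iter_nonneg) simp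
          then show "(T ^^ (2 * n + 2)) ?g y * ?g y / 2 \<le> M_iter n ?g y * ?g y" for y
            unfolding M_iter_def times_divide_eq_left[symmetric]
            by (intro mult_right_mono divide_right_mono) (auto simp del: funpow.simps)
        qed
        finally show ?thesis by simp
      qed
      finally show ?thesis by simp
    qed
    ultimately have "t / 2 \<le> 0"
      by (intro LIMSEQ_le_const[where X = "\<lambda>n. \<integral>y. M_iter n ?g y * ?g y \<partial>\<mu>"]) auto
    with \<open>0 < t\<close> show False by simp
  qed
  with \<phi> nonneg show thesis by (intro that) auto
qed

text \<open>At almost every zero \<open>x\<close> of \<open>\<phi>\<close> the integral of
  \<open>K x y * \<phi> y\<close> is 0, so \<open>K x y = 0\<close> for almost every
  \<open>y\<close> with \<open>\<phi> y > 0\<close>. Thus \<open>K\<close> does not connect the zero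
  set with its complement, and irreducibility makes one of them null.\<close>

lemma eigenfunction_positive:
  assumes \<phi>: "bm \<phi>" "\<And>x. 0 \<le> \<phi> x" and eigen: "AE x in \<mu>. T \<phi> x = \<phi> x"
  shows "(AE x in \<mu>. \<phi> x = 0) \<or> (AE x in \<mu>. 0 < \<phi> x)"
proof -
  interpret P: pair_prob_space \<mu> \<mu> ..
  note [measurable] = bounded_measurableD[OF \<phi>(1)]
  define A where "A = {x. \<phi> x = 0}"
  have A: "A \<in> sets \<mu>"
    using measurable_sets[OF bounded_measurableD[OF \<phi>(1)], of "{0}"] by (simp add: A_def vimage_def)
  have "AE x in \<mu>. AE y in \<mu>. x \<in> A \<and> y \<notin> A \<longrightarrow> K x y = 0"
    using eigen
  proof eventually_elim
    case (elim x)
    show ?case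
    proof (cases "x \<in> A")
      case True
      with elim have "(\<integral>y. K x y * \<phi> y \<partial>\<mu>) = 0" by (simp add: A_def T_def)
      then have "AE y in \<mu>. K x y * \<phi> y = 0"
        by (subst (asm) integral_nonneg_eq_0_iff_AE) (auto intro: integrable_K_mult \<phi>(1) simp: \<phi>(2))
      then show ?thesis by eventually_elim (auto simp: A_def)
    qed simp
  qed
  moreover have "{p \<in> space (\<mu> \<Otimes>\<^sub>M \<mu>). fst p \<in> A \<and> snd p \<notin> A \<longrightarrow> K (fst p) (snd p) = 0} \<in> sets (\<mu> \<Otimes>\<^sub>M \<mu>)"
    using A by measurable
  ultimately have "AE p in \<mu> \<Otimes>\<^sub>M \<mu>. fst p \<in> A \<and> snd p \<notin> A \<longrightarrow> K (fst p) (snd p) = 0"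
    by (intro P.AE_pair_measure) auto
  then have "AE (x, y) in \<mu> \<Otimes>\<^sub>M \<mu>. x \<in> A \<and> y \<notin> A \<longrightarrow> K x y = 0"
    by (simp add: case_prod_beta')
  from irreducible[OF A this] show ?thesis
  proof
    assume "emeasure \<mu> A = 0"
    then have "AE x in \<mu>. x \<notin> A" using A by (intro AE_not_in) (auto simp: null_sets_def)
    then have "AE x in \<mu>. 0 < \<phi> x" by eventually_elim (use \<phi>(2) in \<open>auto simp: A_def less_le\<close>)
    then show ?thesis by simp
  next
    assume "emeasure \<mu> (- A) = 0"
    moreover have "- A \<in> sets \<mu>" using sets.compl_sets[OF A] by (simp add: Compl_eq_Diff_UNIV)
    ultimately have "AE x in \<mu>. x \<notin> - A" by (intro AE_not_in) (auto simp: null_sets_def)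
    then have "AE x in \<mu>. \<phi> x = 0" by eventually_elim (auto simp: A_def)
    then show ?thesis by simp
  qed
qed

lemma exists_positive_eigenfunction:
  obtains \<psi> where "bm \<psi>" "T \<psi> = \<psi>" "\<And>x. 0 \<le> \<psi> x" "AE x in \<mu>. 0 < \<psi> x" "nsq \<psi> = 1"
proof -
  obtain \<phi> where \<phi>: "bm \<phi>" "T \<phi> = \<phi>" "\<And>x. 0 \<le> \<phi> x" "\<not> (AE x in \<mu>. \<phi> x = 0)"
    using exists_nonneg_eigenfunction by metis
  have pos: "AE x in \<mu>. 0 < \<phi> x" using eigenfunction_positive[of \<phi>] \<phi> by auto
  have "nsq \<phi> \<noteq> 0" using \<phi> nsq_eq_0_iff by blast
  then have n: "0 < nrm \<phi>" by (simp add: nrm_def less_le)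
  show thesis
  proof (rule that)
    let ?\<psi> = "\<lambda>x. (1 / nrm \<phi>) * \<phi> x"
    show "bm ?\<psi>" using \<phi> by auto
    show "T ?\<psi> = ?\<psi>" unfolding T_scale \<phi>(2) ..
    show "0 \<le> ?\<psi> x" for x using \<phi>(3) n by simp
    show "AE x in \<mu>. 0 < ?\<psi> x" using pos by eventually_elim (use n in auto)
    have "nsq ?\<psi> = (1 / nrm \<phi>)\<^sup>2 * nsq \<phi>" by (simp add: nsq_def power_mult_distrib power_divide)
    also have "\<dots> = 1" using n by (simp add: power_divide \<open>nsq \<phi> \<noteq> 0\<close>)
    finally show "nsq ?\<psi> = 1" .
  qed
qed

end

section \<open>Simplicity of the eigenvalue 1 and convergence to the projection\<close>

locale critical_eigenfunction = critical_kernel +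
  fixes \<psi> :: "'a \<Rightarrow> real"
  assumes bm_\<psi> [intro, simp]: "bounded_measurable \<mu> \<psi>"
    and T_\<psi> [simp]: "T \<psi> = \<psi>"
    and \<psi>_nonneg [simp]: "0 \<le> \<psi> x"
    and \<psi>_pos: "AE x in \<mu>. 0 < \<psi> x"
    and nsq_\<psi> [simp]: "nsq \<psi> = 1"
begin

lemma \<psi>_measurable [measurable]: "\<psi> \<in> borel_measurable \<mu>"
  by (rule bounded_measurableD) simp

lemma nrm_\<psi> [simp]: "nrm \<psi> = 1"
  by (simp add: nrm_def)

lemma ip_T_\<psi>: "bm f \<Longrightarrow> ip (T f) \<psi> = ip f \<psi>"
  by (simp add: T_selfadjoint)

lemma ip_T_iter_\<psi>: "bm f \<Longrightarrow> ip ((T ^^ n) f) \<psi> = ip f \<psi>"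
  by (simp add: T_iter_selfadjoint T_iter_fixed)

lemma AE_eq_0_if_ip_\<psi>_eq_0:
  assumes f: "bm f" "AE x in \<mu>. 0 \<le> f x" and ip: "ip f \<psi> = 0"
  shows "AE x in \<mu>. f x = 0"
proof -
  have "AE x in \<mu>. f x * \<psi> x = 0"
    using ip f unfolding ip_def
    by (subst (asm) integral_nonneg_eq_0_iff_AE) auto
  with \<psi>_pos show ?thesis by eventually_elim auto
qed

text \<open>If \<open>T v = v\<close> then \<open>\<bar>v\<bar> \<le> T \<bar>v\<bar>\<close>, and pairing with \<open>\<psi>\<close> forces equality. So \<open>\<bar>v\<bar> + v\<close> is
  a non-negative eigenfunction, hence \<open>v\<close> has constant sign, which \<open>v\<close> orthogonal to \<open>\<psi>\<close> excludes.\<close>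

lemma eigenfunction_unique_AE:
  assumes w: "bm w" and eigen: "AE x in \<mu>. T w x = w x"
  shows "AE x in \<mu>. w x = ip w \<psi> * \<psi> x"
proof -
  define v where "v = (\<lambda>x. w x - ip w \<psi> * \<psi> x)"
  have bm_v: "bm v"
    unfolding v_def by (intro bm_intros w bm_\<psi>)
  have "T v = (\<lambda>x. T w x - ip w \<psi> * \<psi> x)"
    unfolding v_def using w by (subst T_diff) (auto simp: T_scale)
  with eigen have Tv: "AE x in \<mu>. T v x = v x" by (auto simp: v_def)
  have ip_v: "ip v \<psi> = 0"
    unfolding v_def using w by (subst ip_diff_left) (auto simp: ip_scale_left nsq_eq_ip[symmetric])
  have bm_av: "bm (\<lambda>x. \<bar>v x\<bar>)" using bm_v by auto
  have "AE x in \<mu>. T (\<lambda>x. \<bar>v x\<bar>) x - \<bar>v x\<bar> = 0"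
  proof (rule AE_eq_0_if_ip_\<psi>_eq_0)
    show "bm (\<lambda>x. T (\<lambda>x. \<bar>v x\<bar>) x - \<bar>v x\<bar>)" using bm_av by auto
    show "AE x in \<mu>. 0 \<le> T (\<lambda>x. \<bar>v x\<bar>) x - \<bar>v x\<bar>"
      using Tv
    proof eventually_elim
      case (elim x)
      with T_abs[OF bm_v, of x] show ?case by simp
    qed
    show "ip (\<lambda>x. T (\<lambda>x. \<bar>v x\<bar>) x - \<bar>v x\<bar>) \<psi> = 0"
      using bm_av by (simp add: ip_diff_left bm_T ip_T_\<psi>)
  qed
  then have T_p: "AE x in \<mu>. T (\<lambda>x. \<bar>v x\<bar> + v x) x = \<bar>v x\<bar> + v x"
    unfolding T_add[OF bm_av bm_v] using Tv by eventually_elim simp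
  have "0 \<le> \<bar>v x\<bar> + v x" for x by simp
  from eigenfunction_positive[OF bounded_measurable_add[OF bm_av bm_v] this T_p]
  have v0: "AE x in \<mu>. v x = 0"
  proof
    assume "AE x in \<mu>. \<bar>v x\<bar> + v x = 0"
    then have "AE x in \<mu>. 0 \<le> (- 1) * v x" by eventually_elim auto
    moreover have "ip (\<lambda>x. (- 1) * v x) \<psi> = 0" by (simp only: ip_scale_left ip_v)
    ultimately have "AE x in \<mu>. (- 1) * v x = 0"
      by (intro AE_eq_0_if_ip_\<psi>_eq_0 bm_intros bm_v)
    then show ?thesis by simp
  next
    assume "AE x in \<mu>. 0 < \<bar>v x\<bar> + v x"
    then have "AE x in \<mu>. 0 \<le> v x" by eventually_elim auto
    then show ?thesis using bm_v ip_v by (intro AE_eq_0_if_ip_\<psi>_eq_0)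
  qed
  then show ?thesis by (simp add: v_def)
qed

text \<open>Both sides are images under \<open>T\<close>, so the almost everywhere identity becomes
  one at every point.\<close>

lemma eigenfunction_unique:
  assumes w: "bm w" "T w = w" shows "w x = ip w \<psi> * \<psi> x"
proof -
  have "T w = T (\<lambda>x. ip w \<psi> * \<psi> x)"
    using w eigenfunction_unique_AE[of w] by (intro T_cong_AE) (auto dest: bounded_measurableD)
  then show ?thesis using w by (simp add: T_scale fun_eq_iff)
qed

lemma ip_M_iter_\<psi>: "bm f \<Longrightarrow> ip (M_iter n f) \<psi> = ip f \<psi>"
proof -
  assume f: "bm f"
  have "M_iter n f = (\<lambda>x. (1 / 2) * ((T ^^ (2 * n + 1)) f x + (T ^^ (2 * n + 2)) f x))"
    by (simp add: M_iter_def fun_eq_iff)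
  then have "ip (M_iter n f) \<psi> = (1 / 2) * (ip ((T ^^ (2 * n + 1)) f) \<psi> + ip ((T ^^ (2 * n + 2)) f) \<psi>)"
    using f by (simp only: ip_scale_left ip_add_left bm_T_iter bm_\<psi>)
  then show ?thesis using f by (simp only: ip_T_iter_\<psi>) simp
qed

text \<open>The limit is fixed by \<open>T\<close>, hence a multiple of \<open>\<psi>\<close>. Its
  coefficient is read off from the pairing with \<open>\<psi>\<close>, which is the same for all
  \<open>n\<close> and equals \<open>T (T \<psi>) x = \<psi> x\<close>.\<close>

lemma M_iter_K2_LIMSEQ: "(\<lambda>n. M_iter n (K2 x) y) \<longlonglongrightarrow> \<psi> x * \<psi> y"
proof -
  obtain \<phi> where \<phi>: "bm \<phi>" "T \<phi> = \<phi>" "\<And>y. (\<lambda>n. M_iter n (K2 x) y) \<longlonglongrightarrow> \<phi> y"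
    using M_iter_LIMSEQ[OF bm_K2] by metis
  obtain C where C: "\<And>x. \<bar>\<psi> x\<bar> \<le> C" "0 < C" using bounded_measurable_bound[OF bm_\<psi>] by metis
  have "(\<lambda>n. ip (M_iter n (K2 x)) \<psi>) \<longlonglongrightarrow> ip \<phi> \<psi>"
    unfolding ip_def
  proof (rule dominated_convergence_bm)
    show "(\<lambda>n. M_iter n (K2 x) y * \<psi> y) \<longlonglongrightarrow> \<phi> y * \<psi> y" for y
      by (intro tendsto_mult_right \<phi>)
    show "\<bar>M_iter n (K2 x) y * \<psi> y\<bar> \<le> B * nrm (K2 x) * C" for n y
      using B_pos C unfolding abs_mult by (intro mult_mono M_iter_abs_le) auto
    show "(\<lambda>y. M_iter n (K2 x) y * \<psi> y) \<in> borel_measurable \<mu>" for n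
      by (intro bounded_measurableD bounded_measurable_mult bm_M_iter) auto
    show "(\<lambda>y. \<phi> y * \<psi> y) \<in> borel_measurable \<mu>"
      using \<phi> by (intro bounded_measurableD bounded_measurable_mult) auto
  qed
  moreover have "ip (M_iter n (K2 x)) \<psi> = \<psi> x" for n
    using T_T_eq_K2[OF bm_\<psi>, of x] by (simp add: ip_M_iter_\<psi>)
  ultimately have "ip \<phi> \<psi> = \<psi> x" by (simp add: LIMSEQ_const_iff)
  with eigenfunction_unique[OF \<phi>(1,2), of y] \<phi>(3)[of y] show ?thesis by simp
qed

abbreviation (input) resid :: "('a \<Rightarrow> real) \<Rightarrow> 'a \<Rightarrow> real" where
  "resid f \<equiv> \<lambda>x. f x - ip f \<psi> * \<psi> x"

abbreviation (input) M_diff :: "nat \<Rightarrow> 'a \<Rightarrow> 'a \<Rightarrow> real" where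
  "M_diff n x \<equiv> \<lambda>y. M_iter n (K2 x) y - \<psi> x * \<psi> y"

text \<open>The squared Hilbert-Schmidt distance between the average of the powers
  \<open>2 * n + 3\<close> and \<open>2 * n + 4\<close> and the projection onto
  \<open>\<psi>\<close>; the rows \<open>K2 x\<close> account for two of the powers.\<close>

definition M_error :: "nat \<Rightarrow> real" where
  "M_error n = (\<integral>x. nsq (M_diff n x) \<partial>\<mu>)"

lemma M_iter_K2_measurable [measurable]: "(\<lambda>(x, y). M_iter n (K2 x) y) \<in> borel_measurable (\<mu> \<Otimes>\<^sub>M \<mu>)"
proof -
  have "(\<lambda>p. (T ^^ k) (K2 (fst p)) (snd p)) \<in> borel_measurable (\<mu> \<Otimes>\<^sub>M \<mu>)" for k
    using T_iter_K2_measurable[of k] by (simp only: case_prod_beta')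
  then show ?thesis
    unfolding M_iter_def case_prod_beta'
    by (intro borel_measurable_divide borel_measurable_add borel_measurable_const)
qed

lemma M_iter_K2_diff_bound:
  obtains C where "\<And>n x y. (M_diff n x y)\<^sup>2 \<le> C"
proof -
  obtain C where C: "\<And>x. \<bar>\<psi> x\<bar> \<le> C" "0 < C" using bounded_measurable_bound[OF bm_\<psi>] by metis
  have "nrm (K2 x) \<le> nrm (\<lambda>_. B\<^sup>2)" for x by (rule nrm_mono) (auto simp: K2_le)
  then have K2: "B * nrm (K2 x) \<le> B * B\<^sup>2" for x using B_pos by (simp add: nrm_const)
  show thesis
  proof (rule that)
    fix n x y
    have "\<bar>\<psi> x * \<psi> y\<bar> \<le> C * C" using C unfolding abs_mult by (intro mult_mono) auto
    moreover have "\<bar>M_iter n (K2 x) y\<bar> \<le> B * B\<^sup>2" using M_iter_abs_le[OF bm_K2] K2 order_trans by blast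
    ultimately have "\<bar>M_diff n x y\<bar> \<le> B * B\<^sup>2 + C * C" by linarith
    then show "(M_diff n x y)\<^sup>2 \<le> (B * B\<^sup>2 + C * C)\<^sup>2"
      using abs_le_square_iff by fastforce
  qed
qed

lemma M_iter_K2_diff_nsq_measurable:
  "(\<lambda>x. nsq (M_diff n x)) \<in> borel_measurable \<mu>"
  unfolding nsq_def by measurable

lemma M_iter_K2_diff_nsq_le:
  assumes "\<And>n x y. (M_diff n x y)\<^sup>2 \<le> C"
  shows "nsq (M_diff n x) \<le> C"
proof -
  have "nsq (M_diff n x) \<le> (\<integral>y. C \<partial>\<mu>)"
    unfolding nsq_def using assms
    by (intro integral_mono integrable_bm bm_intros bm_M_iter) auto
  then show ?thesis by simp
qed

text \<open>Dominated convergence is used twice, in \<open>y\<close> for fixed \<open>x\<close> and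
  then in \<open>x\<close>, with a bound that is uniform in all variables.\<close>

lemma M_error_LIMSEQ: "M_error \<longlonglongrightarrow> 0"
proof -
  obtain C where C: "\<And>n x y. (M_diff n x y)\<^sup>2 \<le> C"
    using M_iter_K2_diff_bound by metis
  have "(\<lambda>n. \<integral>x. nsq (M_diff n x) \<partial>\<mu>) \<longlonglongrightarrow> (\<integral>x. 0 \<partial>\<mu>)"
  proof (rule dominated_convergence_bm)
    show "\<bar>nsq (M_diff n x)\<bar> \<le> C" for n x
      using M_iter_K2_diff_nsq_le[OF C] by simp
    fix x
    have "(\<lambda>n. \<integral>y. (M_diff n x y)\<^sup>2 \<partial>\<mu>) \<longlonglongrightarrow> (\<integral>y. 0 \<partial>\<mu>)"
    proof (rule dominated_convergence_bm)
      show "\<bar>(M_diff n x y)\<^sup>2\<bar> \<le> C" for n y using C by simp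
      show "(\<lambda>n. (M_diff n x y)\<^sup>2) \<longlonglongrightarrow> 0" for y
        using tendsto_power[OF tendsto_diff[OF M_iter_K2_LIMSEQ[of x y] tendsto_const[of "\<psi> x * \<psi> y"]], of 2]
        by simp
      show "(\<lambda>y. (M_diff n x y)\<^sup>2) \<in> borel_measurable \<mu>" for n
        by (rule bounded_measurableD) (intro bm_intros bm_M_iter bm_K2 bm_\<psi>)
    qed simp
    then show "(\<lambda>n. nsq (M_diff n x)) \<longlonglongrightarrow> 0" by (simp add: nsq_def)
  qed (auto intro: M_iter_K2_diff_nsq_measurable)
  then show ?thesis by (simp add: M_error_def[abs_def])
qed

text \<open>The Hilbert-Schmidt norm dominates the operator norm: the value at \<open>x\<close> is
  the inner product of \<open>f\<close> with the row \<open>M_diff n x\<close>, and Cauchy-Schwarz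
  is integrated over \<open>x\<close>.\<close>

lemma projection_error_nsq:
  assumes f: "bm f"
  shows "nsq (\<lambda>x. M_iter n (T (T f)) x - ip f \<psi> * \<psi> x) \<le> M_error n * nsq f"
proof -
  obtain C where C: "\<And>n x y. (M_diff n x y)\<^sup>2 \<le> C"
    using M_iter_K2_diff_bound by metis
  have bmd: "bm (M_diff n x)" for x
    by (intro bm_intros bm_M_iter bm_K2 bm_\<psi>)
  have eq: "M_iter n (T (T f)) x - ip f \<psi> * \<psi> x = ip (M_diff n x) f" for x
  proof -
    have M: "M_iter n (K2 x) = (\<lambda>y. (1 / 2) * ((T ^^ (2 * n + 1)) (K2 x) y + (T ^^ (2 * n + 2)) (K2 x) y))"
      by (simp add: M_iter_def fun_eq_iff)
    have "ip (M_iter n (K2 x)) f = (1 / 2) * (ip ((T ^^ (2 * n + 1)) (K2 x)) f + ip ((T ^^ (2 * n + 2)) (K2 x)) f)"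
      unfolding M using f by (simp only: ip_scale_left ip_add_left bm_T_iter bm_K2)
    also have "\<dots> = (1 / 2) * ((T ^^ (2 * n + 1 + 2)) f x + (T ^^ (2 * n + 2 + 2)) f x)"
      by (simp only: T_iter_eq_K2[OF f])
    also have "\<dots> = M_iter n (T (T f)) x"
      unfolding M_iter_def T_iter_T_T by simp
    finally have "M_iter n (T (T f)) x = ip (M_iter n (K2 x)) f" ..
    moreover have "ip f \<psi> * \<psi> x = ip (\<lambda>y. \<psi> x * \<psi> y) f"
      by (simp add: ip_scale_left ip_commute[of f])
    moreover have "ip (M_diff n x) f = ip (M_iter n (K2 x)) f - ip (\<lambda>y. \<psi> x * \<psi> y) f"
      using f by (intro ip_diff_left bounded_measurable_mult) auto
    ultimately show ?thesis by simp
  qed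
  have "nsq (\<lambda>x. M_iter n (T (T f)) x - ip f \<psi> * \<psi> x)
      \<le> (\<integral>x. nsq (M_diff n x) * nsq f \<partial>\<mu>)"
    unfolding nsq_def[of "\<lambda>x. M_iter n (T (T f)) x - ip f \<psi> * \<psi> x"]
  proof (rule integral_mono)
    show "integrable \<mu> (\<lambda>x. (M_iter n (T (T f)) x - ip f \<psi> * \<psi> x)\<^sup>2)"
      using f by (intro integrable_bm bm_intros bm_M_iter) auto
    show "integrable \<mu> (\<lambda>x. nsq (M_diff n x) * nsq f)"
      using M_iter_K2_diff_nsq_le[OF C]
      by (intro integrable_mult_left integrable_const_bound[where B = C] M_iter_K2_diff_nsq_measurable) auto
    show "(M_iter n (T (T f)) x - ip f \<psi> * \<psi> x)\<^sup>2 \<le> nsq (M_diff n x) * nsq f" for x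
      unfolding eq by (rule ip_square_le[OF bmd f])
  qed
  also have "\<dots> = M_error n * nsq f" by (simp add: M_error_def)
  finally show ?thesis .
qed

text \<open>Telescoping: since \<open>T\<close> is a contraction, each further power costs at most
  one residual.\<close>

lemma T_iter_diff_nrm:
  assumes f: "bm f"
  shows "nrm (\<lambda>x. (T ^^ k) f x - f x) \<le> k * nrm (\<lambda>x. T f x - f x)"
proof (induction k)
  case 0
  then show ?case by (simp add: nrm_const)
next
  case (Suc k)
  have bmd: "bm (\<lambda>x. (T ^^ k) f x - f x)" "bm (\<lambda>x. T f x - f x)" using f by auto
  have "(\<lambda>x. (T ^^ Suc k) f x - f x) = (\<lambda>x. T (\<lambda>x. (T ^^ k) f x - f x) x + (T f x - f x))"
    using f by (simp add: T_diff bm_T_iter)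
  then have "nrm (\<lambda>x. (T ^^ Suc k) f x - f x)
      \<le> nrm (T (\<lambda>x. (T ^^ k) f x - f x)) + nrm (\<lambda>x. T f x - f x)"
    using nrm_triangle[OF bm_T[OF bmd(1)] bmd(2)] by (simp only:)
  also have "\<dots> \<le> k * nrm (\<lambda>x. T f x - f x) + nrm (\<lambda>x. T f x - f x)"
    using contraction_nrm[OF bmd(1)] Suc by linarith
  finally show ?case by (simp add: distrib_right)
qed

text \<open>The averaged powers of \<open>f\<close> serve as an intermediate term: they differ from
  \<open>f\<close> by at most \<open>2 * n + 4\<close> residuals and from the projection by the
  Hilbert-Schmidt error. A nearly fixed function is therefore nearly a multiple of
  \<open>\<psi>\<close>.\<close>

lemma projection_error:
  assumes f: "bm f"
  shows "nrm (resid f)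
    \<le> sqrt (M_error n) * nrm f + (2 * n + 4) * nrm (\<lambda>x. T f x - f x)"
proof -
  let ?r = "nrm (\<lambda>x. T f x - f x)"
  have bmk: "bm (\<lambda>x. (T ^^ k) f x - f x)" for k using f by auto
  have bmM: "bm (\<lambda>x. M_iter n (T (T f)) x - f x)"
    by (intro bounded_measurable_diff bm_M_iter bm_T f)
  have bmP: "bm (\<lambda>x. M_iter n (T (T f)) x - ip f \<psi> * \<psi> x)"
    by (intro bm_intros bm_M_iter bm_T f bm_\<psi>)
  have "(\<lambda>x. M_iter n (T (T f)) x - f x)
      = (\<lambda>x. (1 / 2) * (((T ^^ (2 * n + 3)) f x - f x) + ((T ^^ (2 * n + 4)) f x - f x)))"
    unfolding M_iter_def T_iter_T_T by (simp add: fun_eq_iff field_simps numeral_eq_Suc)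
  then have "nrm (\<lambda>x. M_iter n (T (T f)) x - f x)
      = (1 / 2) * nrm (\<lambda>x. ((T ^^ (2 * n + 3)) f x - f x) + ((T ^^ (2 * n + 4)) f x - f x))"
    by (simp only: nrm_scale)
  also have "\<dots> \<le> (1 / 2) * (nrm (\<lambda>x. (T ^^ (2 * n + 3)) f x - f x) + nrm (\<lambda>x. (T ^^ (2 * n + 4)) f x - f x))"
    using nrm_triangle[OF bmk[of "2 * n + 3"] bmk[of "2 * n + 4"]] by simp
  also have "\<dots> \<le> (1 / 2) * (real (2 * n + 3) * ?r + real (2 * n + 4) * ?r)"
    using T_iter_diff_nrm[OF f, of "2 * n + 3"] T_iter_diff_nrm[OF f, of "2 * n + 4"]
    by (intro mult_left_mono add_mono) auto
  also have "\<dots> \<le> real (2 * n + 4) * ?r"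
    by (simp add: algebra_simps)
  finally have 1: "nrm (\<lambda>x. M_iter n (T (T f)) x - f x) \<le> real (2 * n + 4) * ?r" .
  have 2: "nrm (\<lambda>x. M_iter n (T (T f)) x - ip f \<psi> * \<psi> x) \<le> sqrt (M_error n) * nrm f"
    using projection_error_nsq[OF f, of n] by (simp add: nrm_def flip: real_sqrt_mult)
  have "(resid f)
      = (\<lambda>x. (M_iter n (T (T f)) x - ip f \<psi> * \<psi> x) + (-1) * (M_iter n (T (T f)) x - f x))"
    by (simp add: fun_eq_iff)
  then have "nrm (resid f)
      \<le> nrm (\<lambda>x. M_iter n (T (T f)) x - ip f \<psi> * \<psi> x) + nrm (\<lambda>x. (-1) * (M_iter n (T (T f)) x - f x))"
    using nrm_triangle[OF bmP bounded_measurable_mult[OF bounded_measurable_const[of _ "-1"] bmM]] by (simp only:)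
  also have "nrm (\<lambda>x. (-1) * (M_iter n (T (T f)) x - f x)) = nrm (\<lambda>x. M_iter n (T (T f)) x - f x)"
    by (simp only: nrm_scale)
  finally show ?thesis using 1 2 by simp
qed

lemma projection_error_tendsto_0:
  assumes f: "eventually (\<lambda>i. bm (f i) \<and> 0 < nrm (f i)) F"
    and r: "((\<lambda>i. nrm (\<lambda>x. T (f i) x - f i x) / nrm (f i)) \<longlongrightarrow> 0) F"
  shows "((\<lambda>i. nrm (resid (f i)) / nrm (f i)) \<longlongrightarrow> 0) F"
proof (rule tendstoI)
  fix e :: real assume e: "0 < e"
  have "(\<lambda>n. sqrt (M_error n)) \<longlonglongrightarrow> sqrt 0" by (intro tendsto_real_sqrt M_error_LIMSEQ)
  then have "eventually (\<lambda>n. sqrt (M_error n) < e / 2) sequentially"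
    using e by (intro order_tendstoD(2)) auto
  \<comment> \<open>\<open>n\<close> is chosen before the limit along \<open>F\<close> is taken, so
    the factor \<open>2 * n + 4\<close> in front of the residual is a constant.\<close>
  then obtain n where n: "sqrt (M_error n) < e / 2" by (auto simp: eventually_sequentially)
  have "eventually (\<lambda>i. nrm (\<lambda>x. T (f i) x - f i x) / nrm (f i) < e / (2 * (2 * n + 4))) F"
    using e by (intro order_tendstoD(2)[OF r]) auto
  with f show "eventually (\<lambda>i. dist (nrm (resid (f i)) / nrm (f i)) 0 < e) F"
  proof eventually_elim
    case (elim i)
    then have pos: "0 < nrm (f i)" by simp
    let ?r = "nrm (\<lambda>x. T (f i) x - f i x)"
    have "nrm (resid (f i)) / nrm (f i)
        \<le> (sqrt (M_error n) * nrm (f i) + real (2 * n + 4) * ?r) / nrm (f i)"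
      using projection_error[of "f i" n] elim pos by (intro divide_right_mono) auto
    also have "\<dots> = sqrt (M_error n) + real (2 * n + 4) * (?r / nrm (f i))"
      using pos by (simp add: field_simps)
    also have "\<dots> < e / 2 + real (2 * n + 4) * (e / (2 * (2 * n + 4)))"
      using n elim by (intro add_strict_mono mult_strict_left_mono) auto
    also have "\<dots> = e" by (simp add: field_simps)
    finally show ?case using pos by simp
  qed
qed

end

section \<open>Survival just above criticality\<close>

lemma exp_minus_le_inverse: "0 \<le> u \<Longrightarrow> exp (- u) \<le> 1 / (1 + u)" for u :: real
  using exp_ge_add_one_self[of u] by (simp add: exp_minus divide_inverse le_imp_inverse_le)

text \<open>For \<open>u = c * T f x\<close> and \<open>f x = 1 - exp (- u)\<close> the expression
  \<open>u - 1 + exp (- u)\<close> is the gap between \<open>u\<close> and \<open>f x\<close>. Its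
  sign, its order of magnitude and its quadratic leading term drive the analysis near
  criticality.\<close>

lemma exp_minus_defect_nonneg: "0 \<le> u - 1 + exp (- u)" for u :: real
  using exp_ge_add_one_self[of "- u"] by simp

lemma exp_minus_defect_le_square:
  fixes u :: real assumes "0 \<le> u" shows "u - 1 + exp (- u) \<le> u\<^sup>2"
proof -
  have "u - 1 + exp (- u) \<le> u - 1 + 1 / (1 + u)"
    using exp_minus_le_inverse[OF assms] by simp
  also have "\<dots> = u\<^sup>2 / (1 + u)"
    using assms by (simp add: field_simps power2_eq_square)
  also have "\<dots> \<le> u\<^sup>2"
    using assms by (simp add: divide_le_eq mult_le_cancel_left1)
  finally show ?thesis .
qed

text \<open>The second order remainder in Lagrange form, with the exponential bounded below by its
  value at \<open>- b\<close>.\<close>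

lemma exp_minus_defect_ge:
  fixes u :: real assumes "0 \<le> u" "u \<le> b" shows "exp (- b) / 2 * u\<^sup>2 \<le> u - 1 + exp (- u)"
proof -
  obtain t where t: "\<bar>t\<bar> \<le> \<bar>- u\<bar>" "exp (- u) = (\<Sum>m<2. (- u) ^ m / fact m) + exp t / fact 2 * (- u) ^ 2"
    using Maclaurin_exp_le by blast
  have "exp (- b) \<le> exp t" using t(1) assms by simp
  then have "exp (- b) / 2 * u\<^sup>2 \<le> exp t / 2 * u\<^sup>2" by (intro mult_right_mono) auto
  also have "\<dots> = u - 1 + exp (- u)"
    unfolding t(2) by (simp add: numeral_2_eq_2)
  finally show ?thesis .
qed

lemma exp_minus_defect_quadratic:
  fixes u :: real assumes "0 \<le> u" "u \<le> 1" shows "\<bar>u - 1 + exp (- u) - u\<^sup>2 / 2\<bar> \<le> u ^ 3"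
proof -
  obtain t where t: "\<bar>t\<bar> \<le> \<bar>- u\<bar>" "exp (- u) = (\<Sum>m<3. (- u) ^ m / fact m) + exp t / fact 3 * (- u) ^ 3"
    using Maclaurin_exp_le by blast
  have "exp t \<le> exp 1" using t(1) assms by simp
  also have "\<dots> \<le> 3" by (rule exp_le)
  finally have "exp t / 6 \<le> 1" by simp
  then have "exp t / 6 * u ^ 3 \<le> 1 * u ^ 3" using assms by (intro mult_right_mono) auto
  moreover have "u - 1 + exp (- u) - u\<^sup>2 / 2 = - (exp t / 6 * u ^ 3)"
    unfolding t(2) by (simp add: numeral_3_eq_3 fact_numeral power2_eq_square power3_eq_cube)
  ultimately show ?thesis using assms by simp
qed

section \<open>Fixed points of the survival equation\<close>

context critical_eigenfunction
begin

text \<open>This does not single out the survival function, as the zero function qualifies for every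
  \<open>c\<close>; hence the assumption \<open>lower\<close> in
  \<open>survival_asymptotics\<close>.\<close>

definition survival_fixpoint :: "real \<Rightarrow> ('a \<Rightarrow> real) \<Rightarrow> bool" where
  "survival_fixpoint c f \<longleftrightarrow> bm f \<and> (\<forall>x. 0 \<le> f x \<and> f x = 1 - exp (- (c * T f x)))"

lemma ip_\<psi>_le_1:
  assumes "bm f" "\<And>x. 0 \<le> f x" "\<And>x. f x \<le> 1" shows "ip f \<psi> \<le> 1"
proof -
  have "nrm f \<le> nrm (\<lambda>_. 1)" using assms by (intro nrm_mono) auto
  then have "nrm f \<le> 1" by (simp add: nrm_const)
  then show ?thesis using abs_ip_le[OF assms(1) bm_\<psi>] by simp
qed

context
  fixes c f assumes c: "0 < c" and fp: "survival_fixpoint c f"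
begin

lemma fp_bm: "bm f" and fp_nonneg: "0 \<le> f x" and fp_eq: "f x = 1 - exp (- (c * T f x))"
  using fp unfolding survival_fixpoint_def by blast+

lemma fp_le_1: "f x \<le> 1"
  using fp_eq[of x] by simp

lemma fp_u_nonneg: "0 \<le> c * T f x"
  using c fp_nonneg by (simp add: T_nonneg)

lemma fp_le_u: "f x \<le> c * T f x"
  using exp_minus_defect_nonneg[of "c * T f x"] fp_eq[of x] by simp

lemma fp_nrm_le_1: "nrm f \<le> 1"
proof -
  have "nrm f \<le> nrm (\<lambda>_. 1)" using fp_nonneg fp_le_1 by (intro nrm_mono fp_bm) auto
  then show ?thesis by (simp add: nrm_const)
qed

lemma fp_u_le: "c * T f x \<le> c * B * nrm f"
  using T_abs_le[OF fp_bm, of x] c by (simp add: mult.assoc)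

lemma fp_bm_defect: "bm (\<lambda>x. c * T f x - f x)"
  using fp_bm by (intro bm_intros bm_T) auto

lemma fp_defect_eq: "c * T f x - f x = c * T f x - 1 + exp (- (c * T f x))"
  using fp_eq[of x] by simp

text \<open>Self-adjointness together with \<open>T \<psi> = \<psi>\<close>. The left side is of
  second order in \<open>f\<close>, the right side of first order with the small factor
  \<open>c - 1\<close>; their balance determines the size of \<open>f\<close>.\<close>

lemma fp_ip_defect: "ip (\<lambda>x. c * T f x - f x) \<psi> = (c - 1) * ip f \<psi>"
  using fp_bm by (subst ip_diff_left)
    (auto simp: ip_scale_left ip_T_\<psi> left_diff_distrib intro!: bounded_measurable_mult)

text \<open>The gap is non-negative, yet its pairing with \<open>\<psi>\<close> is
  \<open>(c - 1) * ip f \<psi> \<le> 0\<close>. So it vanishes almost everywhere, which happens only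
  where \<open>c * T f x = 0\<close>.\<close>

lemma fp_subcritical:
  assumes "c \<le> 1" shows "AE x in \<mu>. f x = 0"
proof -
  have defect: "0 \<le> c * T f x - f x" for x using fp_le_u[of x] by simp
  have "0 \<le> ip f \<psi>" unfolding ip_def using fp_nonneg by simp
  then have "ip (\<lambda>x. c * T f x - f x) \<psi> \<le> 0"
    unfolding fp_ip_defect using assms by (simp add: mult_nonpos_nonneg)
  moreover have "0 \<le> ip (\<lambda>x. c * T f x - f x) \<psi>" unfolding ip_def using defect by simp
  ultimately have "AE x in \<mu>. c * T f x - f x = 0"
    using defect by (intro AE_eq_0_if_ip_\<psi>_eq_0 fp_bm_defect) auto
  then show ?thesis
  proof eventually_elim
    case (elim x)
    let ?u = "c * T f x"
    have "exp (- ?u) / 2 * ?u\<^sup>2 \<le> 0"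
      using exp_minus_defect_ge[OF fp_u_nonneg order_refl, of x] elim fp_defect_eq[of x] by simp
    then have "?u = 0" by (simp add: mult_le_0_iff)
    with elim show ?case by simp
  qed
qed

text \<open>For \<open>c \<le> 2\<close> the argument \<open>c * T f x\<close> stays in the interval
  from 0 to \<open>2 * B\<close>. There the gap is at least \<open>exp (- (2 * B)) / 2\<close> times
  its square, hence also times \<open>(f x)\<^sup>2\<close>.\<close>

lemma fp_weighted_square:
  assumes "c \<le> 2" shows "exp (- (2 * B)) / 2 * (\<integral>x. (f x)\<^sup>2 * \<psi> x \<partial>\<mu>) \<le> (c - 1) * ip f \<psi>"
proof -
  have "exp (- (2 * B)) / 2 * (\<integral>x. (f x)\<^sup>2 * \<psi> x \<partial>\<mu>) = (\<integral>x. exp (- (2 * B)) / 2 * (f x)\<^sup>2 * \<psi> x \<partial>\<mu>)"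
    by (simp only: mult.assoc integral_mult_right_zero)
  also have "\<dots> \<le> ip (\<lambda>x. c * T f x - f x) \<psi>"
    unfolding ip_def
  proof (rule integral_mono)
    show "integrable \<mu> (\<lambda>x. exp (- (2 * B)) / 2 * (f x)\<^sup>2 * \<psi> x)"
      by (intro integrable_bm bm_intros fp_bm bm_\<psi>)
    show "integrable \<mu> (\<lambda>x. (c * T f x - f x) * \<psi> x)"
      by (intro integrable_bm bounded_measurable_mult fp_bm_defect bm_\<psi>)
    fix x
    have "c * B * nrm f \<le> 2 * B * 1" using assms c B_pos fp_nrm_le_1 by (intro mult_mono) auto
    then have u: "c * T f x \<le> 2 * B" using fp_u_le[of x] by simp
    have "(f x)\<^sup>2 \<le> (c * T f x)\<^sup>2" by (intro power_mono fp_le_u fp_nonneg)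
    then have "exp (- (2 * B)) / 2 * (f x)\<^sup>2 \<le> exp (- (2 * B)) / 2 * (c * T f x)\<^sup>2"
      by (intro mult_left_mono) auto
    also have "\<dots> \<le> c * T f x - f x"
      unfolding fp_defect_eq by (rule exp_minus_defect_ge[OF fp_u_nonneg u])
    finally show "exp (- (2 * B)) / 2 * (f x)\<^sup>2 * \<psi> x \<le> (c * T f x - f x) * \<psi> x"
      by (intro mult_right_mono) auto
  qed
  finally show ?thesis by (simp only: fp_ip_defect)
qed

text \<open>\<open>T f x - f x\<close> is the gap minus \<open>(c - 1) * T f x\<close>. The gap is
  at most \<open>(c * T f x)\<^sup>2\<close>, where one factor is bounded by
  \<open>c * B * nrm f\<close>; so the residual is of smaller order than \<open>f\<close> once
  \<open>c - 1\<close> and \<open>nrm f\<close> are small.\<close>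

lemma fp_residual:
  assumes c1: "1 \<le> c"
  shows "nrm (\<lambda>x. T f x - f x) \<le> ((c - 1) + c\<^sup>2 * B * nrm f) * nrm f"
proof -
  let ?k = "(c - 1) + c\<^sup>2 * B * nrm f"
  have k: "0 \<le> ?k" using c1 B_pos by simp
  have "nrm (\<lambda>x. T f x - f x) \<le> nrm (\<lambda>x. ?k * T f x)"
  proof (rule nrm_mono)
    show "bm (\<lambda>x. T f x - f x)" "bm (\<lambda>x. ?k * T f x)"
      by (intro bm_intros bm_T fp_bm)+
    fix x
    let ?u = "c * T f x"
    have Tf: "0 \<le> T f x" using fp_nonneg by (rule T_nonneg)
    have d: "0 \<le> ?u - f x" "?u - f x \<le> ?u\<^sup>2"
      using fp_le_u[of x] exp_minus_defect_le_square[OF fp_u_nonneg, of x] fp_defect_eq[of x] by auto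
    have "?u\<^sup>2 = ?u * ?u" by (simp add: power2_eq_square)
    also have "\<dots> \<le> c * B * nrm f * ?u" by (intro mult_right_mono fp_u_le fp_u_nonneg)
    also have "\<dots> = c\<^sup>2 * B * nrm f * T f x" by (simp add: power2_eq_square)
    finally have "?u - f x \<le> c\<^sup>2 * B * nrm f * T f x" using d by simp
    moreover have "T f x - f x = (?u - f x) - (c - 1) * T f x" by (simp add: algebra_simps)
    moreover have "0 \<le> (c - 1) * T f x" using c1 Tf by simp
    ultimately have "\<bar>T f x - f x\<bar> \<le> (c - 1) * T f x + c\<^sup>2 * B * nrm f * T f x"
      using d(1) by linarith
    then show "\<bar>T f x - f x\<bar> \<le> \<bar>?k * T f x\<bar>"
      using k Tf by (simp add: distrib_right)
  qed
  also have "\<dots> = ?k * nrm (T f)" using k by (simp add: nrm_scale)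
  also have "\<dots> \<le> ?k * nrm f" using k by (intro mult_left_mono contraction_nrm fp_bm)
  finally show ?thesis .
qed

text \<open>With \<open>a = ip f \<psi>\<close>, the quotient \<open>c * T f x / a\<close> is within
  \<open>E\<close> of \<open>\<psi> x\<close> at every \<open>x\<close>: the first part of
  \<open>E\<close> bounds the image of \<open>resid f\<close>, the second the term
  \<open>(c - 1) * \<psi> x\<close>. Hence the gap divided by \<open>a\<^sup>2\<close> is close to
  \<open>(\<psi> x)\<^sup>2 / 2\<close>, and its pairing with \<open>\<psi>\<close> is
  \<open>(c - 1) / a\<close>. The two error terms come from the cubic remainder of the exponential
  and from squaring the quotient.\<close>

lemma fp_first_order:
  assumes c1: "1 < c" and C: "\<And>x. \<psi> x \<le> C" and small: "c * B * nrm f \<le> 1" and a: "0 < ip f \<psi>"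
  defines "E \<equiv> c * B * (nrm (resid f) / ip f \<psi>) + (c - 1) * C"
  shows "\<bar>(c - 1) / ip f \<psi> - (\<integral>x. \<psi> x ^ 3 \<partial>\<mu>) / 2\<bar> \<le> (C + E) ^ 3 * ip f \<psi> + E * (2 * C + E) / 2"
proof -
  let ?a = "ip f \<psi>" and ?d = "\<lambda>x. f x - ip f \<psi> * \<psi> x" and ?u = "\<lambda>x. c * T f x"
  let ?R = "(C + E) ^ 3 * ?a + E * (2 * C + E) / 2"
  have bmd: "bm ?d"
    by (intro bm_intros fp_bm bm_\<psi>)
  have C0: "0 \<le> C" using C \<psi>_nonneg order_trans by blast
  have E0: "0 \<le> E" unfolding E_def using c1 B_pos C0 a by simp
  have R0: "0 \<le> ?R" using C0 E0 a by simp
  have approx: "\<bar>?u x / ?a - \<psi> x\<bar> \<le> E" for x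
  proof -
    have "T ?d x = T f x - ?a * \<psi> x"
      using fp_bm by (subst T_diff) (auto simp: T_scale intro!: bounded_measurable_mult)
    then have "?u x - ?a * \<psi> x = c * T ?d x + (c - 1) * (?a * \<psi> x)"
      by (simp only:) (simp add: algebra_simps)
    moreover have "\<bar>c * T ?d x\<bar> \<le> c * (B * nrm ?d)"
      using T_abs_le[OF bmd, of x] c by (simp add: abs_mult)
    moreover have "\<bar>(c - 1) * (?a * \<psi> x)\<bar> \<le> (c - 1) * (?a * C)"
      using C[of x] c1 a by (simp add: abs_mult)
    ultimately have "\<bar>?u x - ?a * \<psi> x\<bar> \<le> c * (B * nrm ?d) + (c - 1) * (?a * C)" by linarith
    then have "\<bar>?u x - ?a * \<psi> x\<bar> / ?a \<le> (c * (B * nrm ?d) + (c - 1) * (?a * C)) / ?a"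
      using a by (intro divide_right_mono) auto
    moreover have "?u x / ?a - \<psi> x = (?u x - ?a * \<psi> x) / ?a"
      using a by (simp add: diff_divide_distrib)
    then have "\<bar>?u x - ?a * \<psi> x\<bar> / ?a = \<bar>?u x / ?a - \<psi> x\<bar>"
      using a by (simp only: abs_divide abs_of_pos)
    moreover have "(c * (B * nrm ?d) + (c - 1) * (?a * C)) / ?a = E"
      using a by (simp add: E_def field_simps)
    ultimately show ?thesis by simp
  qed
  have pointwise: "\<bar>(?u x - f x) / ?a\<^sup>2 - (\<psi> x)\<^sup>2 / 2\<bar> \<le> ?R" for x
  proof -
    let ?w = "?u x / ?a"
    have u1: "0 \<le> ?u x" "?u x \<le> 1" using fp_u_nonneg fp_u_le[of x] small by auto
    have w: "0 \<le> ?w" "?w \<le> C + E" using u1 a approx[of x] C[of x] by auto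
    have "(?u x - f x) / ?a\<^sup>2 - ?w\<^sup>2 / 2 = ((?u x - f x) - (?u x)\<^sup>2 / 2) / ?a\<^sup>2"
      by (simp add: power_divide diff_divide_distrib mult.commute)
    then have "\<bar>(?u x - f x) / ?a\<^sup>2 - ?w\<^sup>2 / 2\<bar> = \<bar>(?u x - 1 + exp (- ?u x)) - (?u x)\<^sup>2 / 2\<bar> / ?a\<^sup>2"
      unfolding fp_defect_eq[of x] by (simp only: abs_divide abs_power2)
    also have "\<dots> \<le> ?u x ^ 3 / ?a\<^sup>2"
      by (intro divide_right_mono exp_minus_defect_quadratic u1) simp
    also have "\<dots> = ?w ^ 3 * ?a" using a by (simp add: power2_eq_square power3_eq_cube)
    also have "\<dots> \<le> (C + E) ^ 3 * ?a" using w a by (intro mult_right_mono power_mono) auto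
    finally have 1: "\<bar>(?u x - f x) / ?a\<^sup>2 - ?w\<^sup>2 / 2\<bar> \<le> (C + E) ^ 3 * ?a" .
    have "?w\<^sup>2 - (\<psi> x)\<^sup>2 = (?w - \<psi> x) * (?w + \<psi> x)" by (simp add: power2_eq_square algebra_simps)
    then have "\<bar>?w\<^sup>2 - (\<psi> x)\<^sup>2\<bar> = \<bar>?w - \<psi> x\<bar> * \<bar>?w + \<psi> x\<bar>" by (simp only: abs_mult)
    also have "\<dots> \<le> E * (2 * C + E)"
      using approx[of x] w C[of x] E0 by (intro mult_mono) auto
    finally have "\<bar>?w\<^sup>2 - (\<psi> x)\<^sup>2\<bar> / 2 \<le> E * (2 * C + E) / 2" by simp
    with 1 show ?thesis by argo
  qed
  have bmv: "bm (\<lambda>x. (?u x - f x) / ?a\<^sup>2)"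
    by (intro bounded_measurable_divide fp_bm_defect)
  have "(c - 1) / ?a = (c - 1) * ?a / ?a\<^sup>2" using a by (simp add: power2_eq_square)
  also have "\<dots> = (\<integral>x. (?u x - f x) / ?a\<^sup>2 * \<psi> x \<partial>\<mu>)"
    unfolding fp_ip_defect[symmetric] by (simp add: ip_def)
  finally have "(c - 1) / ?a - (\<integral>x. \<psi> x ^ 3 \<partial>\<mu>) / 2
      = (\<integral>x. (?u x - f x) / ?a\<^sup>2 * \<psi> x \<partial>\<mu>) - (\<integral>x. \<psi> x ^ 3 / 2 \<partial>\<mu>)" by simp
  also have "\<dots> = (\<integral>x. (?u x - f x) / ?a\<^sup>2 * \<psi> x - \<psi> x ^ 3 / 2 \<partial>\<mu>)"
    by (intro Bochner_Integration.integral_diff[symmetric] integrable_bm bm_intros bmv bm_\<psi>)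
  also have "\<dots> = ip (\<lambda>x. (?u x - f x) / ?a\<^sup>2 - (\<psi> x)\<^sup>2 / 2) \<psi>"
    unfolding ip_def by (intro Bochner_Integration.integral_cong refl)
      (simp add: left_diff_distrib power2_eq_square power3_eq_cube)
  finally have eq: "(c - 1) / ?a - (\<integral>x. \<psi> x ^ 3 \<partial>\<mu>) / 2 = ip (\<lambda>x. (?u x - f x) / ?a\<^sup>2 - (\<psi> x)\<^sup>2 / 2) \<psi>" .
  have bme: "bm (\<lambda>x. (?u x - f x) / ?a\<^sup>2 - (\<psi> x)\<^sup>2 / 2)"
    by (intro bm_intros bmv bm_\<psi>)
  have "nrm (\<lambda>x. (?u x - f x) / ?a\<^sup>2 - (\<psi> x)\<^sup>2 / 2) \<le> nrm (\<lambda>_. ?R)"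
    using pointwise R0 by (intro nrm_mono bme) auto
  then have "nrm (\<lambda>x. (?u x - f x) / ?a\<^sup>2 - (\<psi> x)\<^sup>2 / 2) \<le> ?R"
    using R0 by (simp add: nrm_const)
  with abs_ip_le[OF bme bm_\<psi>] show ?thesis unfolding eq by simp
qed

lemma fp_integral_approx:
  assumes a: "0 < ip f \<psi>"
  shows "\<bar>(\<integral>x. f x \<partial>\<mu>) / ip f \<psi> - (\<integral>x. \<psi> x \<partial>\<mu>)\<bar> \<le> nrm (resid f) / ip f \<psi>"
proof -
  let ?a = "ip f \<psi>"
  have bmd: "bm (resid f)"
    by (intro bm_intros fp_bm bm_\<psi>)
  have "(\<integral>x. f x - ?a * \<psi> x \<partial>\<mu>) = (\<integral>x. f x \<partial>\<mu>) - ?a * (\<integral>x. \<psi> x \<partial>\<mu>)"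
    using fp_bm by (simp add: integrable_bm)
  then have "(\<integral>x. f x \<partial>\<mu>) / ?a - (\<integral>x. \<psi> x \<partial>\<mu>) = (\<integral>x. f x - ?a * \<psi> x \<partial>\<mu>) / ?a"
    using a by (simp only: diff_divide_distrib) simp
  then have "\<bar>(\<integral>x. f x \<partial>\<mu>) / ?a - (\<integral>x. \<psi> x \<partial>\<mu>)\<bar> = \<bar>\<integral>x. f x - ?a * \<psi> x \<partial>\<mu>\<bar> / ?a"
    using a by (simp only: abs_divide abs_of_pos)
  also have "\<dots> \<le> nrm (resid f) / ?a"
    using a by (intro divide_right_mono abs_integral_le_nrm bmd) simp
  finally show ?thesis .
qed

end

text \<open>The choice \<open>\<delta> = (c - 1) / (c * C)\<close> gives
  \<open>c * y \<le> c - 1\<close> for \<open>y = \<delta> * \<psi> x\<close>, and this yields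
  \<open>1 / (1 + c * y) \<le> 1 - y\<close>. The form with an arbitrary \<open>g\<close> above
  \<open>\<delta> * \<psi>\<close> is what an induction along the iterates started at 1
  uses.\<close>

lemma fixpoint_supersolution:
  assumes c: "1 < c"
  obtains \<delta> where "0 < \<delta>" "\<And>x. \<delta> * \<psi> x \<le> 1"
    "\<And>g x. bm g \<Longrightarrow> (\<And>y. \<delta> * \<psi> y \<le> g y) \<Longrightarrow> \<delta> * \<psi> x \<le> 1 - exp (- (c * T g x))"
proof -
  obtain C where C: "\<And>x. \<bar>\<psi> x\<bar> \<le> C" "0 < C" using bounded_measurable_bound[OF bm_\<psi>] by metis
  define \<delta> where "\<delta> = (c - 1) / (c * C)"
  have \<delta>: "0 < \<delta>" using c C by (simp add: \<delta>_def)
  have le: "\<delta> * \<psi> x \<le> (c - 1) / c" for x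
  proof -
    have "\<delta> * \<psi> x \<le> \<delta> * C" using C(1)[of x] \<delta> by simp
    also have "\<dots> = (c - 1) / c" using c C by (simp add: \<delta>_def)
    finally show ?thesis .
  qed
  show thesis
  proof (rule that[OF \<delta>])
    have "(c - 1) / c \<le> 1" using c by simp
    then show "\<delta> * \<psi> x \<le> 1" for x using le[of x] by linarith
    fix g x assume g: "bm g" "\<And>y. \<delta> * \<psi> y \<le> g y"
    let ?y = "\<delta> * \<psi> x"
    have y: "0 \<le> ?y" using \<delta> by simp
    have "T (\<lambda>y. \<delta> * \<psi> y) x \<le> T g x" using g by (intro T_mono) auto
    then have "c * ?y \<le> c * T g x" using c by (simp add: T_scale)
    then have "exp (- (c * T g x)) \<le> exp (- (c * ?y))" by simp
    also have "\<dots> \<le> 1 / (1 + c * ?y)" using c y by (intro exp_minus_le_inverse) simp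
    also have "\<dots> \<le> 1 - ?y"
    proof -
      have "c * ?y \<le> c - 1" using le[of x] c by (simp add: field_simps)
      then have "?y * (c * ?y) \<le> ?y * (c - 1)" using y by (rule mult_left_mono)
      then have "1 \<le> (1 - ?y) * (1 + c * ?y)" by (simp add: algebra_simps)
      moreover have "0 < 1 + c * ?y" using c y by (simp add: add_pos_nonneg)
      ultimately show ?thesis by (simp add: divide_le_eq)
    qed
    finally show "?y \<le> 1 - exp (- (c * T g x))" by simp
  qed
qed

section \<open>Vanishing of the survival function at criticality\<close>

lemma sets_\<psi>_less: "{x. \<psi> x < d} \<in> sets \<mu>"
proof -
  have "{x \<in> space \<mu>. \<psi> x < d} \<in> sets \<mu>" by measurable
  then show ?thesis by simp
qed

lemma prob_\<psi>_small:
  assumes e: "0 < e" obtains \<delta> where "0 < \<delta>" "prob {x. \<psi> x < \<delta>} < e"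
proof -
  have "(\<lambda>n. \<integral>x. (indicator {x. \<psi> x < inverse (real (Suc n))} x :: real) \<partial>\<mu>) \<longlonglongrightarrow> (\<integral>x. 0 \<partial>\<mu>)"
  proof (rule integral_dominated_convergence[where w = "\<lambda>_. 1"])
    show "AE x in \<mu>. (\<lambda>n. indicator {x. \<psi> x < inverse (real (Suc n))} x :: real) \<longlonglongrightarrow> 0"
      using \<psi>_pos
    proof eventually_elim
      case (elim x)
      then have "eventually (\<lambda>n. inverse (real (Suc n)) < \<psi> x) sequentially"
        by (intro order_tendstoD(2)[OF LIMSEQ_inverse_real_of_nat])
      then have "eventually (\<lambda>n. indicator {x. \<psi> x < inverse (real (Suc n))} x = (0 :: real)) sequentially"
        by eventually_elim simp
      then show ?case by (rule tendsto_eventually)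
    qed
  qed (auto simp: indicator_def)
  then have "(\<lambda>n. prob {x. \<psi> x < inverse (real (Suc n))}) \<longlonglongrightarrow> 0"
    using sets_\<psi>_less by simp
  from order_tendstoD(2)[OF this e] obtain n where "prob {x. \<psi> x < inverse (real (Suc n))} < e"
    by (auto simp: eventually_sequentially)
  then show thesis by (intro that[of "inverse (real (Suc n))"]) auto
qed

text \<open>Where \<open>\<psi> x < \<delta>\<close> the bound \<open>f x \<le> 1\<close> is used;
  elsewhere \<open>(f x)\<^sup>2\<close> is at most
  \<open>(f x)\<^sup>2 * \<psi> x / \<delta>\<close>, whose integral is controlled by
  \<open>fp_weighted_square\<close>.\<close>

lemma fp_nsq_le:
  assumes c: "1 < c" "c \<le> 2" and fp: "survival_fixpoint c f" and d: "0 < \<delta>"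
  shows "nsq f \<le> prob {x. \<psi> x < \<delta>} + (c - 1) * (2 * exp (2 * B)) / \<delta>"
proof -
  have c0: "0 < c" using c by simp
  note f = fp_bm[OF c0 fp] fp_nonneg[OF c0 fp] fp_le_1[OF c0 fp]
  note meas = sets_\<psi>_less[of \<delta>]
  have bm2: "bm (\<lambda>x. (f x)\<^sup>2 * \<psi> x / \<delta>)"
    by (intro bm_intros f bm_\<psi>)
  have bmi: "bm (indicator {x. \<psi> x < \<delta>})"
    using meas by (intro bounded_measurableI[where C = 1]) (auto simp: indicator_def)
  have "nsq f \<le> (\<integral>x. indicator {x. \<psi> x < \<delta>} x + (f x)\<^sup>2 * \<psi> x / \<delta> \<partial>\<mu>)"
    unfolding nsq_def
  proof (rule integral_mono)
    show "integrable \<mu> (\<lambda>x. (f x)\<^sup>2)" by (intro integrable_bm bounded_measurable_power f)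
    show "integrable \<mu> (\<lambda>x. indicator {x. \<psi> x < \<delta>} x + (f x)\<^sup>2 * \<psi> x / \<delta>)"
      by (intro integrable_bm bounded_measurable_add bmi bm2)
    fix x
    show "(f x)\<^sup>2 \<le> indicator {x. \<psi> x < \<delta>} x + (f x)\<^sup>2 * \<psi> x / \<delta>"
    proof (cases "\<psi> x < \<delta>")
      case True
      have "(f x)\<^sup>2 \<le> 1" using f(2,3)[of x] by (simp add: power_le_one)
      moreover have "0 \<le> (f x)\<^sup>2 * \<psi> x / \<delta>" using d by simp
      ultimately show ?thesis using True by simp
    next
      case False
      then have "(f x)\<^sup>2 * 1 \<le> (f x)\<^sup>2 * (\<psi> x / \<delta>)" using d by (intro mult_left_mono) auto
      with False show ?thesis by simp
    qed
  qed
  also have "\<dots> = prob {x. \<psi> x < \<delta>} + (\<integral>x. (f x)\<^sup>2 * \<psi> x \<partial>\<mu>) / \<delta>"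
    using meas integrable_bm[OF bmi] integrable_bm[OF bm2] by simp
  also have "(\<integral>x. (f x)\<^sup>2 * \<psi> x \<partial>\<mu>) \<le> (c - 1) * (2 * exp (2 * B))"
  proof -
    let ?J = "\<integral>x. (f x)\<^sup>2 * \<psi> x \<partial>\<mu>"
    have "exp (- (2 * B)) / 2 * ?J \<le> (c - 1) * ip f \<psi>"
      by (rule fp_weighted_square[OF c0 fp c(2)])
    also have "\<dots> \<le> (c - 1) * 1" using c ip_\<psi>_le_1[OF f] by (intro mult_left_mono) auto
    finally have "exp (- (2 * B)) / 2 * ?J * (2 * exp (2 * B)) \<le> (c - 1) * 1 * (2 * exp (2 * B))"
      by (rule mult_right_mono) simp
    moreover have "exp (- (2 * B)) / 2 * y * (2 * exp (2 * B)) = y * exp (- (2 * B) + 2 * B)" for y :: real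
      by (simp only: exp_add) simp
    ultimately have "?J * exp (- (2 * B) + 2 * B) \<le> (c - 1) * 1 * (2 * exp (2 * B))" by (simp only:)
    then show ?thesis by simp
  qed
  finally show ?thesis using d by (simp add: divide_right_mono)
qed

lemma integral_power_\<psi>_pos: "0 < (\<integral>x. \<psi> x ^ n \<partial>\<mu>)"
proof -
  have "(\<integral>x. \<psi> x ^ n \<partial>\<mu>) \<noteq> 0"
  proof
    assume "(\<integral>x. \<psi> x ^ n \<partial>\<mu>) = 0"
    then have "AE x in \<mu>. \<psi> x ^ n = 0"
      by (subst (asm) integral_nonneg_eq_0_iff_AE) auto
    with \<psi>_pos have "AE x in \<mu>. False" by eventually_elim auto
    then show False by simp
  qed
  moreover have "0 \<le> (\<integral>x. \<psi> x ^ n \<partial>\<mu>)" by simp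
  ultimately show ?thesis by linarith
qed

text \<open>With \<open>a = \<langle>f\<^sub>c, \<psi>\<rangle>\<close> one has \<open>f\<^sub>c \<approx> a \<psi>\<close>, and pairing the fixed point equation with \<open>\<psi>\<close> gives
  \<open>(c - 1) a = \<langle>u - 1 + exp (- u), \<psi>\<rangle> \<approx> a\<^sup>2 \<integral>\<psi>\<^sup>3 / 2\<close> for \<open>u = c T f\<^sub>c\<close>.\<close>

theorem survival_asymptotics:
  assumes fp: "\<And>c. 1 < c \<Longrightarrow> survival_fixpoint c (f c)"
    and lower: "\<And>c. 1 < c \<Longrightarrow> \<exists>\<delta>>0. \<forall>x. \<delta> * \<psi> x \<le> f c x"
  shows "((\<lambda>c. (\<integral>x. f c x \<partial>\<mu>) / (c - 1)) \<longlongrightarrow> 2 * (\<integral>x. \<psi> x \<partial>\<mu>) / (\<integral>x. \<psi> x ^ 3 \<partial>\<mu>)) (at_right 1)"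
proof -
  let ?F = "at_right (1 :: real)"
  let ?N = "\<lambda>c. nrm (f c)" and ?a = "\<lambda>c. ip (f c) \<psi>"
  let ?D = "\<lambda>c. nrm (resid (f c))"
  obtain C where C: "\<And>x. \<psi> x \<le> C" using bounded_measurable_bound[OF bm_\<psi>] abs_le_D1 by metis
  have gt1: "eventually (\<lambda>c. 1 < c) ?F" by (simp add: eventually_at_right_less)
  have le2: "eventually (\<lambda>c. c \<le> 2) ?F"
    by (rule eventually_at_rightI[of 1 2]) auto
  have lim_c: "((\<lambda>c. c) \<longlongrightarrow> 1) ?F" by (rule tendsto_ident_at)
  have lim_c1: "((\<lambda>c. c - 1) \<longlongrightarrow> 0) ?F" using tendsto_diff[OF lim_c tendsto_const[of 1]] by simp
  have bmf: "bm (f c)" if "1 < c" for c using fp_bm[OF _ fp[OF that]] that by simp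
  \<comment> \<open>Here \<open>lower\<close> excludes the zero solution, which makes the quotients
    by \<open>?a c\<close> and \<open>?N c\<close> meaningful.\<close>
  have a_pos: "0 < ?a c" if "1 < c" for c
  proof -
    obtain \<delta> where \<delta>: "0 < \<delta>" "\<And>x. \<delta> * \<psi> x \<le> f c x" using lower[OF \<open>1 < c\<close>] by blast
    have "\<delta> = ip (\<lambda>x. \<delta> * \<psi> x) \<psi>" by (simp add: ip_scale_left flip: nsq_eq_ip)
    also have "\<dots> \<le> ?a c"
      unfolding ip_def using \<delta> bmf[OF that]
      by (intro integral_mono integrable_bm bm_intros mult_right_mono) auto
    finally show ?thesis using \<delta>(1) by simp
  qed
  have a_le: "?a c \<le> ?N c" if "1 < c" for c
    using abs_ip_le[OF bmf[OF that] bm_\<psi>] by simp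
  have N_pos: "0 < ?N c" if "1 < c" for c using a_pos[OF that] a_le[OF that] by linarith
  have nsq_lim: "((\<lambda>c. nsq (f c)) \<longlongrightarrow> 0) ?F"
  proof (rule tendstoI)
    fix e :: real assume e: "0 < e"
    \<comment> \<open>\<open>\<delta>\<close> is fixed first, so that the set of small
      \<open>\<psi>\<close> takes half of \<open>e\<close>; for this \<open>\<delta>\<close> the
      other term tends to 0 with \<open>c - 1\<close>.\<close>
    then obtain \<delta> where \<delta>: "0 < \<delta>" "prob {x. \<psi> x < \<delta>} < e / 2" using prob_\<psi>_small[of "e / 2"] by auto
    have "((\<lambda>c. (c - 1) * (2 * exp (2 * B)) / \<delta>) \<longlongrightarrow> 0 * (2 * exp (2 * B)) / \<delta>) ?F"
      using \<delta> by (intro tendsto_intros lim_c1) auto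
    then have "eventually (\<lambda>c. (c - 1) * (2 * exp (2 * B)) / \<delta> < e / 2) ?F"
      using e by (intro order_tendstoD(2)) auto
    with gt1 le2 show "eventually (\<lambda>c. dist (nsq (f c)) 0 < e) ?F"
    proof eventually_elim
      case (elim c)
      show ?case using fp_nsq_le[OF elim(1,2) fp[OF elim(1)] \<delta>(1)] \<delta>(2) elim(3) by simp
    qed
  qed
  have N_lim: "(?N \<longlongrightarrow> 0) ?F"
    using tendsto_real_sqrt[OF nsq_lim] by (simp add: nrm_def)
  have R_lim: "((\<lambda>c. nrm (\<lambda>x. T (f c) x - f c x) / ?N c) \<longlongrightarrow> 0) ?F"
  proof (rule tendsto_sandwich[OF _ _ tendsto_const])
    show "eventually (\<lambda>c. 0 \<le> nrm (\<lambda>x. T (f c) x - f c x) / ?N c) ?F" by simp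
    show "eventually (\<lambda>c. nrm (\<lambda>x. T (f c) x - f c x) / ?N c \<le> (c - 1) + c\<^sup>2 * B * ?N c) ?F"
      using gt1
    proof eventually_elim
      case (elim c)
      then show ?case
        using fp_residual[OF _ fp[OF elim]] N_pos[OF elim] by (simp add: divide_le_eq)
    qed
    have "((\<lambda>c. (c - 1) + c\<^sup>2 * B * ?N c) \<longlongrightarrow> 0 + 1\<^sup>2 * B * 0) ?F"
      by (intro tendsto_intros lim_c1 N_lim)
    then show "((\<lambda>c. (c - 1) + c\<^sup>2 * B * ?N c) \<longlongrightarrow> 0) ?F" by simp
  qed
  have "eventually (\<lambda>c. bm (f c) \<and> 0 < ?N c) ?F"
    using gt1 by eventually_elim (use bmf N_pos in auto)
  from projection_error_tendsto_0[OF this R_lim]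
  have DN_lim: "((\<lambda>c. ?D c / ?N c) \<longlongrightarrow> 0) ?F" .
  \<comment> \<open>As \<open>\<psi>\<close> has norm 1, the triangle inequality gives
    \<open>?N c \<le> ?D c + ?a c\<close>, and Cauchy-Schwarz gives
    \<open>?a c \<le> ?N c\<close>.\<close>
  have aN_lim: "((\<lambda>c. ?a c / ?N c) \<longlongrightarrow> 1) ?F"
  proof (rule tendsto_sandwich[OF _ _ _ tendsto_const])
    show "eventually (\<lambda>c. 1 - ?D c / ?N c \<le> ?a c / ?N c) ?F"
      using gt1
    proof eventually_elim
      case (elim c)
      note f = bmf[OF elim]
      have "nrm (\<lambda>x. (f c x - ?a c * \<psi> x) + ?a c * \<psi> x) \<le> ?D c + nrm (\<lambda>x. ?a c * \<psi> x)"
        by (intro nrm_triangle bm_intros f bm_\<psi>)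
      then have "?N c \<le> ?D c + ?a c" using a_pos[OF elim] by (simp add: nrm_scale)
      then have "(?N c - ?D c) / ?N c \<le> ?a c / ?N c"
        using N_pos[OF elim] by (intro divide_right_mono) auto
      then show ?case using N_pos[OF elim] by (simp add: diff_divide_distrib)
    qed
    show "eventually (\<lambda>c. ?a c / ?N c \<le> 1) ?F"
      using gt1 by eventually_elim (use a_le N_pos in auto)
    show "((\<lambda>c. 1 - ?D c / ?N c) \<longlongrightarrow> 1) ?F"
      using tendsto_diff[OF tendsto_const[of 1] DN_lim] by simp
  qed
  have Da_lim: "((\<lambda>c. ?D c / ?a c) \<longlongrightarrow> 0) ?F"
  proof (rule Lim_transform_eventually)
    show "((\<lambda>c. (?D c / ?N c) / (?a c / ?N c)) \<longlongrightarrow> 0) ?F"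
      using tendsto_divide[OF DN_lim aN_lim] by simp
    show "eventually (\<lambda>c. (?D c / ?N c) / (?a c / ?N c) = ?D c / ?a c) ?F"
      using gt1
    proof eventually_elim
      case (elim c)
      show ?case using N_pos[OF elim] by simp
    qed
  qed
  have a_lim: "(?a \<longlongrightarrow> 0) ?F"
  proof (rule tendsto_sandwich[OF _ _ tendsto_const N_lim])
    show "eventually (\<lambda>c. 0 \<le> ?a c) ?F" using gt1 by eventually_elim (use a_pos in \<open>auto intro: less_imp_le\<close>)
    show "eventually (\<lambda>c. ?a c \<le> ?N c) ?F" using gt1 by eventually_elim (rule a_le)
  qed
  have int_lim: "((\<lambda>c. (\<integral>x. f c x \<partial>\<mu>) / ?a c) \<longlongrightarrow> (\<integral>x. \<psi> x \<partial>\<mu>)) ?F"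
  proof (rule LIM_zero_cancel, rule tendsto_0_le[OF Da_lim, of _ 1])
    show "eventually (\<lambda>c. norm ((\<integral>x. f c x \<partial>\<mu>) / ?a c - (\<integral>x. \<psi> x \<partial>\<mu>)) \<le> norm (?D c / ?a c) * 1) ?F"
      using gt1
    proof eventually_elim
      case (elim c)
      then show ?case
        using fp_integral_approx[OF _ fp[OF elim] a_pos[OF elim]] a_pos[OF elim] by simp
    qed
  qed
  define E where "E c = c * B * (?D c / ?a c) + (c - 1) * C" for c
  have "(E \<longlongrightarrow> 1 * B * 0 + 0 * C) ?F"
    unfolding E_def[abs_def] by (intro tendsto_intros lim_c Da_lim lim_c1)
  then have E_lim: "(E \<longlongrightarrow> 0) ?F" by simp
  have "((\<lambda>c. (C + E c) ^ 3 * ?a c + E c * (2 * C + E c) / 2) \<longlongrightarrow> (C + 0) ^ 3 * 0 + 0 * (2 * C + 0) / 2) ?F"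
    by (intro tendsto_intros E_lim a_lim) simp
  then have err_lim: "((\<lambda>c. (C + E c) ^ 3 * ?a c + E c * (2 * C + E c) / 2) \<longlongrightarrow> 0) ?F" by simp
  have "((\<lambda>c. c * B * ?N c) \<longlongrightarrow> 1 * B * 0) ?F" by (intro tendsto_intros lim_c N_lim)
  then have small: "eventually (\<lambda>c. c * B * ?N c < 1) ?F" by (intro order_tendstoD(2)) auto
  have ratio_lim: "((\<lambda>c. (c - 1) / ?a c) \<longlongrightarrow> (\<integral>x. \<psi> x ^ 3 \<partial>\<mu>) / 2) ?F"
  proof (rule LIM_zero_cancel, rule tendsto_0_le[OF err_lim, of _ 1])
    show "eventually (\<lambda>c. norm ((c - 1) / ?a c - (\<integral>x. \<psi> x ^ 3 \<partial>\<mu>) / 2)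
        \<le> norm ((C + E c) ^ 3 * ?a c + E c * (2 * C + E c) / 2) * 1) ?F"
      using gt1 small
    proof eventually_elim
      case (elim c)
      have "\<bar>(c - 1) / ?a c - (\<integral>x. \<psi> x ^ 3 \<partial>\<mu>) / 2\<bar> \<le> (C + E c) ^ 3 * ?a c + E c * (2 * C + E c) / 2"
        unfolding E_def using elim
        by (intro fp_first_order fp C a_pos) auto
      then show ?case by simp
    qed
  qed
  \<comment> \<open>Dividing the two limits cancels the unknown scale \<open>?a c\<close>.\<close>
  have "((\<lambda>c. ((\<integral>x. f c x \<partial>\<mu>) / ?a c) / ((c - 1) / ?a c)) \<longlongrightarrow> (\<integral>x. \<psi> x \<partial>\<mu>) / ((\<integral>x. \<psi> x ^ 3 \<partial>\<mu>) / 2)) ?F"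
    using integral_power_\<psi>_pos[of 3] by (intro tendsto_divide int_lim ratio_lim) simp
  moreover have "eventually (\<lambda>c. ((\<integral>x. f c x \<partial>\<mu>) / ?a c) / ((c - 1) / ?a c) = (\<integral>x. f c x \<partial>\<mu>) / (c - 1)) ?F"
    using gt1
  proof eventually_elim
    case (elim c)
    then show ?case using a_pos[OF elim] by simp
  qed
  ultimately show ?thesis
    by (simp add: Lim_transform_eventually mult.commute)
qed

end

section \<open>The slope at the critical point\<close>

lemma L2norm_le_ennreal_iff:
  assumes "0 \<le> r" shows "L2norm \<mu> f \<le> ennreal r \<longleftrightarrow> (\<integral>\<^sup>+ x. (f x)\<^sup>2 \<partial>\<mu>) \<le> ennreal (r\<^sup>2)"
proof (cases "\<integral>\<^sup>+ x. (f x)\<^sup>2 \<partial>\<mu>")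
  case (real i)
  have "sqrt i \<le> r \<longleftrightarrow> i \<le> r\<^sup>2"
  proof
    assume "sqrt i \<le> r"
    then have "(sqrt i)\<^sup>2 \<le> r\<^sup>2" using real by (intro power_mono) auto
    then show "i \<le> r\<^sup>2" using real by simp
  next
    assume "i \<le> r\<^sup>2"
    then have "sqrt i \<le> sqrt (r\<^sup>2)" by (rule real_sqrt_le_mono)
    then show "sqrt i \<le> r" using assms by simp
  qed
  with real assms show ?thesis by (simp add: L2norm_def ennreal_le_iff)
next
  case top
  then show ?thesis by (simp add: L2norm_def top_unique)
qed

lemma SUP_power2_ennreal:
  fixes a :: "nat \<Rightarrow> ennreal" assumes "incseq a"
  shows "(SUP i. a i)\<^sup>2 = (SUP i. (a i)\<^sup>2)"
proof (rule antisym)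
  have "(SUP i. a i)\<^sup>2 = (SUP i. SUP j. a i * a j)"
    unfolding power2_eq_square SUP_mult_right_ennreal by (simp only: SUP_mult_left_ennreal)
  also have "\<dots> \<le> (SUP i. (a i)\<^sup>2)"
  proof (intro SUP_least)
    fix i j
    have "a i * a j \<le> (a (max i j))\<^sup>2"
      unfolding power2_eq_square using incseqD[OF assms] by (intro mult_mono) auto
    also have "\<dots> \<le> (SUP i. (a i)\<^sup>2)" by (intro SUP_upper) simp
    finally show "a i * a j \<le> (SUP i. (a i)\<^sup>2)" .
  qed
  finally show "(SUP i. a i)\<^sup>2 \<le> (SUP i. (a i)\<^sup>2)" .
  show "(SUP i. (a i)\<^sup>2) \<le> (SUP i. a i)\<^sup>2"
    by (intro SUP_least power_mono_ennreal SUP_upper) simp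
qed

lemma measurable_kernel_op:
  assumes k: "(\<lambda>p. \<kappa> (fst p) (snd p)) \<in> borel_measurable (\<mu> \<Otimes>\<^sub>M \<mu>)" and f: "f \<in> borel_measurable \<mu>"
    and "sigma_finite_measure \<mu>"
  shows "kernel_op \<mu> \<kappa> f \<in> borel_measurable \<mu>"
proof -
  interpret sigma_finite_measure \<mu> by fact
  note [measurable] = k f
  have "(\<lambda>x. \<integral>\<^sup>+ y. ennreal (\<kappa> (fst (x, y)) (snd (x, y))) * f y \<partial>\<mu>) \<in> borel_measurable \<mu>"
    by measurable
  then show ?thesis by (simp add: kernel_op_def[abs_def])
qed

text \<open>Monotone convergence inside the operator and again in the outer integral. It lets the
  supremum in the operator norm be approached along bounded functions.\<close>

lemma kernel_op_truncate:
  fixes g :: "'a \<Rightarrow> ennreal"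
  assumes k: "(\<lambda>p. \<kappa> (fst p) (snd p)) \<in> borel_measurable (\<mu> \<Otimes>\<^sub>M \<mu>)" and g: "g \<in> borel_measurable \<mu>"
    and sf: "sigma_finite_measure \<mu>" and sp: "space \<mu> = UNIV"
  shows "(\<integral>\<^sup>+ x. (kernel_op \<mu> \<kappa> g x)\<^sup>2 \<partial>\<mu>)
    = (SUP n. \<integral>\<^sup>+ x. (kernel_op \<mu> \<kappa> (\<lambda>y. inf (g y) (of_nat n)) x)\<^sup>2 \<partial>\<mu>)"
proof -
  let ?g = "\<lambda>n y. inf (g y) (of_nat n)"
  have sec: "(\<lambda>y. \<kappa> x y) \<in> borel_measurable \<mu>" for x
    using measurable_compose[OF measurable_Pair1'[of x \<mu> \<mu>] k] by (simp add: sp)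
  note [measurable] = sec g
  have inc: "incseq (\<lambda>n. kernel_op \<mu> \<kappa> (?g n) x)" for x
    unfolding kernel_op_def
    by (auto intro!: incseq_SucI nn_integral_mono mult_left_mono inf_mono)
  have "kernel_op \<mu> \<kappa> g x = (SUP n. kernel_op \<mu> \<kappa> (?g n) x)" for x
  proof -
    have "g y = (SUP n. ?g n y)" for y
      by (simp add: inf_SUP[symmetric] ennreal_SUP_of_nat_eq_top)
    then have "kernel_op \<mu> \<kappa> g x = (\<integral>\<^sup>+ y. (SUP n. ennreal (\<kappa> x y) * ?g n y) \<partial>\<mu>)"
      unfolding kernel_op_def SUP_mult_left_ennreal[symmetric] by simp
    also have "\<dots> = (SUP n. kernel_op \<mu> \<kappa> (?g n) x)"
      unfolding kernel_op_def
      by (intro nn_integral_monotone_convergence_SUP)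
        (auto intro!: incseq_SucI le_funI mult_left_mono inf_mono)
    finally show ?thesis .
  qed
  then have "(\<integral>\<^sup>+ x. (kernel_op \<mu> \<kappa> g x)\<^sup>2 \<partial>\<mu>) = (\<integral>\<^sup>+ x. (SUP n. (kernel_op \<mu> \<kappa> (?g n) x)\<^sup>2) \<partial>\<mu>)"
    by (simp add: SUP_power2_ennreal[OF inc])
  also have "\<dots> = (SUP n. \<integral>\<^sup>+ x. (kernel_op \<mu> \<kappa> (?g n) x)\<^sup>2 \<partial>\<mu>)"
  proof (rule nn_integral_monotone_convergence_SUP)
    show "incseq (\<lambda>n x. (kernel_op \<mu> \<kappa> (?g n) x)\<^sup>2)"
      using inc by (auto simp: incseq_def le_fun_def intro!: power_mono_ennreal)
    show "(\<lambda>x. (kernel_op \<mu> \<kappa> (?g n) x)\<^sup>2) \<in> borel_measurable \<mu>" for n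
      using k by (intro borel_measurable_power_ennreal measurable_kernel_op sf) auto
  qed
  finally show ?thesis .
qed

locale square_integrable_kernel = prob_space \<mu> for \<mu> :: "'a measure" +
  fixes \<kappa> :: "'a \<Rightarrow> 'a \<Rightarrow> real" and L :: real
  assumes space_UNIV: "space \<mu> = UNIV"
    and kernel_measurable: "(\<lambda>(x, y). \<kappa> x y) \<in> borel_measurable (\<mu> \<Otimes>\<^sub>M \<mu>)"
    and kernel_nonneg: "\<And>x y. 0 \<le> \<kappa> x y"
    and kernel_sym: "\<And>x y. \<kappa> x y = \<kappa> y x"
    and square_bound: "\<And>x. (\<integral>\<^sup>+ y. ennreal ((\<kappa> x y)\<^sup>2) \<partial>\<mu>) \<le> ennreal L"
    and L_pos: "0 < L"
    and irreducible: "irreducible_kernel \<mu> \<kappa>"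
    and norm_nonzero: "kernel_op_norm \<mu> \<kappa> \<noteq> 0"
begin

abbreviation (input) nn_sq :: "('a \<Rightarrow> ennreal) \<Rightarrow> ennreal" where
  "nn_sq g \<equiv> \<integral>\<^sup>+ x. (g x)\<^sup>2 \<partial>\<mu>"

lemma kernel_measurable': "(\<lambda>p. \<kappa> (fst p) (snd p)) \<in> borel_measurable (\<mu> \<Otimes>\<^sub>M \<mu>)"
  using kernel_measurable by (simp add: case_prod_beta')

lemma kernel_section [measurable]: "\<kappa> x \<in> borel_measurable \<mu>"
  using measurable_compose[OF measurable_Pair1'[of x \<mu> \<mu>] kernel_measurable'] by (simp add: space_UNIV)

lemma nn_integral_kernel_op_square_le:
  assumes g [measurable]: "g \<in> borel_measurable \<mu>"
  shows "nn_sq (kernel_op \<mu> \<kappa> g) \<le> ennreal L * nn_sq g"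
proof -
  have "(kernel_op \<mu> \<kappa> g x)\<^sup>2 \<le> ennreal L * nn_sq g" for x
  proof -
    have "(kernel_op \<mu> \<kappa> g x)\<^sup>2 \<le> (\<integral>\<^sup>+ y. (ennreal (\<kappa> x y))\<^sup>2 \<partial>\<mu>) * nn_sq g"
      unfolding kernel_op_def by (intro Cauchy_Schwarz_nn_integral) auto
    also have "\<dots> \<le> ennreal L * nn_sq g"
      using square_bound[of x] by (intro mult_right_mono) (simp_all add: ennreal_power kernel_nonneg)
    finally show ?thesis .
  qed
  then have "nn_sq (kernel_op \<mu> \<kappa> g) \<le> (\<integral>\<^sup>+ x. ennreal L * nn_sq g \<partial>\<mu>)"
    by (intro nn_integral_mono)
  then show ?thesis by (simp add: emeasure_space_1)
qed

lemma kernel_op_norm_le: "kernel_op_norm \<mu> \<kappa> \<le> ennreal (sqrt L)"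
  unfolding kernel_op_norm_def
proof (rule SUP_least, clarify)
  fix g assume g: "g \<in> borel_measurable \<mu>" "L2norm \<mu> g \<le> 1"
  then have "nn_sq g \<le> 1" using L2norm_le_ennreal_iff[of 1 \<mu> g] by simp
  then have "ennreal L * nn_sq g \<le> ennreal L * 1" by (intro mult_left_mono) auto
  with nn_integral_kernel_op_square_le[OF g(1)]
  have "nn_sq (kernel_op \<mu> \<kappa> g) \<le> ennreal L" by simp
  then show "L2norm \<mu> (kernel_op \<mu> \<kappa> g) \<le> ennreal (sqrt L)"
    using L_pos by (simp add: L2norm_le_ennreal_iff)
qed

definition c0 :: real where
  "c0 = enn2real (inverse (kernel_op_norm \<mu> \<kappa>))"

lemma kernel_op_norm_eq: "kernel_op_norm \<mu> \<kappa> = ennreal (1 / c0)" and c0_pos: "0 < c0"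
proof -
  obtain r where r: "0 \<le> r" "kernel_op_norm \<mu> \<kappa> = ennreal r"
    using kernel_op_norm_le by (cases "kernel_op_norm \<mu> \<kappa>") (auto simp: top_unique)
  with norm_nonzero have "0 < r" by (cases "r = 0") auto
  then show "kernel_op_norm \<mu> \<kappa> = ennreal (1 / c0)" "0 < c0"
    by (simp_all add: c0_def r(2) inverse_ennreal divide_inverse)
qed

lemma kernel_op_square_le_norm:
  assumes g: "g \<in> borel_measurable \<mu>" "nn_sq g \<le> 1"
  shows "nn_sq (kernel_op \<mu> \<kappa> g) \<le> ennreal ((1 / c0)\<^sup>2)"
proof -
  have "L2norm \<mu> g \<le> 1" using g(2) L2norm_le_ennreal_iff[of 1 \<mu> g] by simp
  then have "L2norm \<mu> (kernel_op \<mu> \<kappa> g) \<le> kernel_op_norm \<mu> \<kappa>"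
    unfolding kernel_op_norm_def using g(1) by (intro SUP_upper) auto
  then show ?thesis
    using c0_pos by (simp add: kernel_op_norm_eq L2norm_le_ennreal_iff del: power_divide)
qed

text \<open>A near-maximiser of the norm may be unbounded or infinite. The inequality is strict, so
  it survives truncation at some height \<open>n\<close>, and truncation does not increase the L2
  norm.\<close>

lemma exists_nearly_extremal:
  assumes r: "0 < r" "r < 1"
  obtains g where "bounded_measurable \<mu> g" "\<And>x. 0 \<le> g x"
    "nn_sq (\<lambda>x. ennreal (g x)) \<le> 1"
    "ennreal (r * (1 / c0)\<^sup>2) < nn_sq (kernel_op \<mu> \<kappa> (\<lambda>y. ennreal (g y)))"
proof -
  have "ennreal (sqrt r * (1 / c0)) < kernel_op_norm \<mu> \<kappa>"
    unfolding kernel_op_norm_eq using r c0_pos by (intro ennreal_lessI) (auto intro!: divide_strict_right_mono)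
  then obtain g where g: "g \<in> borel_measurable \<mu>" "L2norm \<mu> g \<le> 1"
      "ennreal (sqrt r * (1 / c0)) < L2norm \<mu> (kernel_op \<mu> \<kappa> g)"
    unfolding kernel_op_norm_def less_SUP_iff by auto
  have "\<not> L2norm \<mu> (kernel_op \<mu> \<kappa> g) \<le> ennreal (sqrt r * (1 / c0))" using g(3) by simp
  then have "ennreal ((sqrt r * (1 / c0))\<^sup>2) < nn_sq (kernel_op \<mu> \<kappa> g)"
    using r c0_pos by (subst (asm) L2norm_le_ennreal_iff) (auto simp: not_le)
  moreover have "(sqrt r * (1 / c0))\<^sup>2 = r * (1 / c0)\<^sup>2" using r by (simp add: power_mult_distrib power_divide)
  ultimately have "ennreal (r * (1 / c0)\<^sup>2) < nn_sq (kernel_op \<mu> \<kappa> g)" by simp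
  then obtain n where n: "ennreal (r * (1 / c0)\<^sup>2)
      < nn_sq (kernel_op \<mu> \<kappa> (\<lambda>y. inf (g y) (of_nat n)))"
    unfolding kernel_op_truncate[OF kernel_measurable' g(1) sigma_finite_measure_axioms space_UNIV] less_SUP_iff
    by auto
  let ?h = "\<lambda>y. enn2real (inf (g y) (of_nat n))"
  have fin: "inf (g y) (of_nat n) < top" for y
    using le_less_trans[OF inf.cobounded2 of_nat_less_top] by blast
  then have h: "ennreal (?h y) = inf (g y) (of_nat n)" for y by simp
  show thesis
  proof (rule that[of ?h])
    show "bounded_measurable \<mu> ?h"
    proof (rule bounded_measurableI)
      show "?h \<in> borel_measurable \<mu>" using g(1) by measurable
      fix y
      have "enn2real (inf (g y) (of_nat n)) \<le> enn2real (of_nat n)"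
        by (rule enn2real_mono) (auto simp: of_nat_less_top)
      then show "\<bar>?h y\<bar> \<le> real n" by simp
    qed
    have "nn_sq (\<lambda>x. ennreal (?h x)) \<le> nn_sq g"
      unfolding h by (intro nn_integral_mono power_mono_ennreal) simp
    also have "\<dots> \<le> 1" using g(2) L2norm_le_ennreal_iff[of 1 \<mu> g] by simp
    finally show "nn_sq (\<lambda>x. ennreal (?h x)) \<le> 1" .
    show "ennreal (r * (1 / c0)\<^sup>2) < nn_sq (kernel_op \<mu> \<kappa> (\<lambda>y. ennreal (?h y)))"
      unfolding h by (rule n)
  qed simp
qed

sublocale K: kernel_operator \<mu> "\<lambda>x y. c0 * \<kappa> x y" "c0 * sqrt L"
proof
  show "(\<lambda>(x, y). c0 * \<kappa> x y) \<in> borel_measurable (\<mu> \<Otimes>\<^sub>M \<mu>)"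
    using kernel_measurable' by (simp add: case_prod_beta')
  show "(\<integral>\<^sup>+ y. ennreal ((c0 * \<kappa> x y)\<^sup>2) \<partial>\<mu>) \<le> ennreal ((c0 * sqrt L)\<^sup>2)" for x
  proof -
    have "(\<integral>\<^sup>+ y. ennreal ((c0 * \<kappa> x y)\<^sup>2) \<partial>\<mu>) = (\<integral>\<^sup>+ y. ennreal (c0\<^sup>2) * ennreal ((\<kappa> x y)\<^sup>2) \<partial>\<mu>)"
      by (simp add: power_mult_distrib ennreal_mult)
    also have "\<dots> = ennreal (c0\<^sup>2) * (\<integral>\<^sup>+ y. ennreal ((\<kappa> x y)\<^sup>2) \<partial>\<mu>)"
      by (intro nn_integral_cmult) simp
    also have "\<dots> \<le> ennreal (c0\<^sup>2) * ennreal L" by (intro mult_left_mono square_bound) simp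
    also have "\<dots> = ennreal ((c0 * sqrt L)\<^sup>2)"
      using L_pos by (simp add: power_mult_distrib ennreal_mult)
    finally show ?thesis .
  qed
qed (use space_UNIV kernel_nonneg kernel_sym c0_pos L_pos in auto)

lemma integrable_kernel_mult:
  assumes "bounded_measurable \<mu> f" shows "integrable \<mu> (\<lambda>y. \<kappa> x y * f y)"
proof -
  have "integrable \<mu> (\<lambda>y. (1 / c0) * (c0 * \<kappa> x y * f y))"
    using K.integrable_K_mult[OF assms] by (intro integrable_mult_right)
  then show ?thesis using c0_pos by (simp add: mult.assoc)
qed

lemma kernel_op_eq_T:
  assumes f: "bounded_measurable \<mu> f" "\<And>x. 0 \<le> f x"
  shows "kernel_op \<mu> \<kappa> (\<lambda>y. ennreal (f y)) x = ennreal ((1 / c0) * K.T f x)"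
proof -
  have "kernel_op \<mu> \<kappa> (\<lambda>y. ennreal (f y)) x = (\<integral>\<^sup>+ y. ennreal (\<kappa> x y * f y) \<partial>\<mu>)"
    unfolding kernel_op_def using f(2) kernel_nonneg by (simp add: ennreal_mult)
  also have "\<dots> = ennreal (\<integral>y. \<kappa> x y * f y \<partial>\<mu>)"
    using f kernel_nonneg by (intro nn_integral_eq_integral integrable_kernel_mult) auto
  also have "(\<integral>y. \<kappa> x y * f y \<partial>\<mu>) = (1 / c0) * K.T f x"
    using c0_pos by (simp add: K.T_def mult.assoc)
  finally show ?thesis .
qed

lemma nn_integral_square_eq_nsq:
  assumes f: "bounded_measurable \<mu> f" "\<And>x. 0 \<le> f x"
  shows "nn_sq (\<lambda>x. ennreal (f x)) = ennreal (nsq f)"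
proof -
  have "nn_sq (\<lambda>x. ennreal (f x)) = (\<integral>\<^sup>+ x. ennreal ((f x)\<^sup>2) \<partial>\<mu>)"
    using f(2) by (simp add: ennreal_power)
  also have "\<dots> = ennreal (nsq f)"
    unfolding nsq_def using f by (intro nn_integral_eq_integral integrable_bm bounded_measurable_power) auto
  finally show ?thesis .
qed

lemma nn_integral_kernel_op_square:
  assumes f: "bounded_measurable \<mu> f" "\<And>x. 0 \<le> f x"
  shows "nn_sq (kernel_op \<mu> \<kappa> (\<lambda>y. ennreal (f y))) = ennreal ((1 / c0)\<^sup>2 * nsq (K.T f))"
proof -
  have "nn_sq (kernel_op \<mu> \<kappa> (\<lambda>y. ennreal (f y))) = ennreal (nsq (\<lambda>x. (1 / c0) * K.T f x))"
    unfolding kernel_op_eq_T[OF f]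
    using f c0_pos by (intro nn_integral_square_eq_nsq bounded_measurable_mult K.bm_T bounded_measurable_const)
      (auto intro!: divide_nonneg_pos K.T_nonneg)
  then show ?thesis by (simp only: nsq_scale)
qed

sublocale K: critical_kernel \<mu> "\<lambda>x y. c0 * \<kappa> x y" "c0 * sqrt L"
proof
  fix A assume A: "A \<in> sets \<mu>" and ae: "AE (x, y) in \<mu> \<Otimes>\<^sub>M \<mu>. x \<in> A \<and> y \<notin> A \<longrightarrow> c0 * \<kappa> x y = 0"
  have "AE (x, y) in \<mu> \<Otimes>\<^sub>M \<mu>. x \<in> A \<and> y \<in> space \<mu> - A \<longrightarrow> \<kappa> x y = 0"
    using ae c0_pos by (simp add: space_UNIV)
  with irreducible A show "emeasure \<mu> A = 0 \<or> emeasure \<mu> (- A) = 0"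
    unfolding irreducible_kernel_def by (auto simp: space_UNIV Compl_eq_Diff_UNIV)
next
  fix f assume f: "bounded_measurable \<mu> f" "\<And>x :: 'a. 0 \<le> f x"
  have Tf: "bounded_measurable \<mu> (K.T f)" using f by auto
  show "nsq (K.T f) \<le> nsq f"
  \<comment> \<open>The norm is a supremum over the unit ball, so \<open>f\<close> is divided by its
    norm. If that is 0, then \<open>f\<close> vanishes almost everywhere and its image is 0 at every
    point.\<close>
  proof (cases "nsq f = 0")
    case True
    then have "AE x in \<mu>. f x = 0" using f by (simp add: nsq_eq_0_iff)
    then have "K.T f = K.T (\<lambda>_. 0)"
      using f by (intro K.T_cong_AE) (auto dest: bounded_measurableD)
    then show ?thesis by (simp add: K.T_def nsq_def)
  next
    case False
    then have pos: "0 < nrm f" by (simp add: nrm_def less_le)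
    let ?g = "\<lambda>x. (1 / nrm f) * f x"
    have g: "bounded_measurable \<mu> ?g" "\<And>x. 0 \<le> ?g x" using f pos by auto
    have "nsq ?g = (1 / nrm f)\<^sup>2 * nsq f" by (rule nsq_scale)
    also have "\<dots> = 1" using False by (simp add: power_divide)
    finally have "nn_sq (\<lambda>x. ennreal (?g x)) \<le> 1"
      using nn_integral_square_eq_nsq[OF g] by simp
    then have "ennreal ((1 / c0)\<^sup>2 * nsq (K.T ?g)) \<le> ennreal ((1 / c0)\<^sup>2)"
      using kernel_op_square_le_norm[of "\<lambda>y. ennreal (?g y)"] nn_integral_kernel_op_square[OF g]
        bounded_measurableD[OF g(1)] measurable_compose[OF _ measurable_ennreal] by metis
    then have "(1 / c0)\<^sup>2 * nsq (K.T ?g) \<le> (1 / c0)\<^sup>2 * 1" by (simp add: ennreal_le_iff)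
    then have "nsq (K.T ?g) \<le> 1" using c0_pos by (subst (asm) mult_le_cancel_left_pos) auto
    moreover have "nsq (K.T ?g) = nsq (K.T f) / nsq f"
      unfolding K.T_scale nsq_scale by (simp add: power_divide)
    ultimately show ?thesis using False by (simp add: divide_le_eq less_le)
  qed
next
  fix r :: real assume r: "r < 1"
  show "\<exists>g. bounded_measurable \<mu> g \<and> nsq g \<le> 1 \<and> r \<le> nsq (K.T g)"
  proof (cases "0 < r")
    case True
    obtain g where g: "bounded_measurable \<mu> g" "\<And>x. 0 \<le> g x" "nn_sq (\<lambda>x. ennreal (g x)) \<le> 1"
        "ennreal (r * (1 / c0)\<^sup>2) < nn_sq (kernel_op \<mu> \<kappa> (\<lambda>y. ennreal (g y)))"
      using exists_nearly_extremal[OF True r] by blast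
    have "nsq g \<le> 1" using g(3) nn_integral_square_eq_nsq[OF g(1,2)] by (simp flip: ennreal_1)
    moreover have "(1 / c0)\<^sup>2 * r \<le> (1 / c0)\<^sup>2 * nsq (K.T g)"
      using g(4) True unfolding nn_integral_kernel_op_square[OF g(1,2)]
      by (subst (asm) ennreal_less_iff) (auto simp: mult.commute)
    then have "r \<le> nsq (K.T g)" using c0_pos by (subst (asm) mult_le_cancel_left_pos) auto
    ultimately show ?thesis using g(1) by blast
  next
    case False
    then have "r \<le> nsq (K.T (\<lambda>_. 0))" by (intro order_trans[OF _ nsq_nonneg]) simp
    then show ?thesis by (intro exI[of _ "\<lambda>_. 0"]) (simp add: nsq_def)
  qed
qed

end

section \<open>The slope and its extremal case\<close>

context critical_eigenfunction
begin

abbreviation slope :: real where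
  "slope \<equiv> 2 * (\<integral>x. \<psi> x \<partial>\<mu>) / (\<integral>x. \<psi> x ^ 3 \<partial>\<mu>)"

lemma cube_minus_mean:
  fixes m defines "m \<equiv> \<integral>x. \<psi> x \<partial>\<mu>"
  shows "(\<integral>x. (\<psi> x - m)\<^sup>2 * (\<psi> x + m) \<partial>\<mu>) = (\<integral>x. \<psi> x ^ 3 \<partial>\<mu>) - m"
proof -
  have "(\<integral>x. (\<psi> x - m)\<^sup>2 * (\<psi> x + m) \<partial>\<mu>) = (\<integral>x. \<psi> x ^ 3 - m * (\<psi> x)\<^sup>2 - m\<^sup>2 * \<psi> x + m ^ 3 \<partial>\<mu>)"
    by (intro Bochner_Integration.integral_cong refl) (simp add: power2_eq_square power3_eq_cube algebra_simps)
  also have "\<dots> = (\<integral>x. \<psi> x ^ 3 \<partial>\<mu>) - m * nsq \<psi> - m\<^sup>2 * m + m ^ 3"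
  proof -
    have "integrable \<mu> (\<lambda>x. \<psi> x ^ 3)" "integrable \<mu> (\<lambda>x. (\<psi> x)\<^sup>2)" "integrable \<mu> \<psi>"
      by (intro integrable_bm bounded_measurable_power bm_\<psi>)+
    then show ?thesis by (simp add: nsq_def m_def)
  qed
  also have "\<dots> = (\<integral>x. \<psi> x ^ 3 \<partial>\<mu>) - m" by (simp add: power2_eq_square power3_eq_cube)
  finally show ?thesis .
qed

text \<open>The integrand \<open>(\<psi> x - m)\<^sup>2 * (\<psi> x + m)\<close> is non-negative
  and, since \<open>m > 0\<close>, vanishes only where \<open>\<psi> x = m\<close>. So equality
  means that \<open>\<psi>\<close> is constant almost everywhere, that is, that the constant 1 is an
  eigenfunction.\<close>

lemma slope_le_2: "slope \<le> 2"
  and slope_eq_2_iff: "slope = 2 \<longleftrightarrow> (AE x in \<mu>. T (\<lambda>_. 1) x = 1)"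
proof -
  define m where "m = (\<integral>x. \<psi> x \<partial>\<mu>)"
  have m: "0 < m" using integral_power_\<psi>_pos[of 1] by (simp add: m_def)
  have defect: "(\<integral>x. (\<psi> x - m)\<^sup>2 * (\<psi> x + m) \<partial>\<mu>) = (\<integral>x. \<psi> x ^ 3 \<partial>\<mu>) - m"
    unfolding m_def by (rule cube_minus_mean)
  have nn: "0 \<le> (\<psi> x - m)\<^sup>2 * (\<psi> x + m)" for x using m by simp
  then have "m \<le> (\<integral>x. \<psi> x ^ 3 \<partial>\<mu>)"
    using defect Bochner_Integration.integral_nonneg[of \<mu> "\<lambda>x. (\<psi> x - m)\<^sup>2 * (\<psi> x + m)"] by simp
  then show "slope \<le> 2" using integral_power_\<psi>_pos[of 3] by (simp add: divide_le_eq m_def)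
  have "slope = 2 \<longleftrightarrow> (\<integral>x. (\<psi> x - m)\<^sup>2 * (\<psi> x + m) \<partial>\<mu>) = 0"
    using integral_power_\<psi>_pos[of 3] unfolding defect by (auto simp: divide_eq_eq m_def)
  also have "\<dots> \<longleftrightarrow> (AE x in \<mu>. (\<psi> x - m)\<^sup>2 * (\<psi> x + m) = 0)"
    using nn by (intro integral_nonneg_eq_0_iff_AE integrable_bm bm_intros bm_\<psi>) auto
  also have "\<dots> \<longleftrightarrow> (AE x in \<mu>. \<psi> x = m)"
  proof -
    have "(\<psi> x - m)\<^sup>2 * (\<psi> x + m) = 0 \<longleftrightarrow> \<psi> x = m" for x
      using m \<psi>_nonneg[of x] by (auto simp: add_nonneg_eq_0_iff)
    then show ?thesis by simp
  qed
  also have "\<dots> \<longleftrightarrow> (AE x in \<mu>. T (\<lambda>_. 1) x = 1)"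
  proof
    assume ae: "AE x in \<mu>. \<psi> x = m"
    have "T \<psi> = T (\<lambda>x. m * 1)" using ae by (intro T_cong_AE) auto
    then have "\<psi> = (\<lambda>x. m * T (\<lambda>_. 1) x)" unfolding T_scale T_\<psi> .
    then have eq: "\<psi> x = m * T (\<lambda>_. 1) x" for x by (rule fun_cong)
    from ae show "AE x in \<mu>. T (\<lambda>_. 1) x = 1"
    proof eventually_elim
      case (elim x)
      with eq[of x] m show ?case by simp
    qed
  next
    \<comment> \<open>Simplicity gives \<open>\<psi> = 1 / m\<close> almost everywhere; integrating
      yields \<open>m = 1 / m\<close>, so the constant is \<open>m\<close> itself.\<close>
    assume ae: "AE x in \<mu>. T (\<lambda>_. 1) x = 1"
    have "ip (\<lambda>_. 1) \<psi> = m" by (simp add: ip_def m_def)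
    with eigenfunction_unique_AE[of "\<lambda>_. 1"] ae
    have one: "AE x in \<mu>. 1 = m * \<psi> x" by simp
    then have "AE x in \<mu>. \<psi> x = 1 / m" by eventually_elim (use m in \<open>simp add: field_simps\<close>)
    moreover from this have "m = (\<integral>x. 1 / m \<partial>\<mu>)" unfolding m_def[symmetric]
      by (subst (1) m_def, intro integral_cong_AE) auto
    then have "m = 1 / m" by simp
    ultimately show "AE x in \<mu>. \<psi> x = m" by simp
  qed
  finally show "slope = 2 \<longleftrightarrow> (AE x in \<mu>. T (\<lambda>_. 1) x = 1)" .
qed

end

section \<open>Survival probabilities and their one-sided derivative\<close>

context square_integrable_kernel
begin

lemma poisson_branching_scaled:
  assumes "0 \<le> c" shows "poisson_branching \<mu> (\<lambda>x y. c * \<kappa> x y)"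
proof
  show "(\<lambda>(x, y). c * \<kappa> x y) \<in> borel_measurable (\<mu> \<Otimes>\<^sub>M \<mu>)"
    using kernel_measurable' by (simp add: case_prod_beta')
  show "0 \<le> c * \<kappa> x y" for x y using assms kernel_nonneg by simp
  show "(\<integral>\<^sup>+ y. ennreal (c * \<kappa> x y) \<partial>\<mu>) < \<infinity>" for x
  proof -
    have "integrable \<mu> (\<lambda>y. c * \<kappa> x y)" using integrable_kernel_mult[of "\<lambda>_. c" x] by (simp add: mult.commute)
    then have "(\<integral>\<^sup>+ y. ennreal (c * \<kappa> x y) \<partial>\<mu>) = ennreal (\<integral>y. c * \<kappa> x y \<partial>\<mu>)"
      using assms kernel_nonneg by (intro nn_integral_eq_integral) auto
    then show ?thesis by simp
  qed
qed

text \<open>The parameter \<open>b\<close> stands for \<open>c / c0\<close>, so that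
  \<open>b = 1\<close> is critical.\<close>

definition survival :: "real \<Rightarrow> 'a \<Rightarrow> real" where
  "survival b = survival_prob_at \<mu> (\<lambda>x y. b * c0 * \<kappa> x y)"

text \<open>Isolates what the later analysis needs from the branching process: the complements of
  the extinction probabilities and their recursion.\<close>

lemma survival_approx:
  assumes b: "0 \<le> b"
  obtains s where "s 0 = (\<lambda>_. 1)" "\<And>n x. s (Suc n) x = 1 - exp (- (b * K.T (s n) x))"
    "\<And>n. bounded_measurable \<mu> (s n)" "\<And>n x. 0 \<le> s n x" "\<And>n x. s n x \<le> 1"
    "\<And>x. (\<lambda>n. s n x) \<longlonglongrightarrow> survival b x"
proof -
  interpret B: poisson_branching \<mu> "\<lambda>x y. b * c0 * \<kappa> x y"
    using b c0_pos by (intro poisson_branching_scaled) simp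
  let ?s = "\<lambda>n x. 1 - B.extinction n x"
  show thesis
  proof (rule that[of ?s])
    show "?s (Suc n) x = 1 - exp (- (b * K.T (?s n) x))" for n x
    proof -
      have "(\<integral>z. b * c0 * \<kappa> x z * ?s n z \<partial>\<mu>) = (\<integral>z. b * (c0 * \<kappa> x z * ?s n z) \<partial>\<mu>)"
        by (simp only: mult.assoc)
      then show ?thesis by (simp add: B.gen_op_def K.T_def)
    qed
    show "bounded_measurable \<mu> (?s n)" for n
    proof (rule bounded_measurableI)
      show "\<bar>?s n x\<bar> \<le> 1" for x using B.extinction_bounds[of n x] by simp
    qed simp
    show "(\<lambda>n. ?s n x) \<longlonglongrightarrow> survival b x" for x
      unfolding survival_def by (rule B.survival_prob_at_LIMSEQ) (simp add: space_UNIV)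
  qed (use B.extinction_bounds in auto)
qed

text \<open>Dominated convergence under \<open>K.T\<close> carries the recursion to the limit at
  every \<open>x\<close>.\<close>

lemma bounded_survival:
  assumes "0 \<le> b"
  shows "bounded_measurable \<mu> (survival b)" "0 \<le> survival b x" "survival b x = 1 - exp (- (b * K.T (survival b) x))"
proof -
  obtain s where "s 0 = (\<lambda>_. 1)" and s: "\<And>n x. s (Suc n) x = 1 - exp (- (b * K.T (s n) x))"
    "\<And>n. bounded_measurable \<mu> (s n)" "\<And>n x. 0 \<le> s n x" "\<And>n x. s n x \<le> 1"
    "\<And>x. (\<lambda>n. s n x) \<longlonglongrightarrow> survival b x"
    by (rule survival_approx[OF assms]) (rule that)
  have meas: "survival b \<in> borel_measurable \<mu>"
    by (rule borel_measurable_LIMSEQ_real[OF s(5)]) (rule bounded_measurableD[OF s(2)])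
  show nonneg: "0 \<le> survival b x" for x
    by (rule LIMSEQ_le_const[OF s(5)]) (use s(3) in auto)
  have le: "survival b x \<le> 1" for x
    by (rule LIMSEQ_le_const2[OF s(5)]) (use s(4) in auto)
  show "bounded_measurable \<mu> (survival b)"
    by (rule bounded_measurableI[OF meas, of 1]) (use nonneg le in auto)
  have "\<bar>s n x\<bar> \<le> 1" for n x using s(3,4)[of n x] by simp
  then have "(\<lambda>n. K.T (s n) x) \<longlonglongrightarrow> K.T (survival b) x"
    by (rule K.T_LIMSEQ[OF bounded_measurableD[OF s(2)] meas s(5)])
  then have "(\<lambda>n. 1 - exp (- (b * K.T (s n) x))) \<longlonglongrightarrow> 1 - exp (- (b * K.T (survival b) x))"
    by (intro tendsto_intros)
  moreover have "(\<lambda>n. 1 - exp (- (b * K.T (s n) x))) \<longlonglongrightarrow> survival b x"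
    using LIMSEQ_Suc[OF s(5)[of x]] by (simp only: s(1))
  ultimately show "survival b x = 1 - exp (- (b * K.T (survival b) x))"
    by (rule LIMSEQ_unique[symmetric])
qed

lemma survival_prob_scaled:
  assumes "c0 * b = c" shows "survival_prob \<mu> (\<lambda>x y. c * \<kappa> x y) = (\<integral>x. survival b x \<partial>\<mu>)"
  by (simp add: survival_prob_def survival_def assms[symmetric] mult.commute)

theorem survival_prob_derivative:
  defines "\<rho> \<equiv> \<lambda>c. survival_prob \<mu> (\<lambda>x y. c * \<kappa> x y)"
  shows "\<exists>\<rho>'. (\<rho> has_real_derivative \<rho>') (at_right c0) \<and> c0 * \<rho>' \<le> 2 \<and>
    (c0 * \<rho>' = 2 \<longleftrightarrow> (AE x in \<mu>. (\<integral>y. c0 * \<kappa> x y \<partial>\<mu>) = 1))"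
    and "(AE x in \<mu>. (\<integral>y. \<kappa> x y \<partial>\<mu>) = 1) \<Longrightarrow> c0 = 1"
proof -
  obtain \<psi> where \<psi>: "bounded_measurable \<mu> \<psi>" "K.T \<psi> = \<psi>" "\<And>x. 0 \<le> \<psi> x" "AE x in \<mu>. 0 < \<psi> x" "nsq \<psi> = 1"
    using K.exists_positive_eigenfunction by blast
  interpret E: critical_eigenfunction \<mu> "\<lambda>x y. c0 * \<kappa> x y" "c0 * sqrt L" \<psi>
    by standard (use \<psi> in auto)
  have fp: "E.survival_fixpoint b (survival b)" if "0 \<le> b" for b
    unfolding E.survival_fixpoint_def using bounded_survival[OF that] by blast
  have lower: "\<exists>\<delta>>0. \<forall>x. \<delta> * \<psi> x \<le> survival b x" if b: "1 < b" for b
  proof -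
    obtain s where s: "s 0 = (\<lambda>_. 1)" "\<And>n x. s (Suc n) x = 1 - exp (- (b * K.T (s n) x))"
      "\<And>n. bounded_measurable \<mu> (s n)" "\<And>n x. 0 \<le> s n x" "\<And>n x. s n x \<le> 1"
      "\<And>x. (\<lambda>n. s n x) \<longlonglongrightarrow> survival b x"
      by (rule survival_approx[of b]) (use b in auto)
    obtain \<delta> where \<delta>: "0 < \<delta>" "\<And>x. \<delta> * \<psi> x \<le> 1"
      "\<And>g x. bounded_measurable \<mu> g \<Longrightarrow> (\<And>y. \<delta> * \<psi> y \<le> g y) \<Longrightarrow> \<delta> * \<psi> x \<le> 1 - exp (- (b * K.T g x))"
      using E.fixpoint_supersolution[OF b] by metis
    have "\<delta> * \<psi> x \<le> s n x" for n x
      by (induction n arbitrary: x) (simp_all add: s(1,2) \<delta>(2) \<delta>(3)[OF s(3)])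
    then have "\<delta> * \<psi> x \<le> survival b x" for x
      by (intro LIMSEQ_le_const[OF s(6)]) auto
    with \<delta>(1) show ?thesis by blast
  qed
  have lim: "((\<lambda>b. (\<integral>x. survival b x \<partial>\<mu>) / (b - 1)) \<longlongrightarrow> E.slope) (at_right 1)"
    by (rule E.survival_asymptotics) (use fp lower in auto)
  \<comment> \<open>Since survival has probability 0 at criticality, the difference quotient at
    \<open>c0\<close> is \<open>\<rho> c / (c - c0)\<close>.\<close>
  have crit: "\<rho> c0 = 0"
  proof -
    have "AE x in \<mu>. survival 1 x = 0" by (rule E.fp_subcritical[OF _ fp]) auto
    then have "(\<integral>x. survival 1 x \<partial>\<mu>) = 0" by (intro integral_eq_zero_AE) auto
    then show ?thesis unfolding \<rho>_def by (subst survival_prob_scaled[of 1]) auto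
  qed
  \<comment> \<open>The substitution \<open>b = c / c0\<close> transports the one-sided limit from 1
    to \<open>c0\<close> and produces the factor \<open>1 / c0\<close>.\<close>
  have "filterlim (\<lambda>c. c / c0) (at_right 1) (at_right c0)"
  proof (rule filterlim_at_withinI)
    have "((\<lambda>c. c / c0) \<longlongrightarrow> c0 / c0) (at_right c0)"
      using c0_pos by (intro tendsto_intros tendsto_ident_at) auto
    then show "((\<lambda>c. c / c0) \<longlongrightarrow> 1) (at_right c0)" using c0_pos by simp
    show "eventually (\<lambda>c. c / c0 \<in> {1<..} - {1}) (at_right c0)"
      using eventually_at_right_less[of c0] by eventually_elim (use c0_pos in simp)
  qed
  from tendsto_divide[OF filterlim_compose[OF lim this] tendsto_const[of c0]]
  have "((\<lambda>c. (\<integral>x. survival (c / c0) x \<partial>\<mu>) / (c / c0 - 1) / c0) \<longlongrightarrow> E.slope / c0) (at_right c0)"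
    using c0_pos by simp
  moreover have "(\<integral>x. survival (c / c0) x \<partial>\<mu>) / (c / c0 - 1) / c0 = (\<rho> c - \<rho> c0) / (c - c0)" for c
  proof -
    have "\<rho> c = (\<integral>x. survival (c / c0) x \<partial>\<mu>)"
      unfolding \<rho>_def using c0_pos by (intro survival_prob_scaled) simp
    moreover have "(c / c0 - 1) * c0 = c - c0" using c0_pos by (simp add: left_diff_distrib)
    ultimately show ?thesis by (simp only: crit divide_divide_eq_left diff_zero)
  qed
  ultimately have "((\<lambda>c. (\<rho> c - \<rho> c0) / (c - c0)) \<longlongrightarrow> E.slope / c0) (at_right c0)"
    by simp
  then have deriv: "(\<rho> has_real_derivative E.slope / c0) (at_right c0)"
    by (simp add: has_field_derivative_iff)
  have T1: "K.T (\<lambda>_. 1) = (\<lambda>x. \<integral>y. c0 * \<kappa> x y \<partial>\<mu>)"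
    by (simp add: K.T_def fun_eq_iff)
  show "\<exists>\<rho>'. (\<rho> has_real_derivative \<rho>') (at_right c0) \<and> c0 * \<rho>' \<le> 2 \<and>
    (c0 * \<rho>' = 2 \<longleftrightarrow> (AE x in \<mu>. (\<integral>y. c0 * \<kappa> x y \<partial>\<mu>) = 1))"
  proof (intro exI conjI)
    have "c0 * (E.slope / c0) = E.slope" using c0_pos by simp
    then show "c0 * (E.slope / c0) \<le> 2" "c0 * (E.slope / c0) = 2 \<longleftrightarrow> (AE x in \<mu>. (\<integral>y. c0 * \<kappa> x y \<partial>\<mu>) = 1)"
      using E.slope_le_2 E.slope_eq_2_iff unfolding T1 by simp_all
  qed (rule deriv)
  assume one: "AE x in \<mu>. (\<integral>y. \<kappa> x y \<partial>\<mu>) = 1"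
  \<comment> \<open>If almost all row integrals of \<kappa> are 1, then
    \<open>K.T (\<lambda>_. 1)\<close> equals \<open>c0\<close> almost everywhere. Computing its
    pairing with \<open>\<psi>\<close> in two ways shows that \<open>c0\<close> times the integral
    of \<open>\<psi>\<close> equals that integral, which is positive.\<close>
  have "ip (K.T (\<lambda>_. 1)) \<psi> = ip (\<lambda>_. 1) \<psi>" by (rule E.ip_T_\<psi>) simp
  moreover have "ip (K.T (\<lambda>_. 1)) \<psi> = c0 * (\<integral>x. \<psi> x \<partial>\<mu>)"
  proof -
    have "ip (K.T (\<lambda>_. 1)) \<psi> = (\<integral>x. c0 * \<psi> x \<partial>\<mu>)"
      unfolding ip_def
    proof (rule integral_cong_AE)
      have "bounded_measurable \<mu> (\<lambda>x. K.T (\<lambda>_. 1) x * \<psi> x)" by auto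
      then show "(\<lambda>x. K.T (\<lambda>_. 1) x * \<psi> x) \<in> borel_measurable \<mu>" by (rule bounded_measurableD)
      show "AE x in \<mu>. K.T (\<lambda>_. 1) x * \<psi> x = c0 * \<psi> x"
        unfolding T1 using one by eventually_elim simp
    qed simp
    then show ?thesis by simp
  qed
  moreover have "ip (\<lambda>_. 1) \<psi> = (\<integral>x. \<psi> x \<partial>\<mu>)" by (simp add: ip_def)
  ultimately show "c0 = 1" using E.integral_power_\<psi>_pos[of 1] by simp
qed

end

text \<open>The product \<open>c0 * \<rho>'\<close> is unchanged when \<kappa> is multiplied by a
  positive constant, whereas row integrals equal to 1 depend on the scale. Equality is therefore
  characterised by the row integrals of \<open>c0 * \<kappa>\<close>, and the version for \<kappa>
  itself carries the normalisation \<open>c0 = 1\<close>. \<open>norm_nonzero\<close> expresses that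
  the inverse of the norm is finite; for norm 0 the inverse is infinite and \<open>enn2real\<close>
  would return 0.\<close>

theorem corollary3p18:
  fixes \<mu> :: "'s::{metric_space, second_countable_topology} measure"
    and \<kappa> :: "'s \<Rightarrow> 's \<Rightarrow> real"
    and c0 :: real and \<rho> :: "real \<Rightarrow> real"
  assumes ground: "ground_space \<mu>"
    and kernel: "kernel_fun \<kappa>"
    and irreducible: "irreducible_kernel \<mu> \<kappa>"
    and bounded: "(SUP x. \<integral>\<^sup>+ y. ennreal ((\<kappa> x y)\<^sup>2) \<partial>\<mu>) < \<infinity>"
    and norm_nonzero: "kernel_op_norm \<mu> \<kappa> \<noteq> 0"
  defines "c0 \<equiv> enn2real (inverse (kernel_op_norm \<mu> \<kappa>))"
    and "\<rho> \<equiv> (\<lambda>c. survival_prob \<mu> (\<lambda>x y. c * \<kappa> x y))"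
  shows "0 < c0 \<and>
    (\<exists>\<rho>'. (\<rho> has_real_derivative \<rho>') (at_right c0) \<and>
       c0 * \<rho>' \<le> 2 \<and>
       ((\<forall>x y. \<kappa> x y = 1) \<longrightarrow> c0 * \<rho>' = 2) \<and>
       (c0 * \<rho>' = 2 \<longleftrightarrow> (AE x in \<mu>. (\<integral>y. c0 * \<kappa> x y \<partial>\<mu>) = 1)) \<and>
       (c0 = 1 \<and> c0 * \<rho>' = 2 \<longleftrightarrow> (AE x in \<mu>. (\<integral>y. \<kappa> x y \<partial>\<mu>) = 1)))"
proof -
  have sets_\<mu>: "sets \<mu> = sets borel" and prob: "prob_space \<mu>"
    using ground by (simp_all add: ground_space_def)
  interpret prob_space \<mu> by fact
  have space_\<mu>: "space \<mu> = UNIV" using sets_eq_imp_space_eq[OF sets_\<mu>] by simp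
  let ?S = "SUP x. \<integral>\<^sup>+ y. ennreal ((\<kappa> x y)\<^sup>2) \<partial>\<mu>"
  obtain l where l: "0 \<le> l" "?S = ennreal l" using bounded by (cases ?S) auto
  \<comment> \<open>\<open>l + 1\<close> rather than \<open>l\<close>, so that the bound on the rows
    is strictly positive.\<close>
  interpret S: square_integrable_kernel \<mu> \<kappa> "l + 1"
  proof
    show "space \<mu> = UNIV" by (rule space_\<mu>)
    have "sets (\<mu> \<Otimes>\<^sub>M \<mu>) = sets (borel :: ('s \<times> 's) measure)"
      unfolding borel_prod[symmetric] by (intro sets_pair_measure_cong sets_\<mu>)
    then show "(\<lambda>(x, y). \<kappa> x y) \<in> borel_measurable (\<mu> \<Otimes>\<^sub>M \<mu>)"
      using kernel by (simp add: kernel_fun_def cong: measurable_cong_sets)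
    show "(\<integral>\<^sup>+ y. ennreal ((\<kappa> x y)\<^sup>2) \<partial>\<mu>) \<le> ennreal (l + 1)" for x
    proof -
      have "(\<integral>\<^sup>+ y. ennreal ((\<kappa> x y)\<^sup>2) \<partial>\<mu>) \<le> ?S" by (intro SUP_upper) simp
      also have "\<dots> \<le> ennreal (l + 1)" unfolding l(2) by (intro ennreal_leI) simp
      finally show ?thesis .
    qed
  qed (use kernel irreducible norm_nonzero l in \<open>auto simp: kernel_fun_def\<close>)
  have c0: "c0 = S.c0" by (simp add: c0_def S.c0_def)
  obtain \<rho>' where \<rho>': "(\<rho> has_real_derivative \<rho>') (at_right c0)" "c0 * \<rho>' \<le> 2"
      "c0 * \<rho>' = 2 \<longleftrightarrow> (AE x in \<mu>. (\<integral>y. c0 * \<kappa> x y \<partial>\<mu>) = 1)"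
    using S.survival_prob_derivative(1) unfolding \<rho>_def c0 by blast
  have one: "c0 = 1" if "AE x in \<mu>. (\<integral>y. \<kappa> x y \<partial>\<mu>) = 1"
    unfolding c0 using that by (rule S.survival_prob_derivative(2))
  have two: "c0 = 1 \<and> c0 * \<rho>' = 2 \<longleftrightarrow> (AE x in \<mu>. (\<integral>y. \<kappa> x y \<partial>\<mu>) = 1)"
  proof
    assume "c0 = 1 \<and> c0 * \<rho>' = 2"
    moreover from this have "AE x in \<mu>. (\<integral>y. c0 * \<kappa> x y \<partial>\<mu>) = 1" using \<rho>'(3) by blast
    ultimately show "AE x in \<mu>. (\<integral>y. \<kappa> x y \<partial>\<mu>) = 1" by simp
  next
    assume "AE x in \<mu>. (\<integral>y. \<kappa> x y \<partial>\<mu>) = 1"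
    with one[OF this] \<rho>'(3) show "c0 = 1 \<and> c0 * \<rho>' = 2" by simp
  qed
  have "c0 * \<rho>' = 2" if "\<forall>x y. \<kappa> x y = 1"
  proof -
    have "AE x in \<mu>. (\<integral>y. \<kappa> x y \<partial>\<mu>) = 1" using that by (simp add: S.K.prob_UNIV)
    with two show ?thesis by blast
  qed
  with \<rho>' two S.c0_pos show ?thesis unfolding c0 by blast
qed

end
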